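(* Let $F$ be a field of characteristic $2$ and let $\varphi,\psi$ be totally singular quadratic forms over $F$ that are Vishik equivalent. Let $K/F$ be a field extension such that $K^2=G_F(\varphi)$. Assume that $(\varphi_K)_{\mathrm{an}}$ is a special quasi-Pfister neighbor over $K$ given by the triple $(\pi,b,\sigma)$, and that $c\pi\subseteq\psi_K$ for some $c\in K^*$. Moreover, suppose that $\sigma$ is either a quasi-Pfister form, a quasi-Pfister neighbor of codimension one, or a minimal form (over $K$). Then $\varphi$ and $\psi$ are similar (over $F$).
   Context: A totally singular quadratic form over a field $F$ of characteristic $2$ is a map $\varphi:V\to F$ on a finite-dimensional $F$-vector space $V$ with $\varphi(av)=a^2\varphi(v)$ and $\varphi(v+w)=\varphi(v)+\varphi(w)$; $\dim\varphi=\dim V$. Write $\langle a_1,\dots,a_n\rangle$ for $(x_i)\mapsto\sum a_ix_i^2$ on $F^n$. $\perp$ is the orthogonal sum (concatenation of diagonal coefficients), and $\langle a_1,\dots,a_n\rangle\otimes\psi=a_1\psi\perp\dots\perp a_n\psi$. Isometry $\varphi\simeq\psi$: there is a bijective linear $f$ with $\varphi(v)=\psi(f(v))$; if $f$ is only injective, $\varphi$ is a subform of $\psi$, written $\varphi\subseteq\psi$. Similar: $\varphi\simeq c\psi$ for some $c\in F^*$. Isotropic: vanishing at some nonzero vector; anisotropic otherwise. $\varphi\simeq\varphi_{\mathrm{an}}\perp k\times\langle0\rangle$ with $\varphi_{\mathrm{an}}$ anisotropic (unique up to isometry); the defect is $\mathfrak{i}_{\mathrm d}(\varphi)=k$. For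 $E/F$, $\varphi_E$ on $E\otimes_FV$ is given by $\varphi_E(e\otimes v)=e^2\varphi(v)$. Vishik equivalence: $\dim\varphi=\dim\psi$ and $\mathfrak{i}_{\mathrm d}(\varphi_E)=\mathfrak{i}_{\mathrm d}(\psi_E)$ for every field extension $E/F$. $G_F(\varphi)=\{x\in F^*\mid x\varphi\simeq\varphi\}\cup\{0\}$, and $K^2=\{x^2\mid x\in K\}$. The following notions are over an arbitrary field $F$ of characteristic $2$ (and are applied over $K$). An $n$-fold quasi-Pfister form is $\langle\!\langle a_1,\dots,a_n\rangle\!\rangle=\langle1,a_1\rangle\otimes\dots\otimes\langle1,a_n\rangle$ (and $\langle1\rangle$ for $n=0$). $\varphi$ is a quasi-Pfister neighbor (of $\pi$) if $c\varphi\subseteq\pi$ for some $c\in F^*$ and quasi-Pfister form $\pi$ with $\dim\varphi>\frac12\dim\pi$; its codimension is $\dim\pi-\dim\varphi$. $\varphi$ is a special quasi-Pfister neighbor given by the triple $(\pi,b,\sigma)$ if $\varphi$ is similar to $\pi\perp b\sigma$ with $\pi$ a quasi-Pfister form over $F$, $b\in F^*$ and $\sigma\subseteq\pi$. With $D_F^*(\varphi)$ the set of nonzero values of $\varphi$, $N_F(\varphi)=F^2(x/y\mid x,y\in D_F^*(\varphi))$ and $\mathrm{ndeg}_F\varphi=[N_F(\varphi):F^2]$. An anisotropic form $\varphi$ is minimal over $F$ if $\mathrm{ndeg}_F\varphi=2^{\dim\varphi-1}$. *)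

theory Defs
  imports
    "HOL-Algebra.Embedded_Algebras"
    "HOL-Algebra.Generated_Fields"
    "Jordan_Normal_Form.Missing_VectorSpace"
begin

section \<open>Totally singular quadratic forms in characteristic 2\<close>

text \<open>
  A form is a vector space together with its quadratic map. The \<open>mult\<close> and \<open>one\<close> fields of the
  record \<open>qspace\<close>, inherited from \<open>ring\<close>, carry no meaning.
\<close>

record ('a, 'v) qform =
  qspace :: "('a, 'v) module"
  qf :: "'v \<Rightarrow> 'a"

locale totally_singular_form = vectorspace F "qspace Q"
  for F :: "('a, 'm) ring_scheme" (structure) and Q :: "('a, 'v) qform" +
  assumes char2: "\<one>\<^bsub>F\<^esub> \<oplus>\<^bsub>F\<^esub> \<one>\<^bsub>F\<^esub> = \<zero>\<^bsub>F\<^esub>"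
    and finite_dim: "fin_dim"
    and qf_closed: "v \<in> carrier (qspace Q) \<Longrightarrow> qf Q v \<in> carrier F"
    and qf_smult: "a \<in> carrier F \<Longrightarrow> v \<in> carrier (qspace Q)
      \<Longrightarrow> qf Q (a \<odot>\<^bsub>qspace Q\<^esub> v) = a [^]\<^bsub>F\<^esub> (2::nat) \<otimes>\<^bsub>F\<^esub> qf Q v"
    and qf_add: "v \<in> carrier (qspace Q) \<Longrightarrow> w \<in> carrier (qspace Q)
      \<Longrightarrow> qf Q (v \<oplus>\<^bsub>qspace Q\<^esub> w) = qf Q v \<oplus>\<^bsub>F\<^esub> qf Q w"

abbreviation nonzero :: "('a, 'm) ring_scheme \<Rightarrow> 'a set" where
  "nonzero F \<equiv> carrier F - {\<zero>\<^bsub>F\<^esub>}"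

abbreviation form_dim :: "('a, 'm) ring_scheme \<Rightarrow> ('a, 'v) qform \<Rightarrow> nat" where
  "form_dim F P \<equiv> vectorspace.dim F (qspace P)"

definition diag_form :: "('a, 'm) ring_scheme \<Rightarrow> 'a list \<Rightarrow> ('a, nat \<Rightarrow> 'a) qform" where
  "diag_form F as = \<lparr>qspace = ring.func_space F {..<length as},
     qf = (\<lambda>x. \<Oplus>\<^bsub>F\<^esub>i\<in>{..<length as}. as ! i \<otimes>\<^bsub>F\<^esub> x i [^]\<^bsub>F\<^esub> (2::nat))\<rparr>"

definition orth_sum ::
    "('a, 'm) ring_scheme \<Rightarrow> ('a, 'v) qform \<Rightarrow> ('a, 'w) qform \<Rightarrow> ('a, 'v \<times> 'w) qform" where
  "orth_sum F P Q = \<lparr>qspace = direct_sum (qspace P) (qspace Q),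
     qf = (\<lambda>(v, w). qf P v \<oplus>\<^bsub>F\<^esub> qf Q w)\<rparr>"

definition scale_form :: "('a, 'm) ring_scheme \<Rightarrow> 'a \<Rightarrow> ('a, 'v) qform \<Rightarrow> ('a, 'v) qform" where
  "scale_form F c P = P\<lparr>qf := (\<lambda>v. c \<otimes>\<^bsub>F\<^esub> qf P v)\<rparr>"

definition isometric :: "('a, 'm) ring_scheme \<Rightarrow> ('a, 'v) qform \<Rightarrow> ('a, 'w) qform \<Rightarrow> bool" where
  "isometric F P Q \<longleftrightarrow> (\<exists>f. linear_map F (qspace P) (qspace Q) f
     \<and> bij_betw f (carrier (qspace P)) (carrier (qspace Q))
     \<and> (\<forall>v\<in>carrier (qspace P). qf P v = qf Q (f v)))"

definition subform :: "('a, 'm) ring_scheme \<Rightarrow> ('a, 'v) qform \<Rightarrow> ('a, 'w) qform \<Rightarrow> bool" where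
  "subform F P Q \<longleftrightarrow> (\<exists>f. linear_map F (qspace P) (qspace Q) f \<and> inj_on f (carrier (qspace P))
     \<and> (\<forall>v\<in>carrier (qspace P). qf P v = qf Q (f v)))"

definition similar :: "('a, 'm) ring_scheme \<Rightarrow> ('a, 'v) qform \<Rightarrow> ('a, 'w) qform \<Rightarrow> bool" where
  "similar F P Q \<longleftrightarrow> (\<exists>c\<in>nonzero F. isometric F P (scale_form F c Q))"

definition anisotropic :: "('a, 'm) ring_scheme \<Rightarrow> ('a, 'v) qform \<Rightarrow> bool" where
  "anisotropic F P \<longleftrightarrow> (\<forall>v\<in>carrier (qspace P). qf P v = \<zero>\<^bsub>F\<^esub> \<longrightarrow> v = \<zero>\<^bsub>qspace P\<^esub>)"

definition anisotropic_decomposition ::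
    "('a, 'm) ring_scheme \<Rightarrow> ('a, 'v) qform \<Rightarrow> ('a, 'w) qform \<Rightarrow> nat \<Rightarrow> bool" where
  "anisotropic_decomposition F P A k \<longleftrightarrow> totally_singular_form F A \<and> anisotropic F A
     \<and> isometric F P (orth_sum F A (diag_form F (replicate k \<zero>\<^bsub>F\<^esub>)))"

text \<open>The form \<open>A\<close> is (a representative of the isometry class of) the anisotropic part of \<open>P\<close>.\<close>

definition anisotropic_part ::
    "('a, 'm) ring_scheme \<Rightarrow> ('a, 'v) qform \<Rightarrow> ('a, 'w) qform \<Rightarrow> bool" where
  "anisotropic_part F P A \<longleftrightarrow> (\<exists>k. anisotropic_decomposition F P A k)"

text \<open>
  Here and in \<open>codim1_quasi_Pfister_neighbor\<close> below, a form that is bound existentially has its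
  vectors in the type \<open>nat \<Rightarrow> 'a\<close>. This is no restriction: every totally singular form over \<open>F\<close> is
  isometric to a diagonal form \<open>diag_form F as\<close>, which lives on that type.
\<close>

definition defect :: "('a, 'm) ring_scheme \<Rightarrow> ('a, 'v) qform \<Rightarrow> nat" where
  "defect F P = (THE k. \<exists>A :: ('a, nat \<Rightarrow> 'a) qform. anisotropic_decomposition F P A k)"


section \<open>Extension of scalars and Vishik equivalence\<close>

text \<open>
  A field extension \<open>E/F\<close> is given by a ring homomorphism \<open>i\<close> from \<open>F\<close> to the field \<open>E\<close>, which is
  automatically injective. The space \<open>E \<otimes>\<^sub>F V\<close> is represented by its coordinates with respect to
  the \<open>E\<close>-basis \<open>1 \<otimes> b\<^sub>0, 1 \<otimes> b\<^sub>1, \<dots>\<close>, where \<open>b\<^sub>0, b\<^sub>1, \<dots>\<close> is a basis of \<open>V\<close> over \<open>F\<close>. In these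
  coordinates the form with \<open>e \<otimes> v \<mapsto> e\<^sup>2 P(v)\<close> is diagonal with coefficients \<open>i (P(b\<^sub>j))\<close>.
  Different bases give isometric results. The lemmas \<open>base_change_is_tensor\<close> and
  \<open>base_change_totally_singular\<close> confirm that this is the extension of scalars.
\<close>

definition basis_list :: "('a, 'm) ring_scheme \<Rightarrow> ('a, 'v) qform \<Rightarrow> 'v list" where
  "basis_list F P = (SOME bs. distinct bs \<and> vectorspace.basis F (qspace P) (set bs))"

definition base_change ::
    "('a, 'm) ring_scheme \<Rightarrow> ('e, 'n) ring_scheme \<Rightarrow> ('a \<Rightarrow> 'e) \<Rightarrow> ('a, 'v) qform
     \<Rightarrow> ('e, nat \<Rightarrow> 'e) qform" where
  "base_change F E i P = diag_form E (map (\<lambda>b. i (qf P b)) (basis_list F P))"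

lemma finsum_func_space_apply:
  assumes "field E" "finite A" "\<And>x. x \<in> A \<Longrightarrow> f x \<in> carrier (ring.func_space E S)" "s \<in> S"
  shows "(\<Oplus>\<^bsub>ring.func_space E S\<^esub>x\<in>A. f x) s = (\<Oplus>\<^bsub>E\<^esub>x\<in>A. f x s)"
proof -
  interpret field E by fact
  interpret S: module E "func_space S" by (rule func_space_is_module)
  show ?thesis using assms(2,3)
  proof (induction A rule: finite_induct)
    case empty
    then show ?case using assms(4) by (simp add: S.M.finsum_empty) (simp add: func_space_def)
  next
    case (insert x A)
    have "f \<in> A \<rightarrow> carrier (func_space S)" "f x \<in> carrier (func_space S)" using insert by auto
    moreover have "(\<lambda>x. f x s) \<in> A \<rightarrow> carrier E" "f x s \<in> carrier E"
      using insert.prems assms(4) by (auto simp: func_space_def)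
    ultimately show ?case using insert assms(4)
      by (simp add: S.M.finsum_insert finsum_insert) (simp add: func_space_def)
  qed
qed

definition coord_vec :: "('e,'n) ring_scheme \<Rightarrow> nat \<Rightarrow> nat \<Rightarrow> nat \<Rightarrow> 'e" where
 "coord_vec E n j = (\<lambda>k\<in>{..<n}. if k = j then \<one>\<^bsub>E\<^esub> else \<zero>\<^bsub>E\<^esub>)"

lemma coord_vec_inj: "field E \<Longrightarrow> inj_on (coord_vec E n) {..<n}"
  apply (rule inj_onI)
  subgoal for x y
    apply (drule fun_cong[of _ _ x])
    apply (auto simp: coord_vec_def split: if_splits dest: domain.one_not_zero[OF field.axioms(1)])
    done
  done

lemma coord_vec_basis:
  assumes "field E"
  shows "vectorspace.basis E (ring.func_space E {..<n}) (coord_vec E n ` {..<n})"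
proof -
  interpret field E by fact
  let ?V = "func_space {..<n} :: ('a, nat \<Rightarrow> 'a) module"
  interpret V: vectorspace E "?V"
    using func_space_is_module field_axioms by (simp add: vectorspace_def)
  let ?B = "coord_vec E n ` {..<n}"
  have B: "finite ?B" "?B \<subseteq> carrier ?V"
    by (auto simp: coord_vec_def func_space_def split: if_splits)
  have ev: "V.lincomb a ?B k = a (coord_vec E n k)" if "a \<in> ?B \<rightarrow> carrier E" "k < n" for a k
  proof -
    have c: "a (coord_vec E n j) \<odot>\<^bsub>?V\<^esub> coord_vec E n j \<in> carrier ?V" if "j<n" for j
      using that \<open>a \<in> _\<close> B by auto
    have "V.lincomb a ?B k = (\<Oplus>\<^bsub>?V\<^esub>j\<in>{..<n}. a (coord_vec E n j) \<odot>\<^bsub>?V\<^esub> coord_vec E n j) k"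
      unfolding V.lincomb_def
      by (subst V.M.add.finprod_reindex) (use c coord_vec_inj[OF assms] in auto)
    also have "\<dots> = (\<Oplus>\<^bsub>E\<^esub>j\<in>{..<n}. (a (coord_vec E n j) \<odot>\<^bsub>?V\<^esub> coord_vec E n j) k)"
      by (rule finsum_func_space_apply) (use c that assms in auto)
    also have "\<dots> = (\<Oplus>\<^bsub>E\<^esub>j\<in>{..<n}. if k = j then a (coord_vec E n j) else \<zero>\<^bsub>E\<^esub>)"
      by (rule finsum_cong') (use that in \<open>auto simp: func_space_def coord_vec_def Pi_iff\<close>)
    also have "\<dots> = a (coord_vec E n k)"
      by (rule add.finprod_singleton) (use that in auto)
    finally show ?thesis .
  qed
  have cV: "carrier ?V = {..<n} \<rightarrow>\<^sub>E carrier E" by (simp add: func_space_def)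
  have ext: "V.lincomb a ?B = v" if "a \<in> ?B \<rightarrow> carrier E" "v \<in> carrier ?V"
     "\<And>k. k < n \<Longrightarrow> a (coord_vec E n k) = v k" for a v
  proof (rule extensionalityI[of _ "{..<n}"])
    have "V.lincomb a ?B \<in> carrier ?V" using B that by auto
    then show "V.lincomb a ?B \<in> extensional {..<n}" unfolding cV PiE_def by (rule IntD2)
    show "v \<in> extensional {..<n}" using that(2) unfolding cV PiE_def by (rule IntD2)
  qed (use that ev in auto)
  show ?thesis
    unfolding V.basis_criterion[OF B]
  proof (intro allI impI ex_ex1I conjI)
    fix v assume v: "v \<in> carrier ?V"
    let ?a = "\<lambda>u\<in>?B. v (the_inv_into {..<n} (coord_vec E n) u)"
    have e: "?a (coord_vec E n k) = v k" if "k < n" for k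
      using that by (simp add: the_inv_into_f_f[OF coord_vec_inj[OF assms]])
    have "?a u \<in> carrier E" if "u \<in> ?B" for u
    proof -
      from that obtain k where k: "k < n" and u: "u = coord_vec E n k" by blast
      have "v k \<in> carrier E" using v[unfolded cV] by (rule PiE_mem) (simp add: k)
      then show ?thesis unfolding u e[OF k] .
    qed
    then have "?a \<in> ?B \<rightarrow> carrier E" by (rule Pi_I)
    then have "?a \<in> ?B \<rightarrow>\<^sub>E carrier E" "V.lincomb ?a ?B = v"
      by (simp_all only: PiE_def Int_iff restrict_extensional ext[OF _ v e])
    then show "\<exists>a. a \<in> ?B \<rightarrow>\<^sub>E carrier E \<and> V.lincomb a ?B = v" by (intro exI conjI)
  next
    fix v a b
    assume "a \<in> ?B \<rightarrow>\<^sub>E carrier E \<and> V.lincomb a ?B = v" "b \<in> ?B \<rightarrow>\<^sub>E carrier E \<and> V.lincomb b ?B = v"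
    then show "a = b"
      by (intro extensionalityI[of _ ?B]) (auto simp: PiE_def ev[symmetric])
  qed
qed


text \<open>Coordinates of a vector with respect to a finite basis \<open>B\<close>.\<close>

definition coords :: "('a, 'm) ring_scheme \<Rightarrow> ('a, 'v, 'y) module_scheme \<Rightarrow> 'v set \<Rightarrow> 'v \<Rightarrow> 'v \<Rightarrow> 'a" where
  "coords F V B v = (THE a. a \<in> B \<rightarrow>\<^sub>E carrier F \<and> module.lincomb V a B = v)"

context vectorspace begin

lemma coords:
  assumes "finite B" "basis B" "v \<in> carrier V"
  shows "coords K V B v \<in> B \<rightarrow>\<^sub>E carrier K" "lincomb (coords K V B v) B = v"
proof -
  have "B \<subseteq> carrier V" using assms by (simp add: basis_def)
  from theI'[OF basis_criterion[THEN iffD1, rule_format, OF assms(1) this assms(2,3)]]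
  show "coords K V B v \<in> B \<rightarrow>\<^sub>E carrier K" "lincomb (coords K V B v) B = v"
   by (auto simp: coords_def)
qed

lemma coords_unique:
  assumes "finite B" "basis B" "v \<in> carrier V" "a \<in> B \<rightarrow> carrier K" "lincomb a B = v" "u \<in> B"
  shows "coords K V B v u = a u"
proof -
  have B: "B \<subseteq> carrier V" using assms by (simp add: basis_def)
  have "lincomb (restrict a B) B = v"
    using assms B by (auto simp: lincomb_def intro!: M.finsum_cong' simp: Pi_iff subset_iff)
  moreover have "restrict a B \<in> B \<rightarrow>\<^sub>E carrier K" using assms by auto
  ultimately have "coords K V B v = restrict a B"
    using basis_criterion[THEN iffD1, rule_format, OF assms(1) B assms(2,3)] coords[OF assms(1-3)]
    by blast
  then show ?thesis using assms by simp
qed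

end

text \<open>
  The map \<open>t\<close> plays the role of \<open>v \<mapsto> 1 \<otimes> v\<close>: it is linear along \<open>i\<close> and carries an \<open>F\<close>-basis of \<open>V\<close> to
  an \<open>E\<close>-basis, so its target is \<open>E \<otimes>\<^sub>F V\<close>. With \<open>base_change_totally_singular\<close> below,
  the last conjunct gives the value \<open>e\<^sup>2 P(v)\<close> at \<open>e \<otimes> v\<close>.
\<close>

lemma base_change_is_tensor:
  fixes F :: "('a, 'm) ring_scheme" and P :: "('a, 'v) qform" and E :: "('e, 'n) ring_scheme"
  assumes P: "totally_singular_form F P" and E: "field E" and i: "i \<in> ring_hom F E"
  defines "Q \<equiv> base_change F E i P"
  shows "\<exists>t. t \<in> carrier (qspace P) \<rightarrow> carrier (qspace Q)
    \<and> (\<forall>v\<in>carrier (qspace P). \<forall>w\<in>carrier (qspace P).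
          t (v \<oplus>\<^bsub>qspace P\<^esub> w) = t v \<oplus>\<^bsub>qspace Q\<^esub> t w)
    \<and> (\<forall>a\<in>carrier F. \<forall>v\<in>carrier (qspace P). t (a \<odot>\<^bsub>qspace P\<^esub> v) = i a \<odot>\<^bsub>qspace Q\<^esub> t v)
    \<and> (\<exists>B. finite B \<and> vectorspace.basis F (qspace P) B
          \<and> inj_on t B \<and> vectorspace.basis E (qspace Q) (t ` B))
    \<and> (\<forall>v\<in>carrier (qspace P). qf Q (t v) = i (qf P v))"
    (is "\<exists>t. ?P1 t \<and> ?P2 t \<and> ?P3 t \<and> ?P4 t \<and> ?P5 t")
proof -
  interpret P: totally_singular_form F P by fact
  interpret E: field E by fact
  interpret i: ring_hom_cring F E i 
    by (intro ring_hom_cringI P.R.is_cring E.is_cring i) 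
  obtain B0 where "finite B0" "P.basis B0" using P.finite_basis_exists[OF P.finite_dim] by blast
  moreover obtain bs where "set bs = B0" "distinct bs" using finite_distinct_list calculation by blast
  ultimately have "\<exists>bs. distinct bs \<and> P.basis (set bs)" by blast
  from someI_ex[OF this] obtain bs where bs: "bs = basis_list F P" "distinct bs" "P.basis (set bs)"
    unfolding basis_list_def by blast
  define n where "n = length bs"
  define B where "B = set bs"
  have B: "finite B" "P.basis B" "B \<subseteq> carrier (qspace P)" using bs by (auto simp: B_def P.basis_def)
  define co where "co = coords F (qspace P) B"
  have bij: "bij_betw ((!) bs) {..<n} B" using bs by (auto simp: n_def B_def intro: bij_betw_nth)
  have nth: "bs ! j \<in> B" if "j < n" for j using that by (auto simp: n_def B_def)
  have co: "co v u \<in> carrier F" if "v \<in> carrier (qspace P)" "u \<in> B" for u v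
    using P.coords[OF B(1,2) that(1)] that by (auto simp: co_def)
  have lc: "P.lincomb (co v) B = v" if "v \<in> carrier (qspace P)" for v
    using P.coords[OF B(1,2) that(1)] that by (auto simp: co_def)
  note cu = P.coords_unique[OF B(1,2), folded co_def]
  have Q: "qspace Q = E.func_space {..<n}"
    by (simp add: Q_def base_change_def diag_form_def n_def bs)
  have Qq: "qf Q x = (\<Oplus>\<^bsub>E\<^esub>j\<in>{..<n}. i (qf P (bs ! j)) \<otimes>\<^bsub>E\<^esub> x j [^]\<^bsub>E\<^esub> (2::nat))"
    if "x \<in> {..<n} \<rightarrow> carrier E" for x
    unfolding Q_def base_change_def diag_form_def bs(1)[symmetric]
    by (auto intro!: E.finsum_cong' simp: n_def) 
      (use that nth B P.qf_closed in \<open>auto simp: n_def Pi_iff subset_iff\<close>)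
  define t where "t v = (\<lambda>j\<in>{..<n}. i (co v (bs ! j)))" for v
  have t1: "?P1 t" using co nth by (auto simp: t_def Q E.func_space_def)
  have co_add: "co (v \<oplus>\<^bsub>qspace P\<^esub> w) u = co v u \<oplus>\<^bsub>F\<^esub> co w u"
    if "v \<in> carrier (qspace P)" "w \<in> carrier (qspace P)" "u \<in> B" for v w u
  proof (rule cu)
    show "P.lincomb (\<lambda>u. co v u \<oplus>\<^bsub>F\<^esub> co w u) B = v \<oplus>\<^bsub>qspace P\<^esub> w"
      using that co B by (subst P.lincomb_sum) (auto simp: lc)
  qed (use that co in auto)
  have co_smult: "co (a \<odot>\<^bsub>qspace P\<^esub> v) u = a \<otimes>\<^bsub>F\<^esub> co v u"
    if "a \<in> carrier F" "v \<in> carrier (qspace P)" "u \<in> B" for a v u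
  proof (rule cu)
    show "P.lincomb (\<lambda>u. a \<otimes>\<^bsub>F\<^esub> co v u) B = a \<odot>\<^bsub>qspace P\<^esub> v"
      using that co B by (subst P.lincomb_smult) (auto simp: lc)
  qed (use that co in auto)
  have co_basis: "co v u = (if u = v then \<one>\<^bsub>F\<^esub> else \<zero>\<^bsub>F\<^esub>)" if "u \<in> B" "v \<in> B" for u v
  proof (rule cu)
    have "P.lincomb (\<lambda>u. if u = v then \<one>\<^bsub>F\<^esub> else \<zero>\<^bsub>F\<^esub>) B
      = (\<Oplus>\<^bsub>qspace P\<^esub>u\<in>B. if v = u then u else \<zero>\<^bsub>qspace P\<^esub>)"
      unfolding P.lincomb_def by (rule P.M.finsum_cong') (use B in auto)
    also have "\<dots> = v" by (rule P.M.add.finprod_singleton) (use B that in auto)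
    finally show "P.lincomb (\<lambda>u. if u = v then \<one>\<^bsub>F\<^esub> else \<zero>\<^bsub>F\<^esub>) B = v" .
  qed (use that B in auto)
  have t2: "?P2 t"
    using nth co by (auto simp: t_def Q E.func_space_def co_add fun_eq_iff restrict_def)
  have t3: "?P3 t"
    using nth co by (auto simp: t_def Q E.func_space_def co_smult fun_eq_iff restrict_def)
  have tb: "t (bs ! j) = coord_vec E n j" if "j < n" for j
    using that nth bs(2) by (auto simp: t_def coord_vec_def co_basis nth_eq_iff_index_eq n_def fun_eq_iff restrict_def)
  have Bn: "B = (!) bs ` {..<n}" using bij by (simp add: bij_betw_def)
  have "inj_on t B" unfolding Bn
    using coord_vec_inj[OF E] tb by (auto simp: inj_on_def)
  moreover have "t ` B = coord_vec E n ` {..<n}"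
    unfolding Bn image_image using tb by (intro image_cong) auto
  ultimately have t4: "?P4 t"
    using B coord_vec_basis[OF E] Q by metis
  have t5: "?P5 t"
  proof
    fix v assume v: "v \<in> carrier (qspace P)"
    have fin: "qf P (P.lincomb a A) = (\<Oplus>\<^bsub>F\<^esub>u\<in>A. a u [^]\<^bsub>F\<^esub> (2::nat) \<otimes>\<^bsub>F\<^esub> qf P u)"
      if "finite A" "A \<subseteq> B" "a \<in> A \<rightarrow> carrier F" for a A
      using that
    proof (induction A rule: finite_induct)
      case empty
      have "qf P (\<zero>\<^bsub>F\<^esub> \<odot>\<^bsub>qspace P\<^esub> \<zero>\<^bsub>qspace P\<^esub>) = \<zero>\<^bsub>F\<^esub>"
        by (subst P.qf_smult) (auto simp: P.qf_closed numeral_2_eq_2)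
      then show ?case by (simp add: P.lincomb_def)
    next
      case (insert u A)
      have "u \<in> carrier (qspace P)" "A \<subseteq> carrier (qspace P)" using insert B by auto
      with insert show ?case
        apply (simp add: P.lincomb_def)
        apply (subst P.M.finsum_insert)
        apply (auto simp: P.qf_add P.qf_smult Pi_iff subset_iff P.qf_closed P.finsum_insert)
        done
    qed
    have "qf P v = (\<Oplus>\<^bsub>F\<^esub>u\<in>B. co v u [^]\<^bsub>F\<^esub> (2::nat) \<otimes>\<^bsub>F\<^esub> qf P u)"
      using fin[of B "co v"] lc[OF v] B co[OF v] by auto
    also have "\<dots> = (\<Oplus>\<^bsub>F\<^esub>j\<in>{..<n}. co v (bs!j) [^]\<^bsub>F\<^esub> (2::nat) \<otimes>\<^bsub>F\<^esub> qf P (bs!j))"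
      unfolding Bn by (subst P.R.add.finprod_reindex)
        (use bij nth co[OF v] B P.qf_closed in \<open>auto simp: bij_betw_def subset_iff\<close>)
    finally have "i (qf P v) = (\<Oplus>\<^bsub>E\<^esub>j\<in>{..<n}. i (co v (bs!j) [^]\<^bsub>F\<^esub> (2::nat) \<otimes>\<^bsub>F\<^esub> qf P (bs!j)))"
      by simp (subst i.hom_finsum, use nth co[OF v] B P.qf_closed in \<open>auto simp: subset_iff o_def\<close>)
    also have "\<dots> = (\<Oplus>\<^bsub>E\<^esub>j\<in>{..<n}. i (qf P (bs ! j)) \<otimes>\<^bsub>E\<^esub> t v j [^]\<^bsub>E\<^esub> (2::nat))"
      by (rule E.finsum_cong') (use nth co[OF v] B P.qf_closed in 
        \<open>auto simp: subset_iff t_def i.hom_mult numeral_2_eq_2 E.m_comm Pi_iff\<close>)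
    finally show "qf Q (t v) = i (qf P v)"
      using t1 v by (subst Qq) (auto simp: Q E.func_space_def Pi_iff)
  qed
  show ?thesis using t1 t2 t3 t4 t5 by blast
qed

lemma diag_form_totally_singular:
  assumes "field F" "\<one>\<^bsub>F\<^esub> \<oplus>\<^bsub>F\<^esub> \<one>\<^bsub>F\<^esub> = \<zero>\<^bsub>F\<^esub>" "set as \<subseteq> carrier F"
  shows "totally_singular_form F (diag_form F as)"
proof -
  interpret field F by fact
  let ?V = "func_space {..<length as} :: ('a, nat \<Rightarrow> 'a) module"
  interpret V: vectorspace F "?V"
    using func_space_is_module field_axioms by (simp add: vectorspace_def)
  have as: "as ! j \<in> carrier F" if "j < length as" for j using that assms(3) by auto
  have dbl: "x \<oplus>\<^bsub>F\<^esub> x = \<zero>\<^bsub>F\<^esub>" if "x \<in> carrier F" for x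
    using l_distr[OF one_closed one_closed that] assms(2) that by simp
  have sq: "(x \<oplus>\<^bsub>F\<^esub> y) [^]\<^bsub>F\<^esub> (2::nat) = x [^]\<^bsub>F\<^esub> (2::nat) \<oplus>\<^bsub>F\<^esub> y [^]\<^bsub>F\<^esub> (2::nat)"
    if xy: "x \<in> carrier F" "y \<in> carrier F" for x y
  proof -
    have "(x \<oplus>\<^bsub>F\<^esub> y) [^]\<^bsub>F\<^esub> (2::nat)
        = x \<otimes>\<^bsub>F\<^esub> x \<oplus>\<^bsub>F\<^esub> (x \<otimes>\<^bsub>F\<^esub> y \<oplus>\<^bsub>F\<^esub> x \<otimes>\<^bsub>F\<^esub> y) \<oplus>\<^bsub>F\<^esub> y \<otimes>\<^bsub>F\<^esub> y"
      using xy by (simp add: numeral_2_eq_2) algebra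
    then show ?thesis using xy dbl[of "x \<otimes>\<^bsub>F\<^esub> y"] by (simp add: numeral_2_eq_2)
  qed
  have V: "qspace (diag_form F as) = ?V" by (simp add: diag_form_def)
  show ?thesis
  proof (intro totally_singular_form.intro totally_singular_form_axioms.intro, unfold V)
    show "vectorspace F ?V" ..
    show "V.fin_dim"
      using coord_vec_basis[OF assms(1), of "length as"]
      unfolding V.fin_dim_def V.basis_def by (intro exI[of _ "coord_vec F (length as) ` {..<length as}"]) auto
  next
    fix v assume v: "v \<in> carrier ?V"
    then show "qf (diag_form F as) v \<in> carrier F"
      using as by (auto simp: diag_form_def func_space_def Pi_iff intro!: finsum_closed)
    fix w assume w: "w \<in> carrier ?V"
    have vw: "v j \<in> carrier F" "w j \<in> carrier F" if "j < length as" for j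
      using v w that by (auto simp: func_space_def)
    have "(\<Oplus>\<^bsub>F\<^esub>i\<in>{..<length as}. as ! i \<otimes>\<^bsub>F\<^esub> (v \<oplus>\<^bsub>?V\<^esub> w) i [^]\<^bsub>F\<^esub> (2::nat))
      = (\<Oplus>\<^bsub>F\<^esub>i\<in>{..<length as}. as ! i \<otimes>\<^bsub>F\<^esub> v i [^]\<^bsub>F\<^esub> (2::nat) \<oplus>\<^bsub>F\<^esub> as ! i \<otimes>\<^bsub>F\<^esub> w i [^]\<^bsub>F\<^esub> (2::nat))"
      by (intro finsum_cong') (simp_all add: func_space_def as vw sq r_distr)
    also have "\<dots> = (\<Oplus>\<^bsub>F\<^esub>i\<in>{..<length as}. as ! i \<otimes>\<^bsub>F\<^esub> v i [^]\<^bsub>F\<^esub> (2::nat))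
      \<oplus>\<^bsub>F\<^esub> (\<Oplus>\<^bsub>F\<^esub>i\<in>{..<length as}. as ! i \<otimes>\<^bsub>F\<^esub> w i [^]\<^bsub>F\<^esub> (2::nat))"
      by (intro finsum_addf) (simp_all add: as vw)
    finally show "qf (diag_form F as) (v \<oplus>\<^bsub>?V\<^esub> w) = qf (diag_form F as) v \<oplus>\<^bsub>F\<^esub> qf (diag_form F as) w"
      by (simp add: diag_form_def)
  next
    fix a v assume a: "a \<in> carrier F" and v: "v \<in> carrier ?V"
    have vj: "v j \<in> carrier F" if "j < length as" for j
      using v that by (auto simp: func_space_def)
    have "(\<Oplus>\<^bsub>F\<^esub>i\<in>{..<length as}. as ! i \<otimes>\<^bsub>F\<^esub> (a \<odot>\<^bsub>?V\<^esub> v) i [^]\<^bsub>F\<^esub> (2::nat))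
      = (\<Oplus>\<^bsub>F\<^esub>i\<in>{..<length as}. a [^]\<^bsub>F\<^esub> (2::nat) \<otimes>\<^bsub>F\<^esub> (as ! i \<otimes>\<^bsub>F\<^esub> v i [^]\<^bsub>F\<^esub> (2::nat)))"
      by (intro finsum_cong') (simp_all add: func_space_def as a vj nat_pow_distrib m_lcomm)
    also have "\<dots> = a [^]\<^bsub>F\<^esub> (2::nat) \<otimes>\<^bsub>F\<^esub> (\<Oplus>\<^bsub>F\<^esub>i\<in>{..<length as}. as ! i \<otimes>\<^bsub>F\<^esub> v i [^]\<^bsub>F\<^esub> (2::nat))"
      by (intro finsum_rdistr[symmetric]) (simp_all add: as a vj)
    finally show "qf (diag_form F as) (a \<odot>\<^bsub>?V\<^esub> v) = a [^]\<^bsub>F\<^esub> (2::nat) \<otimes>\<^bsub>F\<^esub> qf (diag_form F as) v"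
      by (simp add: diag_form_def)
  qed (use assms in auto)
qed

lemma base_change_totally_singular:
  assumes P: "totally_singular_form F P" and E: "field E" and i: "i \<in> ring_hom F E"
  shows "totally_singular_form E (base_change F E i P)"
proof -
  interpret P: totally_singular_form F P by fact
  interpret E: field E by fact
  interpret i: ring_hom_cring F E i
    by (intro ring_hom_cringI P.R.is_cring E.is_cring i)
  obtain B where B: "finite B" "P.basis B" using P.finite_basis_exists[OF P.finite_dim] by blast
  then have "\<exists>bs. distinct bs \<and> P.basis (set bs)" using finite_distinct_list by metis
  from someI_ex[OF this] have "P.basis (set (basis_list F P))"
    unfolding basis_list_def by blast
  then have bs: "set (basis_list F P) \<subseteq> carrier (qspace P)" by (simp add: P.basis_def)
  show ?thesis
    unfolding base_change_def
  proof (rule diag_form_totally_singular)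
    show "\<one>\<^bsub>E\<^esub> \<oplus>\<^bsub>E\<^esub> \<one>\<^bsub>E\<^esub> = \<zero>\<^bsub>E\<^esub>"
      using i.hom_add[of "\<one>\<^bsub>F\<^esub>" "\<one>\<^bsub>F\<^esub>"] P.char2 by simp
  qed (use E bs P.qf_closed in auto)
qed

text \<open>
  HOL cannot quantify over all types inside a formula, so the extensions \<open>E\<close> range over all fields
  whose elements belong to the type \<open>'a list\<close>. Up to isomorphism these include every finitely
  generated extension of \<open>F\<close>, as such an extension has at most \<open>max (card F) \<aleph>\<^sub>0\<close> elements. Finitely
  generated extensions detect all defects: for an arbitrary \<open>E/F\<close>, writing down anisotropic
  decompositions of \<open>P\<^sub>E\<close> and \<open>Q\<^sub>E\<close> involves finitely many elements of \<open>E\<close> only, and over the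
  subextension generated by them \<open>P\<close> and \<open>Q\<close> have the same defects as over \<open>E\<close>. Hence the condition
  is equivalent to equality of defects over all field extensions of \<open>F\<close>, on whatever type.
\<close>

definition vishik_equivalent ::
    "'a ring \<Rightarrow> ('a, 'v) qform \<Rightarrow> ('a, 'w) qform \<Rightarrow> bool" where
  "vishik_equivalent F P Q \<longleftrightarrow> form_dim F P = form_dim F Q
     \<and> (\<forall>(E :: 'a list ring) i. field E \<longrightarrow> i \<in> ring_hom F E
          \<longrightarrow> defect E (base_change F E i P) = defect E (base_change F E i Q))"

definition similarity_factors :: "('a, 'm) ring_scheme \<Rightarrow> ('a, 'v) qform \<Rightarrow> 'a set" where
  "similarity_factors F P = {x \<in> nonzero F. isometric F (scale_form F x P) P} \<union> {\<zero>\<^bsub>F\<^esub>}"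

definition squares :: "('a, 'm) ring_scheme \<Rightarrow> 'a set" where
  "squares K = (\<lambda>x. x [^]\<^bsub>K\<^esub> (2::nat)) ` carrier K"


section \<open>Quasi-Pfister forms, neighbors and minimal forms\<close>

definition diag_tensor :: "('a, 'm) ring_scheme \<Rightarrow> 'a list \<Rightarrow> 'a list \<Rightarrow> 'a list" where
  "diag_tensor F as bs = concat (map (\<lambda>a. map (\<lambda>b. a \<otimes>\<^bsub>F\<^esub> b) bs) as)"

definition Pfister_coeffs :: "('a, 'm) ring_scheme \<Rightarrow> 'a list \<Rightarrow> 'a list" where
  "Pfister_coeffs F as = foldr (\<lambda>a cs. diag_tensor F [\<one>\<^bsub>F\<^esub>, a] cs) as [\<one>\<^bsub>F\<^esub>]"

definition quasi_Pfister :: "('a, 'm) ring_scheme \<Rightarrow> ('a, 'v) qform \<Rightarrow> bool" where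
  "quasi_Pfister F P \<longleftrightarrow>
     (\<exists>as. set as \<subseteq> carrier F \<and> isometric F P (diag_form F (Pfister_coeffs F as)))"

definition quasi_Pfister_neighbor_of ::
    "('a, 'm) ring_scheme \<Rightarrow> ('a, 'v) qform \<Rightarrow> ('a, 'w) qform \<Rightarrow> bool" where
  "quasi_Pfister_neighbor_of F P T \<longleftrightarrow> totally_singular_form F P \<and> totally_singular_form F T
     \<and> quasi_Pfister F T \<and> (\<exists>c\<in>nonzero F. subform F (scale_form F c P) T)
     \<and> 2 * form_dim F P > form_dim F T"

definition codim1_quasi_Pfister_neighbor ::
    "('a, 'm) ring_scheme \<Rightarrow> ('a, 'v) qform \<Rightarrow> bool" where
  "codim1_quasi_Pfister_neighbor F P \<longleftrightarrow>
     (\<exists>T :: ('a, nat \<Rightarrow> 'a) qform. quasi_Pfister_neighbor_of F P T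
        \<and> form_dim F T - form_dim F P = 1)"

definition special_quasi_Pfister_neighbor ::
    "('a, 'm) ring_scheme \<Rightarrow> ('a, 'v) qform \<Rightarrow> ('a, 'w) qform \<Rightarrow> 'a \<Rightarrow> ('a, 'u) qform \<Rightarrow> bool" where
  "special_quasi_Pfister_neighbor F P p b s \<longleftrightarrow>
     totally_singular_form F P \<and> totally_singular_form F p \<and> totally_singular_form F s
     \<and> quasi_Pfister F p \<and> b \<in> nonzero F \<and> subform F s p
     \<and> similar F P (orth_sum F p (scale_form F b s))"

definition nonzero_values :: "('a, 'm) ring_scheme \<Rightarrow> ('a, 'v) qform \<Rightarrow> 'a set" where
  "nonzero_values F P = qf P ` carrier (qspace P) - {\<zero>\<^bsub>F\<^esub>}"

definition norm_field :: "('a, 'm) ring_scheme \<Rightarrow> ('a, 'v) qform \<Rightarrow> 'a set" where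
  "norm_field F P = generate_field F (squares F
     \<union> {x \<otimes>\<^bsub>F\<^esub> inv\<^bsub>F\<^esub> y | x y. x \<in> nonzero_values F P \<and> y \<in> nonzero_values F P})"

definition norm_degree :: "('a, 'm) ring_scheme \<Rightarrow> ('a, 'v) qform \<Rightarrow> nat" where
  "norm_degree F P = ring.dim F (squares F) (norm_field F P)"

text \<open>
  The condition \<open>ndeg P = 2\<^bsup>dim P - 1\<^esup>\<close> is written without subtraction, so that the
  zero-dimensional form (of norm degree 1) does not become minimal through \<open>0 - 1 = 0\<close> on \<open>nat\<close>.
\<close>

definition minimal_form :: "('a, 'm) ring_scheme \<Rightarrow> ('a, 'v) qform \<Rightarrow> bool" where
  "minimal_form F P \<longleftrightarrow> totally_singular_form F P \<and> anisotropic F P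
     \<and> 2 * norm_degree F P = 2 ^ form_dim F P"

end

theory Submission
  imports Defs
begin

text \<open>
  A totally singular form \<open>P\<close> over \<open>F\<close> is additive and multiplies by \<open>a\<^sup>2\<close> when a vector is multiplied
  by \<open>a\<close>, so its value set \<open>D(P)\<close> is a subspace of \<open>F\<close> over the field \<open>F\<^sup>2\<close> of squares. Dimension and value
  set determine \<open>P\<close> up to isometry (\<open>isometric_iff\<close>), and the defect is \<open>dim P - dim D(P)\<close>
  (\<open>defect_eq\<close>). The theorem thus concerns subspaces of a field, and similarity means \<open>D(\<psi>) = x D(\<phi>)\<close>.

  Let \<open>M\<close> be a field between \<open>F\<^sup>2\<close> and \<open>F\<close>. Squaring embeds \<open>F\<close> into \<open>M\<close>, and the value set of \<open>P\<close> over this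
  extension of \<open>F\<close> consists of the squares of the elements of the \<open>M\<close>-span of \<open>D(P)\<close>. Vishik equivalence
  therefore says at least that the \<open>M\<close>-spans of \<open>D(\<phi>)\<close> and \<open>D(\<psi>)\<close> have the same dimension for every such
  \<open>M\<close> (\<open>vishik_equivalent_subspan_dim\<close>), and this suffices.

  Let \<open>G = K\<^sup>2\<close>. Since \<open>G\<close> comes from similarity factors of \<open>\<phi>\<close>, the value set \<open>A\<close> of \<open>\<phi>\<close> over \<open>K\<close> is the
  image of \<open>D(\<phi>)\<close> itself. Let \<open>B\<close> be the value set of \<open>\<psi>\<close> over \<open>K\<close>. By hypothesis \<open>A = e(P + bS)\<close> and
  \<open>cP \<subseteq> B\<close>, where \<open>P = D(\<pi>)\<close> is a field and \<open>S = D(\<sigma>) \<subseteq> P\<close>; after scaling, \<open>e = c = 1\<close>. For \<open>S \<noteq> 0\<close> the span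
  of \<open>A\<close> over the field \<open>P + bP\<close> is this field, so the same holds for \<open>B\<close>. Hence \<open>B = P + bT\<close> with
  \<open>T \<subseteq> P\<close>, and the spans of \<open>S\<close> and \<open>T\<close> over every field between \<open>G\<close> and \<open>P\<close> have equal dimensions
  (\<open>second_summand\<close>). It remains to find \<open>x\<close> with \<open>T = xS\<close>.

  If \<open>\<sigma>\<close> is a quasi-Pfister form or a neighbor of codimension one, then \<open>S\<close> has codimension at most one in
  \<open>eQ\<close> for a field \<open>Q \<subseteq> P\<close>. Then \<open>T \<subseteq> tQ\<close> for some \<open>t\<close>, and two hyperplanes of a field are always
  similar: if \<open>s\<^sub>1, \<dots>, s\<^sub>n\<close> form a basis of the one and \<open>H\<close> is the other, the hyperplanes \<open>H/s\<^sub>i\<close> have a common nonzero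
  element, as there are fewer of them than the dimension of \<open>Q\<close> (\<open>hyperplanes_similar\<close>).

  If \<open>\<sigma>\<close> is minimal, let \<open>1 \<in> S\<close>. Each \<open>a \<in> S\<close> outside \<open>G\<close> is a ratio of elements of \<open>T\<close>, so that \<open>T\<close> contains
  a line \<open>t\<langle>1, a\<rangle>\<close>. As \<open>T\<close> is minimal too, any two of these lines for \<open>G\<close>-independent \<open>1, a, a'\<close> meet
  (\<open>lines_meet\<close>), and minimality of \<open>S\<close> forces all of them through one point \<open>p\<close>. This means
  \<open>pS \<subseteq> T\<close> (\<open>minimal_contains_multiple\<close>), and the dimensions agree.

  Finally \<open>B = xA\<close> yields \<open>D(\<psi>) \<subseteq> x D(\<phi>)\<close> in \<open>F\<close>, where both sides have the same dimension over \<open>F\<^sup>2\<close>.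
\<close>

section \<open>Dimensions of subspaces of a field\<close>

context field begin

lemma dim_eqI: "subfield K R \<Longrightarrow> dimension n K E \<Longrightarrow> dim K E = n"
  using dimI[of K n E] by (simp add: over_def)

lemma dimension_dim: "subfield K R \<Longrightarrow> finite_dimension K E \<Longrightarrow> dimension (dim K E) K E"
  using finite_dimensionE[of K E] by (simp add: over_def)

lemma subalgebraI:
  assumes "subfield K R" "V \<subseteq> carrier R" "\<zero> \<in> V"
    and "\<And>v w. v \<in> V \<Longrightarrow> w \<in> V \<Longrightarrow> v \<oplus> w \<in> V"
    and "\<And>k v. k \<in> K \<Longrightarrow> v \<in> V \<Longrightarrow> k \<otimes> v \<in> V"
  shows "subalgebra K V R"
proof -
  have "\<ominus> v \<in> V" if "v \<in> V" for v
  proof -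
    have "\<ominus> \<one> \<in> K" using subringE(3,5)[OF subfieldE(1)[OF assms(1)]] by blast
    then have "\<ominus> \<one> \<otimes> v \<in> V" using assms(5) that by blast
    moreover have "v \<in> carrier R" using that assms(2) by blast
    ultimately show ?thesis by (simp add: l_minus)
  qed
  then have "subgroup V (add_monoid R)"
    using assms by (intro add.subgroupI) (auto simp: a_inv_def)
  then show ?thesis using assms(5) by (simp add: subalgebra_def subalgebra_axioms_def)
qed

lemma subalgebraD:
  assumes "subalgebra K V R"
  shows "V \<subseteq> carrier R" "\<zero> \<in> V" "v \<in> V \<Longrightarrow> w \<in> V \<Longrightarrow> v \<oplus> w \<in> V"
    "v \<in> V \<Longrightarrow> \<ominus> v \<in> V" "v \<in> V \<Longrightarrow> w \<in> V \<Longrightarrow> v \<ominus> w \<in> V"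
    "k \<in> K \<Longrightarrow> v \<in> V \<Longrightarrow> k \<otimes> v \<in> V"
proof -
  interpret subalgebra K V R by fact
  show "V \<subseteq> carrier R" using subset by simp
  show "\<zero> \<in> V" using one_closed by simp
  show *: "v \<oplus> w \<in> V" if "v \<in> V" "w \<in> V" for v w using m_closed[OF that] by simp
  show **: "\<ominus> v \<in> V" if "v \<in> V" for v using m_inv_closed[OF that] by (simp add: a_inv_def)
  show "v \<in> V \<Longrightarrow> w \<in> V \<Longrightarrow> v \<ominus> w \<in> V" unfolding a_minus_def using * ** by blast
  show "k \<in> K \<Longrightarrow> v \<in> V \<Longrightarrow> k \<otimes> v \<in> V" by (rule smult_closed)
qed

lemma subfieldD:
  assumes "subfield K R"
  shows "K \<subseteq> carrier R" "\<zero> \<in> K" "\<one> \<in> K" "x \<in> K \<Longrightarrow> y \<in> K \<Longrightarrow> x \<oplus> y \<in> K"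
    "x \<in> K \<Longrightarrow> \<ominus> x \<in> K" "x \<in> K \<Longrightarrow> y \<in> K \<Longrightarrow> x \<ominus> y \<in> K"
    "x \<in> K \<Longrightarrow> y \<in> K \<Longrightarrow> x \<otimes> y \<in> K" "x \<in> K \<Longrightarrow> x \<noteq> \<zero> \<Longrightarrow> inv x \<in> K"
  using subringE[OF subfieldE(1)[OF assms]] subfield_m_inv(1)[OF assms]
  by (auto simp: a_minus_def)

lemma subfield_subalgebra: "subfield K R \<Longrightarrow> subfield M R \<Longrightarrow> K \<subseteq> M \<Longrightarrow> subalgebra K M R"
  by (rule subalgebraI) (auto dest: subfieldD(1-4,7))

lemma subalgebra_antimono: "subfield K R \<Longrightarrow> subalgebra M V R \<Longrightarrow> K \<subseteq> M \<Longrightarrow> subalgebra K V R"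
  by (rule subalgebraI) (auto dest: subalgebraD)

lemma subalgebra_smult:
  assumes "subfield K R" "subalgebra K V R" "x \<in> carrier R"
  shows "subalgebra K ((\<otimes>) x ` V) R"
proof (rule subalgebraI[OF assms(1)])
  note V = subalgebraD[OF assms(2)]
  show "(\<otimes>) x ` V \<subseteq> carrier R" using V(1) assms(3) by auto
  show "\<zero> \<in> (\<otimes>) x ` V" using V(2) assms(3) by (force simp: image_iff)
  fix v assume "v \<in> (\<otimes>) x ` V" then obtain v' where v: "v' \<in> V" "v = x \<otimes> v'" by blast
  { fix w assume "w \<in> (\<otimes>) x ` V" then obtain w' where w: "w' \<in> V" "w = x \<otimes> w'" by blast
    have "v \<oplus> w = x \<otimes> (v' \<oplus> w')" using v w V(1) assms(3) by (simp add: r_distr subset_iff)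
    then show "v \<oplus> w \<in> (\<otimes>) x ` V" using V(3) v w by blast }
  fix k assume k: "k \<in> K"
  have "k \<otimes> v = x \<otimes> (k \<otimes> v')"
    using v k V(1) assms(3) subfieldD(1)[OF assms(1)] by (simp add: m_lcomm subset_iff)
  then show "k \<otimes> v \<in> (\<otimes>) x ` V" using V(6) v k by blast
qed

lemma set_add_iff: "y \<in> A <+>\<^bsub>R\<^esub> B \<longleftrightarrow> (\<exists>u\<in>A. \<exists>v\<in>B. y = u \<oplus> v)"
  unfolding set_add_def' by blast

lemma subalgebra_set_add:
  assumes "subfield K R" "subalgebra K V R" "subalgebra K W R"
  shows "subalgebra K (V <+>\<^bsub>R\<^esub> W) R"
proof (rule subalgebraI[OF assms(1)])
  note V = subalgebraD[OF assms(2)] and W = subalgebraD[OF assms(3)]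
  show "V <+>\<^bsub>R\<^esub> W \<subseteq> carrier R" using V(1) W(1) by (auto simp: set_add_iff subset_iff)
  show "\<zero> \<in> V <+>\<^bsub>R\<^esub> W" using V(2) W(2) by (force simp: set_add_iff)
  fix v assume "v \<in> V <+>\<^bsub>R\<^esub> W" then obtain a b where v: "a \<in> V" "b \<in> W" "v = a \<oplus> b"
    by (auto simp: set_add_iff)
  { fix w assume "w \<in> V <+>\<^bsub>R\<^esub> W" then obtain c d where w: "c \<in> V" "d \<in> W" "w = c \<oplus> d"
    by (auto simp: set_add_iff)
    have "v \<oplus> w = (a \<oplus> c) \<oplus> (b \<oplus> d)" using v w V(1) W(1) by (simp add: a_ac subset_iff)
    then show "v \<oplus> w \<in> V <+>\<^bsub>R\<^esub> W"
      unfolding set_add_iff using V(3)[OF v(1) w(1)] W(3)[OF v(2) w(2)] by blast }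
  fix k assume k: "k \<in> K"
  have "k \<otimes> v = k \<otimes> a \<oplus> k \<otimes> b"
    using v k V(1) W(1) subfieldD(1)[OF assms(1)] by (simp add: r_distr subset_iff)
  then show "k \<otimes> v \<in> V <+>\<^bsub>R\<^esub> W"
    unfolding set_add_iff using V(6)[OF k v(1)] W(6)[OF k v(2)] by blast
qed

lemma set_add_incl:
  assumes "subalgebra K V R" "subalgebra K W R"
  shows "V \<subseteq> V <+>\<^bsub>R\<^esub> W" "W \<subseteq> V <+>\<^bsub>R\<^esub> W"
  using subalgebraD(1,2)[OF assms(1)] subalgebraD(1,2)[OF assms(2)]
  by (force simp: set_add_iff)+

lemma dimension_smult:
  assumes K: "subfield K R" and x: "x \<in> carrier R" "x \<noteq> \<zero>" and "dimension n K E"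
  shows "dimension n K ((\<otimes>) x ` E)"
  using assms(4)
proof (induction n arbitrary: E)
  case 0
  then have "E = {\<zero>}" using dimension_zero[OF K] by simp
  then show ?case using x by simp
next
  case (Suc n)
  from dimension_backwards[OF K Suc.prems] obtain v E'
    where v: "v \<in> carrier R" and E': "dimension n K E'" "v \<notin> E'" and E: "E = line_extension K v E'"
    by blast
  have sub: "E' \<subseteq> carrier R" "K \<subseteq> carrier R"
    using space_subgroup_props(1)[OF K E'(1)] subfieldD(1)[OF K] by auto
  have "x \<otimes> v \<notin> (\<otimes>) x ` E'"
    using sub v x E'(2) by (auto simp: m_lcancel subset_iff)
  then have "dimension (Suc n) K (line_extension K (x \<otimes> v) ((\<otimes>) x ` E'))"
    using x v by (intro Suc_dim Suc.IH E') auto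
  also have "line_extension K (x \<otimes> v) ((\<otimes>) x ` E') = (\<otimes>) x ` E"
  proof -
    have "x \<otimes> (k \<otimes> v \<oplus> w) = k \<otimes> (x \<otimes> v) \<oplus> x \<otimes> w" if "k \<in> K" "w \<in> E'" for k w
      using that sub x v by (simp add: r_distr m_lcomm subset_iff)
    note * = this
    show ?thesis
    proof (intro equalityI subsetI)
      fix y assume "y \<in> line_extension K (x \<otimes> v) ((\<otimes>) x ` E')"
      then obtain k w where "k \<in> K" "w \<in> E'" "y = k \<otimes> (x \<otimes> v) \<oplus> x \<otimes> w"
        unfolding line_extension_mem_iff by blast
      then have "y = x \<otimes> (k \<otimes> v \<oplus> w)" "k \<otimes> v \<oplus> w \<in> E" unfolding E by (auto simp: line_extension_mem_iff *)
      then show "y \<in> (\<otimes>) x ` E" by blast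
    next
      fix y assume "y \<in> (\<otimes>) x ` E"
      then obtain k w where kw: "k \<in> K" "w \<in> E'" "y = x \<otimes> (k \<otimes> v \<oplus> w)"
        unfolding E by (auto simp: line_extension_mem_iff)
      then show "y \<in> line_extension K (x \<otimes> v) ((\<otimes>) x ` E')"
        unfolding line_extension_mem_iff kw(3) *[OF kw(1,2)] by blast
    qed
  qed
  finally show ?case .
qed

lemma finite_dimension_smult:
  "subfield K R \<Longrightarrow> x \<in> carrier R \<Longrightarrow> x \<noteq> \<zero> \<Longrightarrow> finite_dimension K E \<Longrightarrow>
    finite_dimension K ((\<otimes>) x ` E)"
  using dimension_smult unfolding finite_dimension_def by blast

lemma dim_smult:
  "subfield K R \<Longrightarrow> x \<in> carrier R \<Longrightarrow> x \<noteq> \<zero> \<Longrightarrow> finite_dimension K E \<Longrightarrow>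
    dim K ((\<otimes>) x ` E) = dim K E"
  by (rule dim_eqI[OF _ dimension_smult[OF _ _ _ dimension_dim]])

lemma dim_direct_sum:
  assumes "subfield K R" "finite_dimension K E" "finite_dimension K E'" "E \<inter> E' = {\<zero>}"
  shows "finite_dimension K (E <+>\<^bsub>R\<^esub> E')" "dim K (E <+>\<^bsub>R\<^esub> E') = dim K E + dim K E'"
  using dimension_direct_sum_space[OF assms(1) dimension_dim[OF assms(1,2)]
      dimension_dim[OF assms(1,3)] assms(4)] dim_eqI[OF assms(1)]
  by (auto simp: finite_dimension_def)

lemma dim_subspace:
  assumes "subfield K R" "finite_dimension K E" "subalgebra K V R" "V \<subseteq> E"
  shows "finite_dimension K V" "dim K V \<le> dim K E" "dim K V = dim K E \<Longrightarrow> V = E"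
proof -
  show fin: "finite_dimension K V" using subalbegra_incl_imp_finite_dimension[OF assms] .
  obtain us where us: "independent K us" "length us = dim K V" "Span K us = V"
    using exists_base[OF assms(1) dimension_dim[OF assms(1) fin]] by blast
  have "set us \<subseteq> V" using Span_base_incl[OF assms(1) independent_in_carrier[OF us(1)]] us(3) by simp
  then have us': "set us \<subseteq> E" using assms(4) by simp
  show "dim K V \<le> dim K E"
    using independent_length_le_dimension[OF assms(1) dimension_dim[OF assms(1,2)] us(1) us'] us(2) by simp
  show "V = E" if "dim K V = dim K E"
    using independent_length_eq_dimension[OF assms(1) dimension_dim[OF assms(1,2)] us(1) us'] us that
    by simp
qed

lemma dim_sum:
  assumes "subfield K R" "finite_dimension K E" "finite_dimension K E'"
  shows "finite_dimension K (E <+>\<^bsub>R\<^esub> E')" "dim K (E <+>\<^bsub>R\<^esub> E') + dim K (E \<inter> E') = dim K E + dim K E'"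
proof -
  note [simp] = over_def
  show "finite_dimension K (E <+>\<^bsub>R\<^esub> E')" by (rule sum_space_dim[OF assms])
  have "subalgebra K (E \<inter> E') R"
    using finite_dimension_imp_subalgebra[OF assms(1)] assms subalgebra_inter by blast
  from dim_subspace(2)[OF assms(1,2) this]
  show "dim K (E <+>\<^bsub>R\<^esub> E') + dim K (E \<inter> E') = dim K E + dim K E'"
    using sum_space_dim(2)[OF assms] by simp
qed

lemma dim_zero: "subfield K R \<Longrightarrow> dim K {\<zero>} = 0"
  using dim_eqI[OF _ zero_dim] .

lemma dim_eq_0: "subfield K R \<Longrightarrow> finite_dimension K E \<Longrightarrow> dim K E = 0 \<Longrightarrow> E = {\<zero>}"
  using dimension_dim[of K E] dimension_zero[of K E] by simp

text \<open>
  Unlike \<open>Span\<close>, which takes a list of generators, this enlarges a space given over a small field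
  to one over a bigger field without a choice of generators.
\<close>

definition subspan :: "'a set \<Rightarrow> 'a set \<Rightarrow> 'a set" where
  "subspan K A = \<Inter>{V. subalgebra K V R \<and> A \<subseteq> V}"

lemma subspan_min: "subalgebra K V R \<Longrightarrow> A \<subseteq> V \<Longrightarrow> subspan K A \<subseteq> V"
  by (auto simp: subspan_def)

lemma subspan_incl: "A \<subseteq> subspan K A"
  by (auto simp: subspan_def)

lemma subspan_subalgebra:
  assumes "subfield K R" "A \<subseteq> carrier R"
  shows "subalgebra K (subspan K A) R"
proof (rule subalgebraI[OF assms(1)])
  have "subalgebra K (carrier R) R"
    using carrier_is_subalgebra subfieldD(1)[OF assms(1)] by blast
  then show "subspan K A \<subseteq> carrier R" using subspan_min assms(2) by blast
qed (auto simp: subspan_def dest: subalgebraD)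

lemma subspan_Span: "subfield K R \<Longrightarrow> set us \<subseteq> carrier R \<Longrightarrow> subspan K (set us) = Span K us"
  unfolding subspan_def by (rule Span_subalgebra_minimal[symmetric])

lemma subspan_subspan:
  assumes "subfield K R" "subfield M R" "K \<subseteq> M" "A \<subseteq> carrier R"
  shows "subspan M (subspan K A) = subspan M A"
proof
  have M: "subalgebra M (subspan M A) R" using subspan_subalgebra[OF assms(2,4)] .
  show "subspan M (subspan K A) \<subseteq> subspan M A"
    by (intro subspan_min[OF M] subspan_min[OF subalgebra_antimono[OF assms(1) M assms(3)]] subspan_incl)
  have "subalgebra M (subspan M (subspan K A)) R"
    using subspan_subalgebra[OF assms(2)] subalgebraD(1)[OF subspan_subalgebra[OF assms(1,4)]] by blast
  then show "subspan M A \<subseteq> subspan M (subspan K A)"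
    using subspan_incl[of A K] subspan_incl[of "subspan K A" M] by (intro subspan_min) auto
qed

lemma subspan_self: "subalgebra K V R \<Longrightarrow> subspan K V = V"
  using subspan_min[of K V V] subspan_incl[of V K] by auto

lemma subspan_Span_subspan:
  assumes "subfield K R" "subfield M R" "K \<subseteq> M" "set us \<subseteq> carrier R"
  shows "subspan M (Span K us) = Span M us"
  using subspan_subspan[OF assms] subspan_Span[OF assms(1,4)] subspan_Span[OF assms(2,4)] by simp

lemma subspan_finite_dimension:
  assumes "subfield K R" "subfield M R" "K \<subseteq> M" "finite_dimension K V"
  shows "finite_dimension M (subspan M V)"
proof -
  obtain us where "set us \<subseteq> carrier R" "Span K us = V"
    using exists_base[OF assms(1) dimension_dim[OF assms(1,4)]] by blast
  then show ?thesis
    using subspan_Span_subspan[OF assms(1-3)] Span_finite_dimension[OF assms(2)] by metis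
qed

lemma dim_tower:
  assumes "subfield K R" "subfield M R" "finite_dimension K M" "finite_dimension M V"
  shows "finite_dimension K V" "dim K V = dim K M * dim M V"
  using telescopic_base[OF assms(1,2) dimension_dim[OF assms(1,3)] dimension_dim[OF assms(2,4)]]
    dim_eqI[OF assms(1)] by (auto simp: finite_dimension_def)

lemma nonzero_inverse:
  assumes "x \<in> carrier R" "x \<noteq> \<zero>"
  shows "inv x \<in> carrier R" "inv x \<noteq> \<zero>" "inv x \<otimes> x = \<one>" "x \<otimes> inv x = \<one>"
proof -
  have x: "x \<in> Units R" using assms field_Units by blast
  show "inv x \<in> carrier R" "inv x \<otimes> x = \<one>" "x \<otimes> inv x = \<one>" using x by auto
  then show "inv x \<noteq> \<zero>" using assms(1) by auto
qed

lemma smult_inv_image: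
  assumes "x \<in> carrier R" "x \<noteq> \<zero>" "V \<subseteq> carrier R"
  shows "(\<otimes>) (inv x) ` (\<otimes>) x ` V = V" "(\<otimes>) x ` (\<otimes>) (inv x) ` V = V"
proof -
  note x = nonzero_inverse[OF assms(1,2)]
  have "inv x \<otimes> (x \<otimes> v) = v" "x \<otimes> (inv x \<otimes> v) = v" if "v \<in> V" for v
    using that assms x by (simp_all flip: m_assoc add: subset_iff)
  then show "(\<otimes>) (inv x) ` (\<otimes>) x ` V = V" "(\<otimes>) x ` (\<otimes>) (inv x) ` V = V"
    by (auto simp: image_image)
qed

lemma subspan_smult:
  assumes "subfield K R" "A \<subseteq> carrier R" "x \<in> carrier R" "x \<noteq> \<zero>"
  shows "subspan K ((\<otimes>) x ` A) = (\<otimes>) x ` subspan K A"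
proof
  note x = nonzero_inverse(1,2)[OF assms(3,4)]
  have xA: "(\<otimes>) x ` A \<subseteq> carrier R" using assms by auto
  show "subspan K ((\<otimes>) x ` A) \<subseteq> (\<otimes>) x ` subspan K A"
    by (intro subspan_min subalgebra_smult subspan_subalgebra assms image_mono subspan_incl)
  have "(\<otimes>) (inv x) ` (\<otimes>) x ` A \<subseteq> (\<otimes>) (inv x) ` subspan K ((\<otimes>) x ` A)"
    by (intro image_mono subspan_incl)
  then have "A \<subseteq> (\<otimes>) (inv x) ` subspan K ((\<otimes>) x ` A)"
    using smult_inv_image(1)[OF assms(3,4,2)] by simp
  then have "subspan K A \<subseteq> (\<otimes>) (inv x) ` subspan K ((\<otimes>) x ` A)"
    by (intro subspan_min subalgebra_smult subspan_subalgebra assms x xA)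
  then have "(\<otimes>) x ` subspan K A \<subseteq> (\<otimes>) x ` (\<otimes>) (inv x) ` subspan K ((\<otimes>) x ` A)" by (rule image_mono)
  then show "(\<otimes>) x ` subspan K A \<subseteq> subspan K ((\<otimes>) x ` A)"
    by (simp only: smult_inv_image(2)[OF assms(3,4) subalgebraD(1)[OF subspan_subalgebra[OF assms(1) xA]]])
qed

end

section \<open>Subfields that contain all squares\<close>

text \<open>
  In the application \<open>G\<close> is the field of squares in characteristic 2. As \<open>x\<^sup>2\<close> lies in \<open>G\<close>, adjoining \<open>x\<close> to an
  intermediate field \<open>M\<close> just gives \<open>M + xM\<close>.
\<close>

locale square_closed_subfield = field R for R (structure) +
  fixes G
  assumes G: "subfield G R" and square_mem: "x \<in> carrier R \<Longrightarrow> x \<otimes> x \<in> G"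
begin

lemmas GD = subfieldD[OF G]

text \<open>
  The inverse of \<open>x\<close> is \<open>x / x\<^sup>2\<close>, and \<open>x\<^sup>2\<close> lies in the field \<open>G\<close>.
\<close>

lemma subfieldI_subring:
  assumes "G \<subseteq> M" "M \<subseteq> carrier R" "\<And>x y. x \<in> M \<Longrightarrow> y \<in> M \<Longrightarrow> x \<oplus> y \<in> M"
    "\<And>x y. x \<in> M \<Longrightarrow> y \<in> M \<Longrightarrow> x \<otimes> y \<in> M"
  shows "subfield M R"
proof (rule subfieldI')
  have "\<ominus> x \<in> M" if "x \<in> M" for x
  proof -
    have "\<ominus> \<one> \<in> M" using GD(5)[OF GD(3)] assms(1) by blast
    then have "\<ominus> \<one> \<otimes> x \<in> M" using assms(4) that by blast
    moreover have "x \<in> carrier R" using that assms(2) by blast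
    ultimately show ?thesis by (simp add: l_minus)
  qed
  then show "subring M R"
    using assms(2) GD(3) assms(1) assms(3,4) by (intro subringI) (blast, blast, blast+)
  fix x assume x: "x \<in> M - {\<zero>}"
  then have xc: "x \<in> carrier R" "x \<noteq> \<zero>" using assms(2) by auto
  have "x \<otimes> x \<noteq> \<zero>" using xc integral by blast
  then have "inv (x \<otimes> x) \<in> M" using GD(8)[OF square_mem[OF xc(1)]] assms(1) by blast
  then have "x \<otimes> inv (x \<otimes> x) \<in> M" using assms(4)[of x] x by blast
  also have "x \<otimes> inv (x \<otimes> x) = inv x"
  proof (rule comm_inv_char[symmetric])
    have xx: "x \<otimes> x \<in> carrier R" using xc by simp
    show "x \<otimes> (x \<otimes> inv (x \<otimes> x)) = \<one>" "x \<otimes> inv (x \<otimes> x) \<in> carrier R"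
      using nonzero_inverse[OF xx \<open>x \<otimes> x \<noteq> \<zero>\<close>] xc by (simp_all add: m_assoc[symmetric])
  qed (use xc in simp)
  finally show "inv x \<in> M" .
qed

definition adjoin :: "'a set \<Rightarrow> 'a \<Rightarrow> 'a set" where
  "adjoin M x = M <+>\<^bsub>R\<^esub> (\<otimes>) x ` M"

lemma adjoin_iff: "y \<in> adjoin M x \<longleftrightarrow> (\<exists>u\<in>M. \<exists>v\<in>M. y = u \<oplus> x \<otimes> v)"
  by (auto simp: adjoin_def set_add_iff)

lemma adjoin_incl:
  assumes "subfield M R" "x \<in> carrier R"
  shows "M \<subseteq> adjoin M x" "x \<in> adjoin M x"
proof -
  note M = subfieldD[OF assms(1)]
  show "M \<subseteq> adjoin M x"
  proof
    fix u assume "u \<in> M"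
    moreover have "u = u \<oplus> x \<otimes> \<zero>" using \<open>u \<in> M\<close> M(1) assms(2) by auto
    ultimately show "u \<in> adjoin M x" unfolding adjoin_iff using M(2) by blast
  qed
  have "x = \<zero> \<oplus> x \<otimes> \<one>" using assms(2) by simp
  then show "x \<in> adjoin M x" unfolding adjoin_iff using M(2,3) by blast
qed

lemma adjoin_min:
  assumes "subfield N R" "M \<subseteq> N" "x \<in> N"
  shows "adjoin M x \<subseteq> N"
proof
  fix y assume "y \<in> adjoin M x"
  then obtain u v where "u \<in> M" "v \<in> M" "y = u \<oplus> x \<otimes> v" by (auto simp: adjoin_iff)
  then show "y \<in> N" using subfieldD(4,7)[OF assms(1)] assms(2,3) by blast
qed

lemma subfield_adjoin:
  assumes "subfield M R" "G \<subseteq> M" "x \<in> carrier R"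
  shows "subfield (adjoin M x) R"
proof (rule subfieldI_subring)
  note M = subfieldD[OF assms(1)]
  show "G \<subseteq> adjoin M x" using assms(2) adjoin_incl(1)[OF assms(1,3)] by blast
  show "adjoin M x \<subseteq> carrier R"
    using adjoin_min[OF carrier_is_subfield M(1) assms(3)] .
  fix y z assume "y \<in> adjoin M x" "z \<in> adjoin M x"
  then obtain u v u' v' where *: "u \<in> M" "v \<in> M" "y = u \<oplus> x \<otimes> v" "u' \<in> M" "v' \<in> M" "z = u' \<oplus> x \<otimes> v'"
    by (auto simp: adjoin_iff)
  have c: "u \<in> carrier R" "v \<in> carrier R" "u' \<in> carrier R" "v' \<in> carrier R" using * M(1) by auto
  have "y \<oplus> z = (u \<oplus> u') \<oplus> x \<otimes> (v \<oplus> v')"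
    unfolding *(3,6) using c assms(3) by algebra
  then show "y \<oplus> z \<in> adjoin M x" unfolding adjoin_iff using M(4) * by blast
  have xx: "x \<otimes> x \<in> M" using square_mem[OF assms(3)] assms(2) by blast
  have "y \<otimes> z = (u \<otimes> u' \<oplus> (x \<otimes> x) \<otimes> (v \<otimes> v')) \<oplus> x \<otimes> (u \<otimes> v' \<oplus> v \<otimes> u')"
    unfolding *(3,6) using c assms(3) by algebra
  moreover have "u \<otimes> u' \<oplus> (x \<otimes> x) \<otimes> (v \<otimes> v') \<in> M" "u \<otimes> v' \<oplus> v \<otimes> u' \<in> M"
    using M(4,7) * xx by auto
  ultimately show "y \<otimes> z \<in> adjoin M x" unfolding adjoin_iff by blast
qed

lemma adjoin_finite_dimension:
  assumes "subfield M R" "G \<subseteq> M" "x \<in> carrier R" "finite_dimension G M"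
  shows "finite_dimension G (adjoin M x)" "dim G (adjoin M x) \<le> 2 * dim G M"
proof -
  have *: "finite_dimension G (adjoin M x) \<and> dim G (adjoin M x) \<le> 2 * dim G M"
  proof (cases "x = \<zero>")
    case True
    have "adjoin M x = M"
      using adjoin_min[OF assms(1) order_refl, of x] adjoin_incl(1)[OF assms(1,3)]
        subfieldD(2)[OF assms(1)] True by auto
    then show ?thesis using assms(4) by simp
  next
    case False
    note fd = finite_dimension_smult[OF G assms(3) False assms(4)]
    show ?thesis
      unfolding adjoin_def
      using dim_sum[OF G assms(4) fd] dim_smult[OF G assms(3) False assms(4)] by simp
  qed
  then show "finite_dimension G (adjoin M x)" "dim G (adjoin M x) \<le> 2 * dim G M" by auto
qed

definition gen :: "'a set \<Rightarrow> 'a set" where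
  "gen X = generate_field R (G \<union> X)"

lemma subfield_gen: "X \<subseteq> carrier R \<Longrightarrow> subfield (gen X) R"
  unfolding gen_def using GD(1) by (intro generate_field_is_subfield) auto

lemma gen_incl: "G \<subseteq> gen X" "X \<subseteq> gen X"
  unfolding gen_def by (auto intro: generate_field.incl)

lemma gen_min: "X \<subseteq> carrier R \<Longrightarrow> subfield M R \<Longrightarrow> G \<subseteq> M \<Longrightarrow> X \<subseteq> M \<Longrightarrow> gen X \<subseteq> M"
  unfolding gen_def using GD(1) by (intro generate_field_min_subfield1) auto

lemma gen_mono: "X \<subseteq> Y \<Longrightarrow> Y \<subseteq> carrier R \<Longrightarrow> gen X \<subseteq> gen Y"
  by (intro gen_min subfield_gen gen_incl) (use gen_incl in blast)+

text \<open>
  Each adjunction at most doubles the degree.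
\<close>

lemma gen_dim:
  assumes "finite X" "X \<subseteq> carrier R"
  shows "finite_dimension G (gen X) \<and> dim G (gen X) \<le> 2 ^ card X"
  using assms
proof (induction X rule: finite_induct)
  case empty
  have "gen {} = G" using gen_min[OF _ G] gen_incl(1) by blast
  then show ?case
    using dim_eqI[OF G dimension_one[OF G]] dimension_one[OF G] by (auto simp: finite_dimension_def)
next
  case (insert x X)
  then have X: "X \<subseteq> carrier R" "x \<in> carrier R" by auto
  note M = subfield_gen[OF X(1)]
  have fd: "finite_dimension G (gen X)" "dim G (gen X) \<le> 2 ^ card X" using insert.IH X by auto
  note adj = adjoin_finite_dimension[OF M gen_incl(1) X(2) fd(1)]
  have "gen (insert x X) \<subseteq> adjoin (gen X) x"
    using adjoin_incl[OF M X(2)] gen_incl[of X]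
    by (intro gen_min subfield_adjoin M gen_incl X insert.prems) auto
  then have "finite_dimension G (gen (insert x X))" "dim G (gen (insert x X)) \<le> dim G (adjoin (gen X) x)"
    using dim_subspace[OF G adj(1) subfield_subalgebra[OF G subfield_gen[OF insert.prems] gen_incl(1)]]
    by auto
  then show ?case using adj fd insert.hyps by simp
qed

section \<open>Spaces whose spans have the same dimensions\<close>

text \<open>
  This is what Vishik equivalence implies for two value sets. Dimensions are taken over \<open>G\<close> rather than
  over \<open>M\<close>, so that they can be combined with dimensions of spaces that are not closed under \<open>M\<close>. Since \<open>M\<close>
  is finite over \<open>G\<close>, this makes no difference.
\<close>

definition same_span_dims :: "'a set \<Rightarrow> 'a set \<Rightarrow> 'a set \<Rightarrow> bool" where
  "same_span_dims P S T \<longleftrightarrow> (\<forall>M. subfield M R \<longrightarrow> G \<subseteq> M \<longrightarrow> M \<subseteq> P \<longrightarrow> finite_dimension G M \<longrightarrow>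
     dim G (subspan M S) = dim G (subspan M T))"

lemma same_span_dimsD:
  "same_span_dims P S T \<Longrightarrow> subfield M R \<Longrightarrow> G \<subseteq> M \<Longrightarrow> M \<subseteq> P \<Longrightarrow> finite_dimension G M \<Longrightarrow>
    dim G (subspan M S) = dim G (subspan M T)"
  by (simp add: same_span_dims_def)

lemma same_span_dims_sym: "same_span_dims P S T \<Longrightarrow> same_span_dims P T S"
  by (simp add: same_span_dims_def)

lemma finite_dimension_subspan:
  assumes "subfield M R" "G \<subseteq> M" "finite_dimension G M" "finite_dimension G S"
  shows "finite_dimension G (subspan M S)"
  using dim_tower(1)[OF G assms(1,3)] subspan_finite_dimension[OF G assms(1,2,4)] by blast

lemma same_span_dims_smult:
  assumes "same_span_dims P S T" "finite_dimension G S" "finite_dimension G T"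
    and x: "x \<in> carrier R" "x \<noteq> \<zero>" and y: "y \<in> carrier R" "y \<noteq> \<zero>"
  shows "same_span_dims P ((\<otimes>) x ` S) ((\<otimes>) y ` T)"
  unfolding same_span_dims_def
proof (intro allI impI)
  fix M assume M: "subfield M R" "G \<subseteq> M" "M \<subseteq> P" "finite_dimension G M"
  have c: "S \<subseteq> carrier R" "T \<subseteq> carrier R"
    using subalgebraD(1)[OF finite_dimension_imp_subalgebra[OF G]] assms(2,3) by blast+
  have "dim G ((\<otimes>) x ` subspan M S) = dim G ((\<otimes>) y ` subspan M T)"
    using same_span_dimsD[OF assms(1) M] dim_smult[OF G x finite_dimension_subspan[OF M(1,2,4) assms(2)]]
      dim_smult[OF G y finite_dimension_subspan[OF M(1,2,4) assms(3)]] by simp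
  then show "dim G (subspan M ((\<otimes>) x ` S)) = dim G (subspan M ((\<otimes>) y ` T))"
    using subspan_smult[OF M(1) c(1) x] subspan_smult[OF M(1) c(2) y] by simp
qed

lemma dim_pos:
  "finite_dimension G S \<Longrightarrow> S \<noteq> {\<zero>} \<Longrightarrow> 0 < dim G S"
  using dim_eq_0[OF G] by blast

lemma finite_dimension_self: "finite_dimension G G"
  unfolding finite_dimension_def by (rule exI[of _ 1]) (rule dimension_one[OF G])

lemma same_span_dims_dim:
  assumes "same_span_dims P S T" "G \<subseteq> P" "finite_dimension G S" "finite_dimension G T"
  shows "dim G S = dim G T"
  using same_span_dimsD[OF assms(1) G order_refl assms(2) finite_dimension_self]
    subspan_self[OF finite_dimension_imp_subalgebra[OF G assms(3)]]
    subspan_self[OF finite_dimension_imp_subalgebra[OF G assms(4)]]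
  by simp

lemma exists_nonzero:
  assumes "finite_dimension G S" "0 < dim G S"
  shows "\<exists>s\<in>S. s \<noteq> \<zero>"
proof (rule ccontr)
  assume "\<not> ?thesis"
  moreover have "\<zero> \<in> S" using subalgebraD(2)[OF finite_dimension_imp_subalgebra[OF G assms(1)]] .
  ultimately have "S = {\<zero>}" by blast
  then show False using assms(2) dim_zero[OF G] by simp
qed

text \<open>
  The span of \<open>S\<close> over \<open>M\<close> is one-dimensional, hence so is that of \<open>T\<close>, and any nonzero vector generates it.
\<close>

lemma line_transfer:
  assumes eq: "same_span_dims P S T" and fS: "finite_dimension G S" and fT: "finite_dimension G T"
    and M: "subfield M R" "G \<subseteq> M" "M \<subseteq> P" "finite_dimension G M"
    and S: "S \<noteq> {\<zero>}" "e \<in> carrier R" "e \<noteq> \<zero>" "S \<subseteq> (\<otimes>) e ` M"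
    and t: "t \<in> T" "t \<noteq> \<zero>"
  shows "T \<subseteq> (\<otimes>) t ` M"
proof -
  have c: "S \<subseteq> carrier R" "T \<subseteq> carrier R"
    using subalgebraD(1)[OF finite_dimension_imp_subalgebra[OF G]] fS fT by blast+
  have MM: "subalgebra M M R" using subfield_subalgebra[OF M(1) M(1)] by simp
  have tc: "t \<in> carrier R" using t c by blast
  have "subspan M S \<subseteq> (\<otimes>) e ` M"
    by (intro subspan_min subalgebra_smult M MM S)
  then have "dim G (subspan M S) \<le> dim G ((\<otimes>) e ` M)"
    using dim_subspace(2)[OF G finite_dimension_smult[OF G S(2,3) M(4)]]
      subalgebra_antimono[OF G subspan_subalgebra[OF M(1) c(1)] M(2)] by blast
  then have le: "dim G (subspan M T) \<le> dim G M"
    using same_span_dimsD[OF eq M] dim_smult[OF G S(2,3) M(4)] by simp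
  have sT: "subalgebra M (subspan M T) R" using subspan_subalgebra[OF M(1) c(2)] .
  have sub: "(\<otimes>) t ` M \<subseteq> subspan M T"
  proof
    fix y assume "y \<in> (\<otimes>) t ` M"
    then obtain m where m: "m \<in> M" "y = t \<otimes> m" by blast
    then have "y = m \<otimes> t" using tc subfieldD(1)[OF M(1)] by (auto simp: m_comm)
    then show "y \<in> subspan M T" using subalgebraD(6)[OF sT m(1)] subspan_incl t(1) by blast
  qed
  have fin: "finite_dimension G (subspan M T)" by (rule finite_dimension_subspan[OF M(1,2,4) fT])
  have "(\<otimes>) t ` M = subspan M T"
    using dim_subspace[OF G fin subalgebra_smult[OF G subfield_subalgebra[OF G M(1,2)] tc] sub]
      le dim_smult[OF G tc t(2) M(4)] by simp
  then show ?thesis using subspan_incl by blast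
qed

lemma subspan_adjoin:
  assumes S: "subalgebra G S R" and x: "x \<in> carrier R"
  shows "subspan (adjoin G x) S = S <+>\<^bsub>R\<^esub> (\<otimes>) x ` S"
proof
  note Sx = subalgebra_smult[OF G S x]
  note V = subalgebra_set_add[OF G S Sx]
  note SD = subalgebraD[OF S]
  have sub: "S \<subseteq> S <+>\<^bsub>R\<^esub> (\<otimes>) x ` S" by (rule set_add_incl(1)[OF S Sx])
  show "subspan (adjoin G x) S \<subseteq> S <+>\<^bsub>R\<^esub> (\<otimes>) x ` S"
  proof (intro subspan_min subalgebraI subfield_adjoin[OF G order_refl x] sub subalgebraD(1-3)[OF V])
    fix k v assume "k \<in> adjoin G x" "v \<in> S <+>\<^bsub>R\<^esub> (\<otimes>) x ` S"
    then obtain g h s s' where *: "g \<in> G" "h \<in> G" "k = g \<oplus> x \<otimes> h" "s \<in> S" "s' \<in> S" "v = s \<oplus> x \<otimes> s'"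
      by (auto simp: adjoin_iff set_add_iff)
    have c: "g \<in> carrier R" "h \<in> carrier R" "s \<in> carrier R" "s' \<in> carrier R"
      using * GD(1) SD(1) by auto
    have "k \<otimes> v = (g \<otimes> s \<oplus> (x \<otimes> x \<otimes> h) \<otimes> s') \<oplus> x \<otimes> (g \<otimes> s' \<oplus> h \<otimes> s)"
      unfolding *(3,6) using c x by algebra
    moreover have "g \<otimes> s \<oplus> (x \<otimes> x \<otimes> h) \<otimes> s' \<in> S" "g \<otimes> s' \<oplus> h \<otimes> s \<in> S"
      using SD(3,6) GD(7) square_mem[OF x] * by blast+
    ultimately show "k \<otimes> v \<in> S <+>\<^bsub>R\<^esub> (\<otimes>) x ` S" unfolding set_add_iff by blast
  qed
  have A: "subalgebra (adjoin G x) (subspan (adjoin G x) S) R"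
    by (rule subspan_subalgebra[OF subfield_adjoin[OF G order_refl x] SD(1)])
  show "S <+>\<^bsub>R\<^esub> (\<otimes>) x ` S \<subseteq> subspan (adjoin G x) S"
  proof
    fix y assume "y \<in> S <+>\<^bsub>R\<^esub> (\<otimes>) x ` S"
    then obtain s s' where "s \<in> S" "s' \<in> S" "y = s \<oplus> x \<otimes> s'" by (auto simp: set_add_iff)
    then show "y \<in> subspan (adjoin G x) S"
      using subalgebraD(3,6)[OF A] adjoin_incl(2)[OF G x] subspan_incl[of S "adjoin G x"] by blast
  qed
qed

text \<open>
  A ratio \<open>x\<close> of two elements of \<open>S\<close> is visible in the dimension of \<open>S \<inter> xS\<close>. Since \<open>S + xS\<close> is the span
  of \<open>S\<close> over \<open>G(x)\<close>, this dimension is the same for \<open>T\<close>.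
\<close>

lemma ratio_transfer:
  assumes eq: "same_span_dims P S T" and P: "subfield P R" "G \<subseteq> P"
    and fS: "finite_dimension G S" and fT: "finite_dimension G T"
    and x: "x \<in> P" "x \<noteq> \<zero>" and s: "s \<in> S" "s \<noteq> \<zero>" "x \<otimes> s \<in> S"
  shows "\<exists>t\<in>T. t \<noteq> \<zero> \<and> x \<otimes> t \<in> T"
proof -
  have xc: "x \<in> carrier R" using x subfieldD(1)[OF P(1)] by blast
  have sS: "subalgebra G S R" and sT: "subalgebra G T R"
    using finite_dimension_imp_subalgebra[OF G] fS fT by auto
  have cS: "S \<subseteq> carrier R" using subalgebraD(1)[OF sS] .
  note xS = finite_dimension_smult[OF G xc x(2) fS] and xT = finite_dimension_smult[OF G xc x(2) fT]
  have iS: "subalgebra G (S \<inter> (\<otimes>) x ` S) R" and iT: "subalgebra G (T \<inter> (\<otimes>) x ` T) R"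
    by (intro subalgebra_inter sS sT subalgebra_smult[OF G _ xc])+
  have fiS: "finite_dimension G (S \<inter> (\<otimes>) x ` S)" and fiT: "finite_dimension G (T \<inter> (\<otimes>) x ` T)"
    using dim_subspace(1)[OF G fS iS] dim_subspace(1)[OF G fT iT] by auto
  have d: "dim G (S <+>\<^bsub>R\<^esub> (\<otimes>) x ` S) = dim G (T <+>\<^bsub>R\<^esub> (\<otimes>) x ` T)"
    using same_span_dimsD[OF eq subfield_adjoin[OF G order_refl xc] adjoin_incl(1)[OF G xc]
        adjoin_min[OF P(1) P(2) x(1)] adjoin_finite_dimension(1)[OF G order_refl xc finite_dimension_self]]
      subspan_adjoin[OF sS xc] subspan_adjoin[OF sT xc] by simp
  have "dim G (S \<inter> (\<otimes>) x ` S) = dim G (T \<inter> (\<otimes>) x ` T)"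
    using d dim_sum(2)[OF G fS xS] dim_sum(2)[OF G fT xT] dim_smult[OF G xc x(2) fS]
      dim_smult[OF G xc x(2) fT] same_span_dims_dim[OF eq P(2) fS fT] by simp
  moreover have "x \<otimes> s \<in> S \<inter> (\<otimes>) x ` S" "x \<otimes> s \<noteq> \<zero>"
    using s cS x(2) xc integral by blast+
  then have "0 < dim G (S \<inter> (\<otimes>) x ` S)" using dim_pos[OF fiS] by blast
  ultimately have "0 < dim G (T \<inter> (\<otimes>) x ` T)" by simp
  from exists_nonzero[OF fiT this] obtain t where t: "t \<in> T" "x \<otimes> t \<in> T" "x \<otimes> t \<noteq> \<zero>" by blast
  have "t \<noteq> \<zero>" using t(3) xc by auto
  then show ?thesis using t by blast
qed

section \<open>Hyperplanes of a subfield\<close>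

text \<open>
  Every condition \<open>q s \<in> T\<close> confines \<open>q\<close> to the space \<open>T/s\<close>, of codimension at most one in \<open>Q\<close>, and so
  lowers the dimension by at most one.
\<close>

lemma hyperplane_transporter:
  assumes Q: "subfield Q R" "G \<subseteq> Q" "finite_dimension G Q"
    and T: "subalgebra G T R" "T \<subseteq> Q" "dim G Q \<le> Suc (dim G T)"
    and ss: "set ss \<subseteq> Q - {\<zero>}"
  shows "finite_dimension G {q \<in> Q. \<forall>s\<in>set ss. q \<otimes> s \<in> T} \<and>
    subalgebra G {q \<in> Q. \<forall>s\<in>set ss. q \<otimes> s \<in> T} R \<and>
    dim G Q \<le> dim G {q \<in> Q. \<forall>s\<in>set ss. q \<otimes> s \<in> T} + length ss"
  using ss
proof (induction ss)
  case Nil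
  then show ?case using Q subfield_subalgebra[OF G Q(1,2)] by simp
next
  case (Cons s ss)
  note QD = subfieldD[OF Q(1)]
  note TD = subalgebraD[OF T(1)]
  have s: "s \<in> Q" "s \<noteq> \<zero>" "s \<in> carrier R" using Cons.prems QD(1) by auto
  note s' = nonzero_inverse[OF s(3,2)]
  define W where "W = {q \<in> Q. \<forall>s\<in>set ss. q \<otimes> s \<in> T}"
  have W: "finite_dimension G W" "subalgebra G W R" "dim G Q \<le> dim G W + length ss"
    unfolding W_def using Cons by auto
  have fT: "finite_dimension G T" using dim_subspace(1)[OF G Q(3) T(1,2)] .
  define H where "H = (\<otimes>) (inv s) ` T"
  have invs: "inv s \<in> Q" using QD(8)[OF s(1,2)] .
  have H: "finite_dimension G H" "subalgebra G H R" "dim G H = dim G T" "H \<subseteq> Q"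
    unfolding H_def using finite_dimension_smult[OF G s'(1,2) fT] subalgebra_smult[OF G T(1) s'(1)]
      dim_smult[OF G s'(1,2) fT] QD(7)[OF invs] T(2) by auto
  have eq: "{q \<in> Q. \<forall>s\<in>set (s # ss). q \<otimes> s \<in> T} = W \<inter> H"
  proof (intro equalityI subsetI)
    fix q assume q: "q \<in> {q \<in> Q. \<forall>s\<in>set (s # ss). q \<otimes> s \<in> T}"
    then have qc: "q \<in> carrier R" using QD(1) by auto
    have "q = inv s \<otimes> (q \<otimes> s)" using qc s(3) s' by (simp add: m_lcomm m_comm)
    then show "q \<in> W \<inter> H" unfolding W_def H_def using q by auto
  next
    fix q assume q: "q \<in> W \<inter> H"
    then obtain t where t: "t \<in> T" "q = inv s \<otimes> t" unfolding H_def by blast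
    have tc: "t \<in> carrier R" using t(1) TD(1) by blast
    have "q \<otimes> s = t" unfolding t(2) using tc s(3) s' by (simp add: m_assoc m_comm[of t s] flip: m_assoc[of "inv s" s t])
    then show "q \<in> {q \<in> Q. \<forall>s\<in>set (s # ss). q \<otimes> s \<in> T}" using q t(1) unfolding W_def by simp
  qed
  have sub: "W <+>\<^bsub>R\<^esub> H \<subseteq> Q"
  proof
    fix y assume "y \<in> W <+>\<^bsub>R\<^esub> H"
    then obtain u v where "u \<in> W" "v \<in> H" "y = u \<oplus> v" by (auto simp: set_add_iff)
    then show "y \<in> Q" using QD(4)[of u v] H(4) unfolding W_def by blast
  qed
  have "dim G (W <+>\<^bsub>R\<^esub> H) \<le> dim G Q"
    using dim_subspace(2)[OF G Q(3) subalgebra_set_add[OF G W(2) H(2)] sub] .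
  moreover have "dim G (W <+>\<^bsub>R\<^esub> H) + dim G (W \<inter> H) = dim G W + dim G H"
    by (rule dim_sum(2)[OF G W(1) H(1)])
  moreover have "subalgebra G (W \<inter> H) R" "finite_dimension G (W \<inter> H)"
    using subalgebra_inter[OF W(2) H(2)] dim_subspace(1)[OF G W(1)] by auto
  ultimately show ?case using T(3) H(3) W(3) unfolding eq by simp
qed

text \<open>
  A proper subspace \<open>S\<close> is spanned by fewer than \<open>dim Q\<close> elements, so the conditions \<open>q s \<in> T\<close> for these
  generators \<open>s\<close> have a common nonzero solution \<open>q\<close>. Then \<open>qS \<subseteq> T\<close>, with equality by dimension.
\<close>

lemma hyperplanes_similar:
  assumes Q: "subfield Q R" "G \<subseteq> Q" "finite_dimension G Q"
    and S: "subalgebra G S R" "S \<subseteq> Q" and T: "subalgebra G T R" "T \<subseteq> Q"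
    and d: "dim G S = dim G T" "dim G Q \<le> Suc (dim G T)"
  shows "\<exists>x\<in>Q - {\<zero>}. T = (\<otimes>) x ` S"
proof -
  note QD = subfieldD[OF Q(1)]
  have fS: "finite_dimension G S" and fT: "finite_dimension G T"
    using dim_subspace(1)[OF G Q(3)] S T by auto
  obtain ss where ss: "independent G ss" "length ss = dim G S" "Span G ss = S"
    using exists_base[OF G dimension_dim[OF G fS]] by blast
  have ssc: "set ss \<subseteq> carrier R" using independent_in_carrier[OF ss(1)] .
  have ssS: "set ss \<subseteq> S" using Span_base_incl[OF G ssc] ss(3) by simp
  show ?thesis
  proof (cases "dim G T = dim G Q")
    case True
    have "S = Q" "T = Q" using dim_subspace(3)[OF G Q(3)] S T d True by auto
    moreover have "(\<otimes>) \<one> ` Q = Q" using QD(1) by (auto simp: image_iff subset_iff)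
    ultimately show ?thesis using QD(3) one_not_zero by (intro bexI[of _ \<one>]) auto
  next
    case False
    have lt: "dim G T < dim G Q" using dim_subspace(2)[OF G Q(3) T] False by simp
    have z: "\<zero> \<notin> set ss"
    proof
      assume "\<zero> \<in> set ss"
      then obtain as bs where "ss = as @ \<zero> # bs" using split_list by metis
      then have "independent G (\<zero> # bs)" using independent_split(1)[OF G, of as "\<zero> # bs"] ss(1) by simp
      then show False
        using independent_backwards[of G \<zero> bs] Span_subgroup_props(2)[OF G, of bs]
          independent_in_carrier[of G bs] by blast
    qed
    define W where "W = {q \<in> Q. \<forall>s\<in>set ss. q \<otimes> s \<in> T}"
    have W: "finite_dimension G W" "subalgebra G W R" "dim G Q \<le> dim G W + length ss"
      unfolding W_def using hyperplane_transporter[OF Q T d(2), of ss] ssS S(2) z by auto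
    have "0 < dim G W" using W(3) ss(2) d lt by simp
    from exists_nonzero[OF W(1) this] obtain x where x: "x \<in> Q" "x \<noteq> \<zero>" "\<And>s. s \<in> set ss \<Longrightarrow> x \<otimes> s \<in> T"
      unfolding W_def by blast
    have xc: "x \<in> carrier R" using x(1) QD(1) by blast
    note x' = nonzero_inverse[OF xc x(2)]
    have "set ss \<subseteq> (\<otimes>) (inv x) ` T"
    proof
      fix s assume s: "s \<in> set ss"
      then have "s = inv x \<otimes> (x \<otimes> s)" using ssc xc x' by (simp add: subset_iff flip: m_assoc)
      then show "s \<in> (\<otimes>) (inv x) ` T" using x(3)[OF s] by blast
    qed
    then have "S \<subseteq> (\<otimes>) (inv x) ` T"
      using subalgebra_Span_incl[OF G subalgebra_smult[OF G T(1) x'(1)]] ss(3) by blast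
    then have "(\<otimes>) x ` S \<subseteq> (\<otimes>) x ` (\<otimes>) (inv x) ` T" by (rule image_mono)
    then have sub: "(\<otimes>) x ` S \<subseteq> T"
      using smult_inv_image(2)[OF xc x(2) subalgebraD(1)[OF T(1)]] by simp
    have "(\<otimes>) x ` S = T"
      using dim_subspace(3)[OF G fT subalgebra_smult[OF G S(1) xc] sub] dim_smult[OF G xc x(2) fS] d(1)
      by simp
    then show ?thesis using x by blast
  qed
qed

text \<open>
  The hypothesis on spans places \<open>T\<close> on a line over the same field \<open>Q\<close>; after division both spaces have
  codimension at most one in \<open>Q\<close>.
\<close>

lemma similar_if_almost_field:
  assumes eq: "same_span_dims P S T" and P: "subfield P R" "G \<subseteq> P"
    and fS: "finite_dimension G S" and fT: "finite_dimension G T" and S0: "S \<noteq> {\<zero>}"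
    and Q: "subfield Q R" "G \<subseteq> Q" "Q \<subseteq> P" "finite_dimension G Q"
    and e: "e \<in> carrier R" "e \<noteq> \<zero>" "S \<subseteq> (\<otimes>) e ` Q" and d: "dim G Q \<le> Suc (dim G S)"
  shows "\<exists>x\<in>carrier R - {\<zero>}. T = (\<otimes>) x ` S"
proof -
  have sS: "subalgebra G S R" and sT: "subalgebra G T R"
    using finite_dimension_imp_subalgebra[OF G] fS fT by auto
  have dST: "dim G S = dim G T" by (rule same_span_dims_dim[OF eq P(2) fS fT])
  then have "0 < dim G T" using dim_pos[OF fS S0] by simp
  then obtain t where t: "t \<in> T" "t \<noteq> \<zero>" using exists_nonzero[OF fT] by blast
  have tc: "t \<in> carrier R" using t(1) subalgebraD(1)[OF sT] by blast
  note e' = nonzero_inverse[OF e(1,2)] and t' = nonzero_inverse[OF tc t(2)]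
  have Qc: "Q \<subseteq> carrier R" using subfieldD(1)[OF Q(1)] .
  have Sc: "S \<subseteq> carrier R" and Tc: "T \<subseteq> carrier R" using subalgebraD(1) sS sT by blast+
  have TQ: "T \<subseteq> (\<otimes>) t ` Q" by (rule line_transfer[OF eq fS fT Q S0 e t])
  define S1 where "S1 = (\<otimes>) (inv e) ` S"
  define T1 where "T1 = (\<otimes>) (inv t) ` T"
  have "S1 \<subseteq> (\<otimes>) (inv e) ` (\<otimes>) e ` Q" "T1 \<subseteq> (\<otimes>) (inv t) ` (\<otimes>) t ` Q"
    unfolding S1_def T1_def using e(3) TQ by (auto intro!: image_mono)
  then have sub: "S1 \<subseteq> Q" "T1 \<subseteq> Q"
    using smult_inv_image(1)[OF e(1,2) Qc] smult_inv_image(1)[OF tc t(2) Qc] by auto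
  have alg: "subalgebra G S1 R" "subalgebra G T1 R"
    unfolding S1_def T1_def by (intro subalgebra_smult[OF G] sS sT e' t')+
  have dims: "dim G S1 = dim G S" "dim G T1 = dim G T"
    unfolding S1_def T1_def using dim_smult[OF G e'(1,2) fS] dim_smult[OF G t'(1,2) fT] by auto
  obtain y where y: "y \<in> Q" "y \<noteq> \<zero>" "T1 = (\<otimes>) y ` S1"
    using hyperplanes_similar[OF Q(1,2,4) alg(1) sub(1) alg(2) sub(2)] d dST dims by auto
  have yc: "y \<in> carrier R" using y(1) Qc by blast
  have "T = (\<otimes>) t ` T1" unfolding T1_def using smult_inv_image(2)[OF tc t(2) Tc] by simp
  also have "\<dots> = (\<otimes>) (t \<otimes> y \<otimes> inv e) ` S"
    unfolding y(3) S1_def image_image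
    by (rule image_cong) (use tc yc e'(1) Sc in \<open>auto simp: m_assoc subset_iff\<close>)
  finally have "T = (\<otimes>) (t \<otimes> y \<otimes> inv e) ` S" .
  moreover have "t \<otimes> y \<otimes> inv e \<in> carrier R - {\<zero>}"
    using tc yc e' t(2) y(2) integral by auto
  ultimately show ?thesis by blast
qed

text \<open>
  The spaces \<open>H\<close> and \<open>qH\<close> are too large to intersect trivially inside \<open>Q\<close>. Thus \<open>Q\<close> consists of ratios of
  elements of \<open>H\<close>.
\<close>

lemma large_part_of_field:
  assumes Q: "subfield Q R" "G \<subseteq> Q" "finite_dimension G Q"
    and H: "subalgebra G H R" "H \<subseteq> Q" "dim G Q < 2 * dim G H"
    and q: "q \<in> Q" "q \<noteq> \<zero>"
  shows "\<exists>h\<in>H. \<exists>h'\<in>H. h' \<noteq> \<zero> \<and> q \<otimes> h' = h"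
proof -
  note QD = subfieldD[OF Q(1)]
  have qc: "q \<in> carrier R" using q(1) QD(1) by blast
  have fH: "finite_dimension G H" by (rule dim_subspace(1)[OF G Q(3) H(1,2)])
  note qH = subalgebra_smult[OF G H(1) qc] and fqH = finite_dimension_smult[OF G qc q(2) fH]
  have sub: "H <+>\<^bsub>R\<^esub> (\<otimes>) q ` H \<subseteq> Q"
  proof
    fix y assume "y \<in> H <+>\<^bsub>R\<^esub> (\<otimes>) q ` H"
    then obtain a b where "a \<in> H" "b \<in> H" "y = a \<oplus> q \<otimes> b" by (auto simp: set_add_iff)
    then show "y \<in> Q" using QD(4)[OF _ QD(7)[OF q(1)]] H(2) by blast
  qed
  have "dim G (H <+>\<^bsub>R\<^esub> (\<otimes>) q ` H) \<le> dim G Q"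
    by (rule dim_subspace(2)[OF G Q(3) subalgebra_set_add[OF G H(1) qH] sub])
  then have pos: "0 < dim G (H \<inter> (\<otimes>) q ` H)"
    using dim_sum(2)[OF G fH fqH] dim_smult[OF G qc q(2) fH] H(3) by simp
  have "finite_dimension G (H \<inter> (\<otimes>) q ` H)"
    using dim_subspace(1)[OF G fH subalgebra_inter[OF H(1) qH]] by blast
  then obtain h where h: "h \<in> H" "h \<in> (\<otimes>) q ` H" "h \<noteq> \<zero>" using exists_nonzero pos by blast
  then obtain h' where h': "h' \<in> H" "h = q \<otimes> h'" by blast
  have "h' \<noteq> \<zero>" using h(3) h'(2) qc by auto
  then show ?thesis using h(1) h' by blast
qed

section \<open>Minimal spaces\<close>

text \<open>
  For \<open>G = K\<^sup>2\<close> and the value set \<open>S\<close> of a form over \<open>K\<close>, this is the norm field of the form.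
\<close>

definition ratio_field :: "'a set \<Rightarrow> 'a set" where
  "ratio_field S = gen {s \<otimes> inv t | s t. s \<in> S - {\<zero>} \<and> t \<in> S - {\<zero>}}"

text \<open>
  The value sets of minimal forms: the degree of the ratio field is as large as \<open>dim S\<close> permits. The
  factor 2 replaces an exponent \<open>dim S - 1\<close> and thereby excludes the zero space.
\<close>

definition minimal_space :: "'a set \<Rightarrow> bool" where
  "minimal_space S \<longleftrightarrow> finite_dimension G S \<and> 2 * dim G (ratio_field S) = 2 ^ dim G S"

lemma ratios_carrier:
  "S \<subseteq> carrier R \<Longrightarrow> {s \<otimes> inv t | s t. s \<in> S - {\<zero>} \<and> t \<in> S - {\<zero>}} \<subseteq> carrier R"
  using nonzero_inverse(1) by blast

lemma subfield_ratio_field: "S \<subseteq> carrier R \<Longrightarrow> subfield (ratio_field S) R"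
  unfolding ratio_field_def by (intro subfield_gen ratios_carrier)

lemma ratio_mem: "s \<in> S \<Longrightarrow> s \<noteq> \<zero> \<Longrightarrow> t \<in> S \<Longrightarrow> t \<noteq> \<zero> \<Longrightarrow> s \<otimes> inv t \<in> ratio_field S"
  unfolding ratio_field_def by (rule subsetD[OF gen_incl(2)]) blast

lemma ratio_field_min:
  assumes M: "subfield M R" "G \<subseteq> M" and e: "e \<in> carrier R" "e \<noteq> \<zero>" "S \<subseteq> (\<otimes>) e ` M"
  shows "ratio_field S \<subseteq> M"
proof -
  note MD = subfieldD[OF M(1)]
  have c: "S \<subseteq> carrier R" using e MD(1) by auto
  have "s \<otimes> inv t \<in> M" if st: "s \<in> S" "t \<in> S" "t \<noteq> \<zero>" for s t
  proof -
    obtain m n where mn: "m \<in> M" "s = e \<otimes> m" "n \<in> M" "t = e \<otimes> n" using st e(3) by blast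
    have mc: "m \<in> carrier R" "n \<in> carrier R" using mn MD(1) by auto
    have n0: "n \<noteq> \<zero>" using st(3) mn(4) e by auto
    note e' = nonzero_inverse[OF e(1,2)] and n' = nonzero_inverse[OF mc(2) n0]
    note cc = e(1) e'(1) n'(1) mc
    have "(e \<otimes> n) \<otimes> (inv e \<otimes> inv n) = (e \<otimes> inv e) \<otimes> (n \<otimes> inv n)"
      using cc by (simp add: m_ac)
    then have "inv t = inv e \<otimes> inv n"
      unfolding mn(4) using e'(4) n'(4) cc by (intro comm_inv_char) auto
    then have "s \<otimes> inv t = (e \<otimes> inv e) \<otimes> (m \<otimes> inv n)"
      unfolding mn(2) using cc by (simp add: m_ac)
    also have "\<dots> = m \<otimes> inv n" using e'(4) cc by simp
    finally show ?thesis using MD(7)[OF mn(1) MD(8)[OF mn(3) n0]] by simp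
  qed
  then show ?thesis
    unfolding ratio_field_def by (intro gen_min M ratios_carrier c) blast
qed

lemma subset_ratio_field:
  assumes "S \<subseteq> carrier R" "t \<in> S" "t \<noteq> \<zero>"
  shows "S \<subseteq> (\<otimes>) t ` ratio_field S"
proof
  fix s assume s: "s \<in> S"
  have tc: "t \<in> carrier R" "s \<in> carrier R" using assms s by auto
  note t' = nonzero_inverse[OF tc(1) assms(3)]
  have "s \<otimes> inv t \<in> ratio_field S"
  proof (cases "s = \<zero>")
    case True
    then show ?thesis using t' subfieldD(2)[OF subfield_ratio_field[OF assms(1)]] by simp
  qed (use ratio_mem s assms in blast)
  moreover have "s = t \<otimes> (s \<otimes> inv t)" using tc t' by (simp add: m_lcomm)
  ultimately show "s \<in> (\<otimes>) t ` ratio_field S" by blast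
qed

lemma ratio_field_smult:
  assumes "S \<subseteq> carrier R" "x \<in> carrier R" "x \<noteq> \<zero>" "S \<noteq> {\<zero>}" "S \<noteq> {}"
  shows "ratio_field ((\<otimes>) x ` S) = ratio_field S"
proof
  obtain t where t: "t \<in> S" "t \<noteq> \<zero>" using assms(4,5) by blast
  have tc: "t \<in> carrier R" using t assms by blast
  note x' = nonzero_inverse[OF assms(2,3)]
  have xc: "(\<otimes>) x ` S \<subseteq> carrier R" using assms by auto
  have xt: "x \<otimes> t \<in> (\<otimes>) x ` S" "x \<otimes> t \<noteq> \<zero>" "x \<otimes> t \<in> carrier R"
    using t tc assms integral by auto
  have F: "ratio_field S \<subseteq> carrier R" "ratio_field ((\<otimes>) x ` S) \<subseteq> carrier R"
    using subfieldD(1) subfield_ratio_field assms(1) xc by blast+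
  have "(\<otimes>) x ` S \<subseteq> (\<otimes>) x ` (\<otimes>) t ` ratio_field S"
    by (intro image_mono subset_ratio_field assms t)
  also have "\<dots> = (\<otimes>) (x \<otimes> t) ` ratio_field S"
    unfolding image_image by (rule image_cong) (use F tc assms in \<open>auto simp: m_assoc subset_iff\<close>)
  finally show "ratio_field ((\<otimes>) x ` S) \<subseteq> ratio_field S"
    using xt by (intro ratio_field_min[where e = "x \<otimes> t"] subfield_ratio_field assms)
      (auto simp: ratio_field_def intro: gen_incl(1)[THEN subsetD])
  have "S = (\<otimes>) (inv x) ` (\<otimes>) x ` S" using smult_inv_image(1)[OF assms(2,3,1)] by simp
  also have "\<dots> \<subseteq> (\<otimes>) (inv x) ` (\<otimes>) (x \<otimes> t) ` ratio_field ((\<otimes>) x ` S)"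
    by (rule image_mono) (rule subset_ratio_field[OF xc xt(1,2)])
  also have "\<dots> = (\<otimes>) t ` ratio_field ((\<otimes>) x ` S)"
    unfolding image_image
    by (rule image_cong) (use F tc assms x' in \<open>auto simp: subset_iff simp flip: m_assoc\<close>)
  finally show "ratio_field S \<subseteq> ratio_field ((\<otimes>) x ` S)"
    using t tc by (intro ratio_field_min[where e = t] subfield_ratio_field xc)
      (auto simp: ratio_field_def intro: gen_incl(1)[THEN subsetD])
qed

lemma minimal_space_nonzero: "minimal_space S \<Longrightarrow> S \<noteq> {\<zero>}"
proof
  assume "minimal_space S" "S = {\<zero>}"
  then have "2 * dim G (ratio_field {\<zero>}) = 1" using dim_zero[OF G] by (simp add: minimal_space_def)
  then show False by presburger
qed

lemma minimal_space_smult: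
  assumes "minimal_space S" "x \<in> carrier R" "x \<noteq> \<zero>"
  shows "minimal_space ((\<otimes>) x ` S)"
proof -
  have f: "finite_dimension G S" using assms(1) by (simp add: minimal_space_def)
  note S = subalgebraD[OF finite_dimension_imp_subalgebra[OF G f]]
  show ?thesis
    using assms(1) finite_dimension_smult[OF G assms(2,3) f] dim_smult[OF G assms(2,3) f]
      ratio_field_smult[OF S(1) assms(2,3) minimal_space_nonzero[OF assms(1)]] ex_in_conv[of S] S(2)
    unfolding minimal_space_def by metis
qed

text \<open>
  Subspaces of a minimal space are minimal: if few generators \<open>X\<close> sufficed for the vectors \<open>us\<close>, then
  together with one generator for each further vector of a basis of \<open>S\<close> they would generate the ratio field
  of \<open>S\<close>, which would then have too small a degree. This is the form in which minimality is used.
\<close>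

lemma minimal_independent:
  assumes min: "minimal_space S" and us: "independent G us" "set us \<subseteq> S"
    and s: "s \<in> S" "s \<noteq> \<zero>" and X: "finite X" "X \<subseteq> carrier R"
    and gen: "\<And>u. u \<in> set us \<Longrightarrow> u \<otimes> inv s \<in> gen X"
  shows "length us \<le> card X + 1"
proof -
  have f: "finite_dimension G S" using min by (simp add: minimal_space_def)
  note S = subalgebraD[OF finite_dimension_imp_subalgebra[OF G f]]
  have sc: "s \<in> carrier R" using s S(1) by blast
  note s' = nonzero_inverse[OF sc s(2)]
  obtain vs where vs: "length (vs @ us) = dim G S" "independent G (vs @ us)" "Span G (vs @ us) = S"
    using complete_base[OF G dimension_dim[OF G f] us] by blast
  have vc: "set (vs @ us) \<subseteq> carrier R" using independent_in_carrier[OF vs(2)] .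
  define Y where "Y = X \<union> (\<lambda>v. v \<otimes> inv s) ` set vs"
  have Y: "finite Y" "Y \<subseteq> carrier R" unfolding Y_def using X vc s' by auto
  have cY: "card Y \<le> card X + length vs"
    unfolding Y_def using card_Un_le[of X] card_image_le[of "set vs"] card_length[of vs]
    by (meson add_left_mono finite_set le_trans)
  note N = subfield_gen[OF Y(2)] and N' = subfieldD[OF subfield_gen[OF Y(2)]]
  have "set (vs @ us) \<subseteq> (\<otimes>) s ` gen Y"
  proof
    fix u assume u: "u \<in> set (vs @ us)"
    then have "u \<in> carrier R" using vc by blast
    then have "u = s \<otimes> (u \<otimes> inv s)" using m_lcomm[OF sc _ s'(1), of u] s'(4) by simp
    moreover have "u \<otimes> inv s \<in> gen Y"
      using u gen gen_incl(2)[of Y] gen_mono[OF _ Y(2), of X] unfolding Y_def by auto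
    ultimately show "u \<in> (\<otimes>) s ` gen Y" by blast
  qed
  then have "S \<subseteq> (\<otimes>) s ` gen Y"
    using subalgebra_Span_incl[OF G subalgebra_smult[OF G subfield_subalgebra[OF G N gen_incl(1)] sc]]
      vs(3) by blast
  then have sub: "ratio_field S \<subseteq> gen Y" by (rule ratio_field_min[OF N gen_incl(1) sc s(2)])
  have "G \<subseteq> ratio_field S" by (simp add: ratio_field_def gen_incl(1))
  then have "dim G (ratio_field S) \<le> dim G (gen Y)"
    using dim_subspace(2)[OF G conjunct1[OF gen_dim[OF Y]] _ sub]
      subfield_subalgebra[OF G subfield_ratio_field[OF S(1)]] by blast
  also have "\<dots> \<le> 2 ^ card Y" using gen_dim[OF Y] by blast
  also have "\<dots> \<le> 2 ^ (card X + length vs)" using cY by simp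
  finally have "2 ^ dim G S \<le> (2::nat) ^ (card X + length vs + 1)"
    using min by (simp add: minimal_space_def)
  then have "dim G S \<le> card X + length vs + 1" by (rule power_le_imp_le_exp[rotated]) simp
  then show ?thesis using vs(1) by simp
qed

text \<open>
  The space \<open>S\<close> lies on a line over its ratio field, hence so does \<open>T\<close>. So the ratio field of \<open>T\<close> is contained
  in that of \<open>S\<close>, and the converse holds by symmetry.
\<close>

lemma minimal_space_transfer:
  assumes eq: "same_span_dims P S T" and P: "subfield P R" "G \<subseteq> P" "finite_dimension G P"
    and S: "minimal_space S" "S \<subseteq> P" and T: "finite_dimension G T" "T \<subseteq> P"
  shows "minimal_space T"
proof -
  have f: "finite_dimension G S" using S(1) by (simp add: minimal_space_def)
  have sub: "ratio_field B \<subseteq> ratio_field A"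
    if eq: "same_span_dims P A B" and A: "finite_dimension G A" "A \<noteq> {\<zero>}" "A \<subseteq> P"
      and B: "finite_dimension G B" "B \<noteq> {\<zero>}" for A B
  proof -
    note AD = subalgebraD[OF finite_dimension_imp_subalgebra[OF G A(1)]]
    note BD = subalgebraD[OF finite_dimension_imp_subalgebra[OF G B(1)]]
    obtain a where a: "a \<in> A" "a \<noteq> \<zero>" using A(2) AD(2) by blast
    obtain b where b: "b \<in> B" "b \<noteq> \<zero>" using B(2) BD(2) by blast
    have abc: "a \<in> carrier R" "b \<in> carrier R" using a b AD(1) BD(1) by auto
    have "P = (\<otimes>) \<one> ` P" using subfieldD(1)[OF P(1)] by (auto simp: image_iff subset_iff)
    then have rP: "ratio_field A \<subseteq> P" using ratio_field_min[OF P(1,2), of \<one> A] A(3) by auto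
    note F = subfield_ratio_field[OF AD(1)]
    have GF: "G \<subseteq> ratio_field A" by (simp add: ratio_field_def gen_incl(1))
    have fin: "finite_dimension G (ratio_field A)"
      using dim_subspace(1)[OF G P(3) subfield_subalgebra[OF G F GF] rP] .
    have "B \<subseteq> (\<otimes>) b ` ratio_field A"
      by (rule line_transfer[OF eq A(1) B(1) F GF rP fin A(2) abc(1) a(2)
            subset_ratio_field[OF AD(1) a] b])
    then show ?thesis by (rule ratio_field_min[OF F GF abc(2) b(2)])
  qed
  have d: "dim G S = dim G T" by (rule same_span_dims_dim[OF eq P(2) f T(1)])
  have S0: "S \<noteq> {\<zero>}" by (rule minimal_space_nonzero[OF S(1)])
  have T0: "T \<noteq> {\<zero>}" using dim_pos[OF f S0] d dim_zero[OF G] by auto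
  have "ratio_field S = ratio_field T"
    using sub[OF eq f S0 S(2) T(1) T0] sub[OF same_span_dims_sym[OF eq] T(1) T0 T(2) f S0] by blast
  then show ?thesis using S(1) d T(1) by (simp add: minimal_space_def)
qed

lemma linear_relation_trivial:
  assumes "subfield N R" "y \<in> carrier R" "y \<notin> N" "a \<in> N" "b \<in> N" "a \<otimes> y \<oplus> b = \<zero>"
  shows "a = \<zero>" "b = \<zero>"
proof -
  note N = subfieldD[OF assms(1)]
  have c: "a \<in> carrier R" "b \<in> carrier R" using assms(4,5) N(1) by blast+
  show a: "a = \<zero>"
  proof (rule ccontr)
    assume a: "a \<noteq> \<zero>"
    note a' = nonzero_inverse[OF c(1) a]
    have "a \<otimes> y = \<ominus> b" using assms(6) c assms(2) by (simp add: minus_equality)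
    moreover have "y = inv a \<otimes> (a \<otimes> y)" using a' c assms(2) by (simp flip: m_assoc)
    ultimately have "y = inv a \<otimes> (\<ominus> b)" by simp
    then show False using N(5)[OF assms(5)] N(7)[OF N(8)[OF assms(4) a]] assms(3) by auto
  qed
  then show "b = \<zero>" using assms(2,6) c by simp
qed

lemma line_subset:
  assumes T: "subalgebra G T R" and a: "a \<in> carrier R" and t: "t \<in> T" "a \<otimes> t \<in> T" and v: "v \<in> adjoin G a"
  shows "t \<otimes> v \<in> T"
proof -
  note TD = subalgebraD[OF T]
  obtain g h where gh: "g \<in> G" "h \<in> G" "v = g \<oplus> a \<otimes> h" using v by (auto simp: adjoin_iff)
  have c: "g \<in> carrier R" "h \<in> carrier R" "t \<in> carrier R" using gh t GD(1) TD(1) by auto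
  have "t \<otimes> v = g \<otimes> t \<oplus> h \<otimes> (a \<otimes> t)" unfolding gh(3) using c a by algebra
  then show ?thesis using TD(3)[OF TD(6)[OF gh(1) t(1)] TD(6)[OF gh(2) t(2)]] by simp
qed

lemma Span_Cons_iff: "a \<in> Span K (u # us) \<longleftrightarrow> (\<exists>k\<in>K. \<exists>v\<in>Span K us. a = k \<otimes> u \<oplus> v)"
  by (simp add: line_extension_mem_iff)

lemma Span_one: "Span G [\<one>] = G"
  unfolding set_eq_iff Span_Cons_iff[of _ G \<one>] using GD(1) by (auto simp: subset_iff)

lemma Span_pair: "x \<in> carrier R \<Longrightarrow> Span G [x, \<one>] \<subseteq> adjoin G x"
  unfolding subset_iff Span_Cons_iff[of _ G x] Span_one adjoin_iff
  using GD(1) by (auto simp: a_comm m_comm subset_iff)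

text \<open>
  The space \<open>T\<close> contains the lines \<open>t\<langle>1, x\<rangle>\<close> and \<open>t'\<langle>1, y\<rangle>\<close>, and \<open>xy\<close> is a ratio of elements of \<open>T\<close>; up to
  a square in \<open>G\<close> it is the ratio \<open>x/y\<close>. Suppose that the lines are disjoint and let \<open>t = 1\<close>, \<open>t' = u\<close>.
  Complete the independent vectors \<open>1, x, u, uy\<close> of \<open>T\<close> to a basis by vectors \<open>vs\<close>, and let
  \<open>M = G(u, vs)\<close>. By minimality \<open>1, x, y, xy\<close> are independent over \<open>M\<close>. Since \<open>T \<subseteq> M + xG + uyG\<close>, comparison
  of coefficients shows that \<open>\<sigma>\<close> and \<open>xy\<sigma>\<close> cannot both lie in \<open>T\<close> unless \<open>\<sigma> = 0\<close>.
\<close>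

lemma lines_meet:
  assumes min: "minimal_space T" and xy: "x \<in> carrier R" "x \<notin> G" "y \<in> carrier R" "y \<notin> adjoin G x"
    and t: "t \<in> T" "t \<noteq> \<zero>" "x \<otimes> t \<in> T" and t': "t' \<in> T" "t' \<noteq> \<zero>" "y \<otimes> t' \<in> T"
    and \<tau>: "\<tau> \<in> T" "\<tau> \<noteq> \<zero>" "x \<otimes> y \<otimes> \<tau> \<in> T"
  shows "\<exists>g\<in>adjoin G x. \<exists>h\<in>adjoin G y. g \<noteq> \<zero> \<and> h \<noteq> \<zero> \<and> t \<otimes> g = t' \<otimes> h"
proof (rule ccontr)
  assume no: "\<not> ?thesis"
  have f: "finite_dimension G T" using min by (simp add: minimal_space_def)
  note sT = finite_dimension_imp_subalgebra[OF G f]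
  note TD = subalgebraD[OF sT]
  have c: "t \<in> carrier R" "t' \<in> carrier R" "\<tau> \<in> carrier R" using t t' \<tau> TD(1) by auto
  note i = nonzero_inverse[OF c(1) t(2)]
  define T1 where "T1 = (\<otimes>) (inv t) ` T"
  define u where "u = inv t \<otimes> t'"
  define \<sigma> where "\<sigma> = inv t \<otimes> \<tau>"
  have min1: "minimal_space T1" unfolding T1_def by (rule minimal_space_smult[OF min i(1,2)])
  have f1: "finite_dimension G T1" using min1 by (simp add: minimal_space_def)
  have s1: "subalgebra G T1 R" by (rule finite_dimension_imp_subalgebra[OF G f1])
  have uc: "u \<in> carrier R" "u \<noteq> \<zero>" "\<sigma> \<in> carrier R" "\<sigma> \<noteq> \<zero>"
    unfolding u_def \<sigma>_def using i c t'(2) \<tau>(2) integral by auto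
  have tu: "t \<otimes> u = t'" unfolding u_def using i c by (simp flip: m_assoc)
  have "inv t \<otimes> (x \<otimes> t) = x"
    using m_lcomm[OF i(1) xy(1) c(1)] i(3) xy(1) by simp
  moreover have "inv t \<otimes> (y \<otimes> t') = u \<otimes> y" "inv t \<otimes> (x \<otimes> y \<otimes> \<tau>) = x \<otimes> y \<otimes> \<sigma>"
    unfolding u_def \<sigma>_def using i(1) c xy(1,3) by (simp_all add: m_ac)
  moreover note i(3)
  ultimately have mem: "\<one> \<in> T1" "x \<in> T1" "u \<in> T1" "u \<otimes> y \<in> T1" "\<sigma> \<in> T1" "x \<otimes> y \<otimes> \<sigma> \<in> T1"
    unfolding T1_def u_def \<sigma>_def using t t' \<tau> by (auto simp: image_iff dest: sym)
  note Gx = subfield_adjoin[OF G order_refl xy(1)] and Gy = subfield_adjoin[OF G order_refl xy(3)]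
  note GxD = subfieldD[OF Gx] and GyD = subfieldD[OF Gy]
  note ix = adjoin_incl[OF G xy(1)] and iy = adjoin_incl[OF G xy(3)]
  have yG: "y \<notin> G" using ix xy(4) by blast
  \<comment> \<open>a vector common to both lines contradicts the assumption\<close>
  have u_meet: False if "h \<in> adjoin G y" "h \<noteq> \<zero>" "u \<otimes> h \<in> adjoin G x" for h
  proof -
    have hc: "h \<in> carrier R" using that GyD(1) by blast
    have "t \<otimes> (u \<otimes> h) = t' \<otimes> h" using tu c uc hc by (simp flip: m_assoc)
    moreover have "u \<otimes> h \<noteq> \<zero>" using uc hc that(2) integral by blast
    ultimately show False using no that by blast
  qed
  have u_x: "u \<notin> adjoin G x" using u_meet[of \<one>] GyD(3) uc one_not_zero by auto
  then have uG: "u \<notin> G" using ix by blast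
  note S1 = Span_one and Sx = Span_pair[OF xy(1)]
  have ind: "independent G [u \<otimes> y, u, x, \<one>]"
  proof (intro li_Cons li_Nil)
    show "\<one> \<notin> Span G []" by simp
    show "x \<notin> Span G [\<one>]" using S1 xy(2) by simp
    show "u \<notin> Span G [x, \<one>]" using u_x Sx by blast
    show "u \<otimes> y \<notin> Span G [u, x, \<one>]"
    proof
      assume "u \<otimes> y \<in> Span G [u, x, \<one>]"
      then obtain k v where kv: "k \<in> G" "v \<in> Span G [x, \<one>]" "u \<otimes> y = k \<otimes> u \<oplus> v"
        unfolding Span_Cons_iff[of _ G u] by blast
      have v: "v \<in> adjoin G x" "v \<in> carrier R" using kv(2) Sx GxD(1) by auto
      have kc: "k \<in> carrier R" using kv(1) GD(1) by blast
      have "u \<otimes> (y \<ominus> k) = u \<otimes> y \<ominus> k \<otimes> u" using kc uc xy(3) by algebra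
      also have "\<dots> = v" unfolding kv(3) using kc uc v(2) by algebra
      finally have "u \<otimes> (y \<ominus> k) = v" .
      moreover have "y \<ominus> k \<in> adjoin G y" using GyD(6)[OF iy(2)] iy(1) kv(1) by blast
      moreover have "y \<ominus> k \<noteq> \<zero>" using kc xy(3) kv(1) yG by auto
      ultimately show False using u_meet v(1) by blast
    qed
  qed (use uc xy in auto)
  have "set [u \<otimes> y, u, x, \<one>] \<subseteq> T1" using mem by simp
  then obtain vs where vs: "independent G (vs @ [u \<otimes> y, u, x, \<one>])" "Span G (vs @ [u \<otimes> y, u, x, \<one>]) = T1"
    using complete_base[OF G dimension_dim[OF G f1] ind] by blast
  have vc: "set vs \<subseteq> carrier R" using independent_in_carrier[OF vs(1)] by simp
  have vT: "set (vs @ [u \<otimes> y, u, x, \<one>]) \<subseteq> T1"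
    using Span_base_incl[OF G independent_in_carrier[OF vs(1)]] unfolding vs(2) .
  define M where "M = gen (insert u (set vs))"
  define Nx where "Nx = gen (insert x (insert u (set vs)))"
  define Ny where "Ny = gen (insert y (insert u (set vs)))"
  have cM: "insert u (set vs) \<subseteq> carrier R" and cNx: "insert x (insert u (set vs)) \<subseteq> carrier R"
    and cNy: "insert y (insert u (set vs)) \<subseteq> carrier R" using vc uc xy by auto
  have M: "subfield M R" and Nx: "subfield Nx R" and Ny: "subfield Ny R"
    unfolding M_def Nx_def Ny_def by (intro subfield_gen cM cNx cNy)+
  note MD = subfieldD[OF M] and NxD = subfieldD[OF Nx] and NyD = subfieldD[OF Ny]
  have MN: "M \<subseteq> Nx" "M \<subseteq> Ny" unfolding M_def Nx_def Ny_def
    by (rule gen_mono[OF _ cNx] gen_mono[OF _ cNy]; blast)+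
  have GM: "G \<subseteq> M" unfolding M_def by (rule gen_incl(1))
  have xN: "x \<in> Nx" "y \<in> Ny" "u \<in> M" unfolding M_def Nx_def Ny_def using gen_incl(2) by blast+
  have vsM: "set vs \<subseteq> M" unfolding M_def using gen_incl(2) by blast
  \<comment> \<open>by minimality, a single element adjoined to \<open>M\<close> does not give both \<open>x\<close> and \<open>y\<close>\<close>
  have both: False if X: "insert a (insert u (set vs)) \<subseteq> carrier R"
      "x \<in> gen (insert a (insert u (set vs)))" "y \<in> gen (insert a (insert u (set vs)))" for a
  proof -
    let ?X = "insert a (insert u (set vs))"
    note N = subfieldD[OF subfield_gen[OF X(1)]]
    have "length (vs @ [u \<otimes> y, u, x, \<one>]) \<le> card ?X + 1"
    proof (rule minimal_independent[OF min1 vs(1) vT mem(1) one_not_zero _ X(1)])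
      fix w assume w: "w \<in> set (vs @ [u \<otimes> y, u, x, \<one>])"
      have u: "u \<in> gen ?X" "set vs \<subseteq> gen ?X" using gen_incl(2)[of ?X] by auto
      have "w \<in> gen ?X" using w N(3) N(7)[OF u(1) X(3)] X(2) u by auto
      then show "w \<otimes> inv \<one> \<in> gen ?X" using N(1) by (auto simp: subset_iff)
    qed simp
    moreover have "card ?X \<le> length vs + 2"
      using card_length[of vs] card_insert_le_m1 by (simp add: card_insert_if)
    ultimately show False by simp
  qed
  have yNx: "y \<notin> Nx" and xNy: "x \<notin> Ny"
    using both[OF cNx] both[OF cNy] xN unfolding Nx_def Ny_def by blast+
  define V where "V = M <+>\<^bsub>R\<^esub> ((\<otimes>) x ` G <+>\<^bsub>R\<^esub> (\<otimes>) (u \<otimes> y) ` G)"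
  have GG: "subalgebra G G R" and GMs: "subalgebra G M R" using subfield_subalgebra[OF G] G M GM by auto
  have uyc: "u \<otimes> y \<in> carrier R" using uc xy by simp
  have Vs: "subalgebra G V R"
    unfolding V_def by (intro subalgebra_set_add[OF G] subalgebra_smult[OF G] GG GMs xy(1) uyc)
  have VI: "r \<oplus> (x \<otimes> g \<oplus> (u \<otimes> y) \<otimes> h) \<in> V" if "r \<in> M" "g \<in> G" "h \<in> G" for r g h
  proof -
    have "x \<otimes> g \<oplus> (u \<otimes> y) \<otimes> h \<in> (\<otimes>) x ` G <+>\<^bsub>R\<^esub> (\<otimes>) (u \<otimes> y) ` G"
      unfolding set_add_iff[of _ "(\<otimes>) x ` G"] using that(2,3) by blast
    then show ?thesis unfolding V_def set_add_iff[of _ M] using that(1) by blast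
  qed
  have VE: "\<exists>r\<in>M. \<exists>g\<in>G. \<exists>h\<in>G. w = r \<oplus> (x \<otimes> g \<oplus> (u \<otimes> y) \<otimes> h)" if wV: "w \<in> V" for w
  proof -
    obtain r v where rv: "r \<in> M" "v \<in> (\<otimes>) x ` G <+>\<^bsub>R\<^esub> (\<otimes>) (u \<otimes> y) ` G" "w = r \<oplus> v"
      using wV unfolding V_def set_add_iff[of _ M] by blast
    then obtain g h where "g \<in> G" "h \<in> G" "v = x \<otimes> g \<oplus> (u \<otimes> y) \<otimes> h"
      unfolding set_add_iff[of _ "(\<otimes>) x ` G"] by blast
    then show ?thesis using rv by blast
  qed
  have "x = \<zero> \<oplus> (x \<otimes> \<one> \<oplus> (u \<otimes> y) \<otimes> \<zero>)" "u \<otimes> y = \<zero> \<oplus> (x \<otimes> \<zero> \<oplus> (u \<otimes> y) \<otimes> \<one>)"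
    using xy uc by auto
  then have xV: "x \<in> V" "u \<otimes> y \<in> V" using VI[OF MD(2) GD(3,2)] VI[OF MD(2) GD(2,3)] by auto
  have MV: "r \<in> V" if "r \<in> M" for r
  proof -
    have "r = r \<oplus> (x \<otimes> \<zero> \<oplus> (u \<otimes> y) \<otimes> \<zero>)" using that MD(1) xy uc by auto
    then show ?thesis using VI[OF that GD(2,2)] by simp
  qed
  have "set (vs @ [u \<otimes> y, u, x, \<one>]) \<subseteq> V" using xV MV vsM xN(3) MD(3) by auto
  then have TV: "T1 \<subseteq> V" using subalgebra_Span_incl[OF G Vs] vs(2) by blast
  obtain r g h where rgh: "r \<in> M" "g \<in> G" "h \<in> G" "\<sigma> = r \<oplus> (x \<otimes> g \<oplus> (u \<otimes> y) \<otimes> h)"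
    using VE[OF subsetD[OF TV mem(5)]] by blast
  obtain r' g' h' where rgh': "r' \<in> M" "g' \<in> G" "h' \<in> G"
      "x \<otimes> y \<otimes> \<sigma> = r' \<oplus> (x \<otimes> g' \<oplus> (u \<otimes> y) \<otimes> h')"
    using VE[OF subsetD[OF TV mem(6)]] by blast
  have cc: "r \<in> carrier R" "g \<in> carrier R" "h \<in> carrier R" "r' \<in> carrier R" "g' \<in> carrier R" "h' \<in> carrier R"
    using rgh rgh' MD(1) GD(1) by auto
  \<comment> \<open>the coefficients of \<open>y\<close> and \<open>1\<close> over \<open>M(x)\<close>, each split into those of \<open>x\<close> and \<open>1\<close> over \<open>M\<close>\<close>
  let ?a2 = "g \<otimes> (x \<otimes> x) \<ominus> h' \<otimes> u" and ?b1 = "h \<otimes> (y \<otimes> y) \<otimes> u \<ominus> g'"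
  let ?a = "r \<otimes> x \<oplus> ?a2" and ?b = "?b1 \<otimes> x \<oplus> \<ominus> r'"
  have "?a \<otimes> y \<oplus> ?b = x \<otimes> y \<otimes> (r \<oplus> (x \<otimes> g \<oplus> (u \<otimes> y) \<otimes> h)) \<ominus> (r' \<oplus> (x \<otimes> g' \<oplus> (u \<otimes> y) \<otimes> h'))"
    using cc xy(1,3) uc(1) by algebra
  also have "\<dots> = \<zero>" unfolding rgh(4)[symmetric] rgh'(4) using cc xy(1,3) uc(1) by algebra
  finally have rel: "?a \<otimes> y \<oplus> ?b = \<zero>" .
  have xx: "x \<otimes> x \<in> G" "y \<otimes> y \<in> G" using square_mem xy by auto
  note inM = subsetD[OF GM]
  have a2: "?a2 \<in> M"
    using MD(6)[OF MD(7)[OF inM[OF rgh(2)] inM[OF xx(1)]] MD(7)[OF inM[OF rgh'(3)] xN(3)]] .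
  have b1: "?b1 \<in> M"
    using MD(6)[OF MD(7)[OF MD(7)[OF inM[OF rgh(3)] inM[OF xx(2)]] xN(3)] inM[OF rgh'(2)]] .
  note inNx = subsetD[OF MN(1)] and inNy = subsetD[OF MN(2)]
  have aN: "?a \<in> Nx" using NxD(4)[OF NxD(7)[OF inNx[OF rgh(1)] xN(1)] inNx[OF a2]] .
  have bN: "?b \<in> Nx" using NxD(4)[OF NxD(7)[OF inNx[OF b1] xN(1)] NxD(5)[OF inNx[OF rgh'(1)]]] .
  note ab = linear_relation_trivial[OF Nx xy(3) yNx aN bN rel]
  have A: "r = \<zero>" "?a2 = \<zero>"
    using linear_relation_trivial[OF Ny xy(1) xNy inNy[OF rgh(1)] inNy[OF a2] ab(1)] .
  have B: "?b1 = \<zero>"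
    using linear_relation_trivial(1)[OF Ny xy(1) xNy inNy[OF b1] NyD(5)[OF inNy[OF rgh'(1)]] ab(2)] .
  have "h \<otimes> (y \<otimes> y) \<otimes> u \<oplus> \<ominus> g' = \<zero>" using B by (simp add: a_minus_def)
  then have "h \<otimes> (y \<otimes> y) = \<zero>"
    using linear_relation_trivial(1)[OF G uc(1) uG GD(7)[OF rgh(3) xx(2)] GD(5)[OF rgh'(2)]] by blast
  moreover have "y \<noteq> \<zero>" "x \<noteq> \<zero>" using yG xy(2) GD(2) by blast+
  then have nz: "y \<otimes> y \<noteq> \<zero>" "x \<otimes> x \<noteq> \<zero>" using xy(1,3) integral by blast+
  ultimately have h: "h = \<zero>" using integral[of h "y \<otimes> y"] cc xy(3) by blast
  have "\<ominus> h' \<otimes> u \<oplus> g \<otimes> (x \<otimes> x) = ?a2" using cc xy(1) uc(1) by algebra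
  then have "g \<otimes> (x \<otimes> x) = \<zero>"
    using linear_relation_trivial(2)[OF G uc(1) uG GD(5)[OF rgh'(3)] GD(7)[OF rgh(2) xx(1)]] A(2) by simp
  then have g: "g = \<zero>" using integral[of g "x \<otimes> x"] nz cc xy(1) by blast
  have "\<sigma> = \<zero>" unfolding rgh(4) A(1) g h using xy uc by simp
  then show False using uc by blast
qed

text \<open>
  For \<open>a1, a2 \<in> S\<close> independent of each other and of 1, let \<open>p\<close> be the point where their lines in \<open>T\<close> meet. The
  line of a further \<open>a \<in> S\<close> meets \<open>p\<langle>1, a1\<rangle>\<close> and \<open>p\<langle>1, a2\<rangle>\<close>. If it did so in two different
  points, their ratio would show that \<open>a\<close> lies in \<open>G(a1, a2)\<close>, against the minimality of \<open>S\<close>. So the points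
  coincide, and \<open>p\<close> is the only point that the two lines share. Hence the line of \<open>a\<close> passes through \<open>p\<close>, that
  is, \<open>p a \<in> T\<close>.
\<close>

lemma minimal_contains_multiple:
  assumes eq: "same_span_dims P S T" and P: "subfield P R" "G \<subseteq> P" "finite_dimension G P"
    and S: "minimal_space S" "S \<subseteq> P" "\<one> \<in> S" and T: "finite_dimension G T" "T \<subseteq> P"
  shows "\<exists>p\<in>T. p \<noteq> \<zero> \<and> (\<forall>a\<in>S. p \<otimes> a \<in> T)"
proof -
  have minT: "minimal_space T" by (rule minimal_space_transfer[OF eq P S(1,2) T])
  have f: "finite_dimension G S" using S(1) by (simp add: minimal_space_def)
  note sT = finite_dimension_imp_subalgebra[OF G T(1)] and sS = finite_dimension_imp_subalgebra[OF G f]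
  note TD = subalgebraD[OF sT] and SD = subalgebraD[OF sS] and PD = subfieldD[OF P(1)]
  have T0: "\<exists>t\<in>T. t \<noteq> \<zero>"
    using exists_nonzero[OF T(1) dim_pos[OF T(1) minimal_space_nonzero[OF minT]]] .
  have line: "\<exists>t\<in>T. t \<noteq> \<zero> \<and> a \<otimes> t \<in> T" if a: "a \<in> S" for a
  proof (cases "a = \<zero>")
    case True
    obtain t where t: "t \<in> T" "t \<noteq> \<zero>" using T0 by blast
    then have "a \<otimes> t = \<zero>" using True TD(1) by auto
    then show ?thesis using t TD(2) by metis
  next
    case False
    have "a \<otimes> \<one> \<in> S" using a SD(1) by auto
    then show ?thesis
      using ratio_transfer[OF eq P(1,2) f T(1) _ False S(3) one_not_zero] a S(2) by blast
  qed
  have meet: "\<exists>g\<in>adjoin G x. \<exists>h\<in>adjoin G y. g \<noteq> \<zero> \<and> h \<noteq> \<zero> \<and> t \<otimes> g = t' \<otimes> h"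
    if xy: "x \<in> S" "x \<notin> G" "y \<in> S" "y \<notin> adjoin G x"
      and t: "t \<in> T" "t \<noteq> \<zero>" "x \<otimes> t \<in> T" and t': "t' \<in> T" "t' \<noteq> \<zero>" "y \<otimes> t' \<in> T" for x y t t'
  proof -
    have c: "x \<in> carrier R" "y \<in> carrier R" using xy SD(1) by auto
    have y0: "y \<noteq> \<zero>" using xy(4) adjoin_incl(1)[OF G c(1)] GD(2) by blast
    have x0: "x \<noteq> \<zero>" using xy(2) GD(2) by blast
    note y' = nonzero_inverse[OF c(2) y0]
    have "x \<otimes> inv y \<in> P" using PD(7)[OF _ PD(8)] xy S(2) y0 by blast
    moreover have "x \<otimes> inv y \<noteq> \<zero>" using x0 y' c integral by blast
    moreover have "x \<otimes> inv y \<otimes> y \<in> S" using c y' xy(1) by (simp add: m_assoc)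
    ultimately obtain \<tau> where \<tau>: "\<tau> \<in> T" "\<tau> \<noteq> \<zero>" "x \<otimes> inv y \<otimes> \<tau> \<in> T"
      using ratio_transfer[OF eq P(1,2) f T(1) _ _ xy(3) y0] by blast
    have \<tau>c: "\<tau> \<in> carrier R" using \<tau> TD(1) by blast
    have "y \<otimes> y \<otimes> (x \<otimes> inv y \<otimes> \<tau>) = (y \<otimes> inv y) \<otimes> (x \<otimes> y \<otimes> \<tau>)"
      using c y'(1) \<tau>c by algebra
    also have "\<dots> = x \<otimes> y \<otimes> \<tau>" using y'(4) c \<tau>c by simp
    finally have "x \<otimes> y \<otimes> \<tau> \<in> T" using TD(6)[OF square_mem[OF c(2)] \<tau>(3)] by simp
    then show ?thesis by (rule lines_meet[OF minT c(1) xy(2) c(2) xy(4) t t' \<tau>(1,2)])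
  qed
  show ?thesis
  proof (cases "S \<subseteq> G")
    case True
    obtain t where t: "t \<in> T" "t \<noteq> \<zero>" using T0 by blast
    have "t \<otimes> a \<in> T" if "a \<in> S" for a
    proof -
      have "a \<in> G" "t \<in> carrier R" using that True t TD(1) by auto
      then have "t \<otimes> a = a \<otimes> t" using GD(1) by (auto simp: m_comm)
      then show ?thesis using TD(6)[OF \<open>a \<in> G\<close> t(1)] by simp
    qed
    then show ?thesis using t by blast
  next
    case False
    then obtain a1 where a1: "a1 \<in> S" "a1 \<notin> G" by blast
    have a1c: "a1 \<in> carrier R" using a1 SD(1) by blast
    obtain t1 where t1: "t1 \<in> T" "t1 \<noteq> \<zero>" "a1 \<otimes> t1 \<in> T" using line[OF a1(1)] by blast
    show ?thesis
    proof (cases "S \<subseteq> adjoin G a1")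
      case True
      then show ?thesis using line_subset[OF sT a1c t1(1,3)] t1(1,2) by blast
    next
      case False
      then obtain a2 where a2: "a2 \<in> S" "a2 \<notin> adjoin G a1" by blast
      have a2c: "a2 \<in> carrier R" using a2 SD(1) by blast
      obtain t2 where t2: "t2 \<in> T" "t2 \<noteq> \<zero>" "a2 \<otimes> t2 \<in> T" using line[OF a2(1)] by blast
      obtain g h where gh: "g \<in> adjoin G a1" "h \<in> adjoin G a2" "g \<noteq> \<zero>" "h \<noteq> \<zero>" "t1 \<otimes> g = t2 \<otimes> h"
        using meet[OF a1 a2 t1 t2] by blast
      define p where "p = t1 \<otimes> g"
      note F1 = subfield_adjoin[OF G order_refl a1c] and F2 = subfield_adjoin[OF G order_refl a2c]
      note F1D = subfieldD[OF F1] and F2D = subfieldD[OF F2]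
      note i1 = adjoin_incl[OF G a1c] and i2 = adjoin_incl[OF G a2c]
      have c: "t1 \<in> carrier R" "t2 \<in> carrier R" "g \<in> carrier R" "h \<in> carrier R"
        using t1 t2 gh F1D(1) F2D(1) TD(1) by auto
      have p: "p \<in> T" "p \<noteq> \<zero>" "p \<in> carrier R"
        unfolding p_def using line_subset[OF sT a1c t1(1,3) gh(1)] c t1(2) gh(3) integral by auto
      \<comment> \<open>a line over \<open>G(a1)\<close> is spanned by any of its nonzero points, so \<open>p\<close> replaces \<open>t1\<close>;
        similarly for \<open>t2\<close>\<close>
      have "a1 \<otimes> p = t1 \<otimes> (g \<otimes> a1)" unfolding p_def using c a1c by algebra
      then have pa1: "a1 \<otimes> p \<in> T" using line_subset[OF sT a1c t1(1,3) F1D(7)[OF gh(1) i1(2)]] by simp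
      have "a2 \<otimes> p = t2 \<otimes> (h \<otimes> a2)" unfolding p_def gh(5) using c a2c by algebra
      then have pa2: "a2 \<otimes> p \<in> T" using line_subset[OF sT a2c t2(1,3) F2D(7)[OF gh(2) i2(2)]] by simp
      have a2G: "a2 \<notin> G" using a2(2) i1(1) by blast
      have "p \<otimes> a \<in> T" if a: "a \<in> S" for a
      proof (cases "a \<in> adjoin G a1 <+>\<^bsub>R\<^esub> (\<otimes>) a2 ` G")
        case True
        then obtain v k where vk: "v \<in> adjoin G a1" "k \<in> G" "a = v \<oplus> a2 \<otimes> k"
          by (auto simp: set_add_iff)
        have vc: "v \<in> carrier R" "k \<in> carrier R" using vk F1D(1) GD(1) by auto
        have "p \<otimes> a = p \<otimes> v \<oplus> k \<otimes> (a2 \<otimes> p)" unfolding vk(3) using vc p(3) a2c by algebra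
        then show ?thesis
          using TD(3)[OF line_subset[OF sT a1c p(1) pa1 vk(1)] TD(6)[OF vk(2) pa2]] by simp
      next
        case a_out: False
        have ac: "a \<in> carrier R" using a SD(1) by blast
        have sub1: "adjoin G a1 \<subseteq> adjoin G a1 <+>\<^bsub>R\<^esub> (\<otimes>) a2 ` G"
          using set_add_incl(1)[OF subfield_subalgebra[OF G F1 i1(1)]
              subalgebra_smult[OF G subfield_subalgebra[OF G G order_refl] a2c]] .
        have sub2: "adjoin G a2 \<subseteq> adjoin G a1 <+>\<^bsub>R\<^esub> (\<otimes>) a2 ` G"
        proof
          fix b assume "b \<in> adjoin G a2"
          then obtain u v where "u \<in> G" "v \<in> G" "b = u \<oplus> a2 \<otimes> v" by (auto simp: adjoin_iff)
          then show "b \<in> adjoin G a1 <+>\<^bsub>R\<^esub> (\<otimes>) a2 ` G" unfolding set_add_iff using i1(1) by blast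
        qed
        note F = subfield_adjoin[OF G order_refl ac]
        note FD = subfieldD[OF F] and i = adjoin_incl[OF G ac]
        obtain t where t: "t \<in> T" "t \<noteq> \<zero>" "a \<otimes> t \<in> T" using line[OF a] by blast
        have tc: "t \<in> carrier R" using t TD(1) by blast
        obtain u1 v1 where uv1: "u1 \<in> adjoin G a1" "v1 \<in> adjoin G a" "u1 \<noteq> \<zero>" "v1 \<noteq> \<zero>"
            "p \<otimes> u1 = t \<otimes> v1"
          using meet[OF a1 a _ p(1,2) pa1 t] a_out sub1 by blast
        obtain u2 v2 where uv2: "u2 \<in> adjoin G a2" "v2 \<in> adjoin G a" "u2 \<noteq> \<zero>" "v2 \<noteq> \<zero>"
            "p \<otimes> u2 = t \<otimes> v2"
          using meet[OF a2(1) a2G a _ p(1,2) pa2 t] a_out sub2 by blast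
        have uvc: "u1 \<in> carrier R" "v1 \<in> carrier R" "u2 \<in> carrier R" "v2 \<in> carrier R"
          using uv1 uv2 F1D(1) F2D(1) FD(1) by auto
        note u1' = nonzero_inverse[OF uvc(1) uv1(3)] and u2' = nonzero_inverse[OF uvc(3) uv2(3)]
        note v2' = nonzero_inverse[OF uvc(4) uv2(4)]
        define r where "r = u1 \<otimes> inv u2"
        have rc: "r \<in> carrier R" unfolding r_def using uvc u2' by simp
        have ru: "r \<otimes> u2 = u1" unfolding r_def using uvc u2' by (simp add: m_assoc)
        have rv: "r \<otimes> v2 = v1"
        proof -
          have "t \<otimes> (r \<otimes> v2) = r \<otimes> (t \<otimes> v2)" using tc rc uvc by (simp add: m_lcomm)
          also have "\<dots> = p \<otimes> (r \<otimes> u2)" unfolding uv2(5)[symmetric] using p(3) rc uvc by (simp add: m_lcomm)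
          also have "\<dots> = t \<otimes> v1" unfolding ru uv1(5) ..
          finally show ?thesis using m_lcancel[OF t(2) tc, of "r \<otimes> v2" v1] rc uvc by simp
        qed
        show ?thesis
        \<comment> \<open>for \<open>r \<in> G\<close> the two points coincide and must be \<open>p\<close>, up to a factor in \<open>G\<close>\<close>
        proof (cases "r \<in> G")
          case True
          obtain k l where kl: "k \<in> G" "l \<in> G" "u2 = k \<oplus> a2 \<otimes> l" using uv2(1) by (auto simp: adjoin_iff)
          have klc: "k \<in> carrier R" "l \<in> carrier R" using kl GD(1) by auto
          have "u2 = inv r \<otimes> u1" if "r \<noteq> \<zero>"
            using nonzero_inverse[OF rc that] rc uvc(3) unfolding ru[symmetric] by (simp flip: m_assoc)
          moreover have r0: "r \<noteq> \<zero>" using ru uv1(3) uvc by auto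
          ultimately have u2F: "u2 \<in> adjoin G a1"
            using F1D(7)[OF _ uv1(1)] GD(8)[OF True] i1(1) by blast
          have "l \<otimes> a2 \<oplus> (k \<ominus> u2) = \<zero>" unfolding kl(3) using klc a2c by algebra
          then have "l = \<zero>"
            using linear_relation_trivial(1)[OF F1 a2c a2(2)] kl i1(1) F1D(6)[OF _ u2F] by blast
          then have "u2 \<in> G" using kl klc a2c by simp
          then have u1G: "u1 \<in> G" using ru GD(7)[OF True] by metis
          have "p = inv u1 \<otimes> (p \<otimes> u1)" using p(3) uvc u1' by (simp add: m_lcomm[of "inv u1"])
          then have "p \<otimes> a = inv u1 \<otimes> (t \<otimes> v1) \<otimes> a" unfolding uv1(5) by simp
          also have "\<dots> = inv u1 \<otimes> (t \<otimes> (v1 \<otimes> a))" using u1'(1) tc uvc ac by (simp add: m_assoc)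
          finally show ?thesis
            using TD(6)[OF GD(8)[OF u1G uv1(3)] line_subset[OF sT ac t(1,3) FD(7)[OF uv1(2) i(2)]]] by simp
        next
          case False
          let ?N = "gen {a1, a2}"
          have Xc: "{a1, a2} \<subseteq> carrier R" using a1c a2c by simp
          note N = subfield_gen[OF Xc]
          note ND = subfieldD[OF N]
          have aN: "a1 \<in> ?N" "a2 \<in> ?N" "G \<subseteq> ?N" using gen_incl[of "{a1, a2}"] by blast+
          have rN: "r \<in> ?N"
            unfolding r_def using adjoin_min[OF N aN(3,1)] adjoin_min[OF N aN(3,2)] uv1(1) uv2(1,3)
            by (intro ND(7,8)) auto
          obtain z w where zw: "z \<in> G" "w \<in> G" "v1 = z \<oplus> a \<otimes> w" using uv1(2) by (auto simp: adjoin_iff)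
          obtain z' w' where zw': "z' \<in> G" "w' \<in> G" "v2 = z' \<oplus> a \<otimes> w'" using uv2(2) by (auto simp: adjoin_iff)
          have zc: "z \<in> carrier R" "w \<in> carrier R" "z' \<in> carrier R" "w' \<in> carrier R" using zw zw' GD(1) by auto
          \<comment> \<open>the equation \<open>v1 = r v2\<close> is linear in \<open>a\<close> with coefficients in \<open>G(a1, a2)\<close>\<close>
          have aNN: "a \<in> ?N"
          proof (rule ccontr)
            assume nN: "a \<notin> ?N"
            have "(w \<ominus> r \<otimes> w') \<otimes> a \<oplus> (z \<ominus> r \<otimes> z') = v1 \<ominus> r \<otimes> v2"
              unfolding zw(3) zw'(3) using zc ac rc by algebra
            also have "\<dots> = \<zero>" unfolding rv using uvc by algebra
            finally have rel: "(w \<ominus> r \<otimes> w') \<otimes> a \<oplus> (z \<ominus> r \<otimes> z') = \<zero>" .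
            have in_N: "w \<ominus> r \<otimes> w' \<in> ?N" "z \<ominus> r \<otimes> z' \<in> ?N"
              using ND(6)[OF _ ND(7)[OF rN]] zw(1,2) zw'(1,2) aN(3) by blast+
            have z0: "w \<ominus> r \<otimes> w' = \<zero>" "z \<ominus> r \<otimes> z' = \<zero>"
              using linear_relation_trivial[OF N ac nN in_N rel] by auto
            have "\<ominus> w' \<otimes> r \<oplus> w = w \<ominus> r \<otimes> w'" "\<ominus> z' \<otimes> r \<oplus> z = z \<ominus> r \<otimes> z'"
              using zc rc by algebra+
            then have "\<ominus> w' = \<zero>" "\<ominus> z' = \<zero>"
              using linear_relation_trivial(1)[OF G rc False GD(5)] zw zw' z0 by metis+
            then have "w' = \<zero>" "z' = \<zero>" using zc minus_minus by force+
            then show False using uv2(4) zw'(3) ac by simp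
          qed
          note S1 = Span_one and Sx = Span_pair[OF a1c]
          have Sxx: "Span G [a2, a1, \<one>] \<subseteq> adjoin G a1 <+>\<^bsub>R\<^esub> (\<otimes>) a2 ` G"
          proof
            fix b assume "b \<in> Span G [a2, a1, \<one>]"
            then obtain k v where kv: "k \<in> G" "v \<in> adjoin G a1" "b = k \<otimes> a2 \<oplus> v"
              unfolding Span_Cons_iff[of _ G a2] using Sx by blast
            then have "b = v \<oplus> a2 \<otimes> k"
              using subsetD[OF GD(1) kv(1)] subsetD[OF F1D(1) kv(2)] a2c by (simp add: a_comm m_comm)
            then show "b \<in> adjoin G a1 <+>\<^bsub>R\<^esub> (\<otimes>) a2 ` G" unfolding set_add_iff using kv by blast
          qed
          have ind: "independent G [a, a2, a1, \<one>]"
          proof (intro li_Cons li_Nil)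
            show "\<one> \<notin> Span G []" by simp
            show "a1 \<notin> Span G [\<one>]" using S1 a1 by simp
            show "a2 \<notin> Span G [a1, \<one>]" using Sx a2 by blast
            show "a \<notin> Span G [a2, a1, \<one>]" using Sxx a_out by blast
          qed (use ac a2c a1c in auto)
          have "length [a, a2, a1, \<one>] \<le> card {a1, a2} + 1"
          proof (rule minimal_independent[OF S(1) ind _ S(3) one_not_zero _ Xc])
            show "set [a, a2, a1, \<one>] \<subseteq> S" using a a1 a2 S(3) by simp
            fix b assume "b \<in> set [a, a2, a1, \<one>]"
            then have "b \<in> ?N" using aNN aN ND(3) by auto
            then show "b \<otimes> inv \<one> \<in> ?N" using ND(1) by (auto simp: subset_iff)
          qed simp
          then show ?thesis by (simp add: card_insert_if split: if_splits)
        qed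
      qed
      then show ?thesis using p by blast
    qed
  qed
qed

text \<open>
  Dividing \<open>S\<close> by one of its elements makes \<open>1 \<in> S\<close>.
\<close>

lemma minimal_spaces_similar:
  assumes eq: "same_span_dims P S T" and P: "subfield P R" "G \<subseteq> P" "finite_dimension G P"
    and S: "minimal_space S" "S \<subseteq> P" and T: "finite_dimension G T" "T \<subseteq> P"
  shows "\<exists>x\<in>carrier R - {\<zero>}. T = (\<otimes>) x ` S"
proof -
  have f: "finite_dimension G S" using S(1) by (simp add: minimal_space_def)
  note PD = subfieldD[OF P(1)]
  have Sc: "S \<subseteq> carrier R" and Tc: "T \<subseteq> carrier R" using S(2) T(2) PD(1) by auto
  obtain s where s: "s \<in> S" "s \<noteq> \<zero>"
    using exists_nonzero[OF f dim_pos[OF f minimal_space_nonzero[OF S(1)]]] by blast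
  have sc: "s \<in> carrier R" using s Sc by blast
  note s' = nonzero_inverse[OF sc s(2)]
  define S1 where "S1 = (\<otimes>) (inv s) ` S"
  have "(\<otimes>) \<one> ` T = T" using Tc by (auto simp: image_iff subset_iff)
  then have eq1: "same_span_dims P S1 T"
    unfolding S1_def using same_span_dims_smult[OF eq f T(1) s'(1,2) one_closed one_not_zero] by simp
  have "inv s \<in> P" using PD(8) s S(2) by blast
  then have S1: "S1 \<subseteq> P" "\<one> \<in> S1" "minimal_space S1"
    unfolding S1_def using PD(7) S(2) s(1) s'(3) minimal_space_smult[OF S(1) s'(1,2)]
    by (auto simp: image_iff dest: sym intro!: bexI[of _ s])
  obtain p where p: "p \<in> T" "p \<noteq> \<zero>" "\<And>a. a \<in> S1 \<Longrightarrow> p \<otimes> a \<in> T"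
    using minimal_contains_multiple[OF eq1 P S1(3,1,2) T] by blast
  have pc: "p \<in> carrier R" using p Tc by blast
  have f1: "finite_dimension G S1" unfolding S1_def by (rule finite_dimension_smult[OF G s'(1,2) f])
  have "(\<otimes>) p ` S1 \<subseteq> T" using p(3) by blast
  then have "(\<otimes>) p ` S1 = T"
    using dim_subspace(3)[OF G T(1) subalgebra_smult[OF G finite_dimension_imp_subalgebra[OF G f1] pc]]
      dim_smult[OF G pc p(2) f1] same_span_dims_dim[OF eq1 P(2) f1 T(1)] by simp
  moreover have "(\<otimes>) p ` S1 = (\<otimes>) (p \<otimes> inv s) ` S"
    unfolding S1_def image_image
    by (rule image_cong) (use pc s'(1) Sc in \<open>auto simp: m_assoc subset_iff\<close>)
  moreover have "p \<otimes> inv s \<in> carrier R - {\<zero>}" using pc p(2) s' integral by auto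
  ultimately show ?thesis by blast
qed

section \<open>Spaces that split off a subfield\<close>

lemma subspan_eq_field:
  assumes "subfield M R" "\<one> \<in> A" "A \<subseteq> M"
  shows "subspan M A = M"
proof
  note MD = subfieldD[OF assms(1)]
  have MM: "subalgebra M M R" using subfield_subalgebra[OF assms(1) assms(1) order_refl] .
  show "subspan M A \<subseteq> M" by (rule subspan_min[OF MM assms(3)])
  have "A \<subseteq> carrier R" using assms(3) MD(1) by blast
  note sub = subspan_subalgebra[OF assms(1) this]
  have one: "\<one> \<in> subspan M A" using subspan_incl assms(2) by blast
  show "M \<subseteq> subspan M A"
  proof
    fix m assume m: "m \<in> M"
    then have "m \<in> carrier R" using MD(1) by blast
    then show "m \<in> subspan M A" using subalgebraD(6)[OF sub m one] by simp
  qed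
qed

lemma subspan_field_plus:
  assumes P: "subfield P R" "G \<subseteq> P" "finite_dimension G P" and b: "b \<in> carrier R" "b \<notin> P"
    and U: "subalgebra G U R" "U \<subseteq> P" and M: "subfield M R" "G \<subseteq> M" "M \<subseteq> P"
  shows "dim G (subspan M (P <+>\<^bsub>R\<^esub> (\<otimes>) b ` U)) = dim G P + dim G (subspan M U)"
proof -
  note PD = subfieldD[OF P(1)] and UD = subalgebraD[OF U(1)]
  have MP: "subalgebra M P R" by (rule subfield_subalgebra[OF M(1) P(1) M(3)])
  have GP: "subalgebra G P R" by (rule subfield_subalgebra[OF G P(1,2)])
  have MU: "subalgebra M (subspan M U) R" by (rule subspan_subalgebra[OF M(1) UD(1)])
  have UP: "subspan M U \<subseteq> P" by (rule subspan_min[OF MP U(2)])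
  have GU: "subalgebra G (subspan M U) R" by (rule subalgebra_antimono[OF G MU M(2)])
  have bU: "subalgebra G ((\<otimes>) b ` U) R" by (rule subalgebra_smult[OF G U(1) b(1)])
  have c: "P <+>\<^bsub>R\<^esub> (\<otimes>) b ` U \<subseteq> carrier R"
    by (rule subalgebraD(1)[OF subalgebra_set_add[OF G GP bU]])
  note sub = subspan_subalgebra[OF M(1) c]
  have "subspan M (P <+>\<^bsub>R\<^esub> (\<otimes>) b ` U) = P <+>\<^bsub>R\<^esub> (\<otimes>) b ` subspan M U"
  proof
    have "P <+>\<^bsub>R\<^esub> (\<otimes>) b ` U \<subseteq> P <+>\<^bsub>R\<^esub> (\<otimes>) b ` subspan M U"
      using subspan_incl[of U M] unfolding subset_iff set_add_iff by blast
    then show "subspan M (P <+>\<^bsub>R\<^esub> (\<otimes>) b ` U) \<subseteq> P <+>\<^bsub>R\<^esub> (\<otimes>) b ` subspan M U"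
      by (intro subspan_min subalgebra_set_add[OF M(1)] subalgebra_smult[OF M(1)] MP MU b(1))
    have PU: "P \<subseteq> subspan M (P <+>\<^bsub>R\<^esub> (\<otimes>) b ` U)" "(\<otimes>) b ` U \<subseteq> subspan M (P <+>\<^bsub>R\<^esub> (\<otimes>) b ` U)"
      using set_add_incl[OF GP bU] subspan_incl by blast+
    define W where "W = {w \<in> carrier R. b \<otimes> w \<in> subspan M (P <+>\<^bsub>R\<^esub> (\<otimes>) b ` U)}"
    have "subalgebra M W R"
    proof (rule subalgebraI[OF M(1)])
      show "\<zero> \<in> W" unfolding W_def using subalgebraD(2)[OF sub] b(1) by simp
      fix v assume v: "v \<in> W"
      show "v \<oplus> w \<in> W" if "w \<in> W" for w
        using v that subalgebraD(3)[OF sub, of "b \<otimes> v" "b \<otimes> w"] b(1) unfolding W_def by (simp add: r_distr)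
      show "k \<otimes> v \<in> W" if "k \<in> M" for k
      proof -
        have "k \<in> carrier R" using that subfieldD(1)[OF M(1)] by blast
        then show ?thesis
          using v subalgebraD(6)[OF sub that, of "b \<otimes> v"] b(1) unfolding W_def by (simp add: m_lcomm)
      qed
    qed (auto simp: W_def)
    moreover have "U \<subseteq> W" unfolding W_def using UD(1) PU(2) by blast
    ultimately have "subspan M U \<subseteq> W" by (rule subspan_min)
    then show "P <+>\<^bsub>R\<^esub> (\<otimes>) b ` subspan M U \<subseteq> subspan M (P <+>\<^bsub>R\<^esub> (\<otimes>) b ` U)"
      using PU(1) subalgebraD(3)[OF sub] unfolding subset_iff set_add_iff W_def by blast
  qed
  moreover have "P \<inter> (\<otimes>) b ` subspan M U = {\<zero>}"
  proof
    show "P \<inter> (\<otimes>) b ` subspan M U \<subseteq> {\<zero>}"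
    proof
      fix y assume "y \<in> P \<inter> (\<otimes>) b ` subspan M U"
      then obtain v where v: "y \<in> P" "v \<in> P" "y = b \<otimes> v" using UP by blast
      have vc: "v \<in> carrier R" using v(2) PD(1) by blast
      have "v = \<zero>"
      proof (rule ccontr)
        assume v0: "v \<noteq> \<zero>"
        note v' = nonzero_inverse[OF vc v0]
        have "b = y \<otimes> inv v" unfolding v(3) using b(1) vc v' by (simp add: m_assoc)
        then show False using PD(7)[OF v(1) PD(8)[OF v(2) v0]] b(2) by simp
      qed
      then show "y \<in> {\<zero>}" using v(3) b(1) by simp
    qed
    show "{\<zero>} \<subseteq> P \<inter> (\<otimes>) b ` subspan M U"
      using PD(2) subalgebraD(2)[OF subalgebra_smult[OF G GU b(1)]] by blast
  qed
  moreover have b0: "b \<noteq> \<zero>" using b(2) PD(2) by blast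
  have fU: "finite_dimension G (subspan M U)" by (rule dim_subspace(1)[OF G P(3) GU UP])
  ultimately show ?thesis
    using dim_direct_sum(2)[OF G P(3) finite_dimension_smult[OF G b(1) b0 fU]] dim_smult[OF G b(1) b0 fU]
    by simp
qed

text \<open>
  The field \<open>P + bP\<close> contains \<open>P + bS\<close>, whose span over it is therefore one-dimensional. So the span
  of \<open>B\<close> is one-dimensional as well, and as \<open>1 \<in> B\<close> it is \<open>P + bP\<close>. The space \<open>T\<close> collects the second
  components of the elements of \<open>B\<close>. For \<open>M\<close> inside \<open>P\<close> the summand \<open>P\<close> contributes equally to both spans.
\<close>

lemma second_summand:
  assumes P: "subfield P R" "G \<subseteq> P" "finite_dimension G P"
    and b: "b \<in> carrier R" "b \<noteq> \<zero>" "P \<inter> (\<otimes>) b ` S = {\<zero>}"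
    and S: "subalgebra G S R" "S \<subseteq> P" "S \<noteq> {\<zero>}"
    and L: "subfield L R" "P <+>\<^bsub>R\<^esub> (\<otimes>) b ` S \<subseteq> L"
    and B: "finite_dimension G B" "P \<subseteq> B"
    and eq: "same_span_dims L (P <+>\<^bsub>R\<^esub> (\<otimes>) b ` S) B"
  shows "\<exists>T. finite_dimension G T \<and> T \<subseteq> P \<and> same_span_dims P S T \<and> B = P <+>\<^bsub>R\<^esub> (\<otimes>) b ` T"
proof -
  let ?A = "P <+>\<^bsub>R\<^esub> (\<otimes>) b ` S"
  note PD = subfieldD[OF P(1)] and SD = subalgebraD[OF S(1)] and LD = subfieldD[OF L(1)]
  have sB: "subalgebra G B R" by (rule finite_dimension_imp_subalgebra[OF G B(1)])
  note BD = subalgebraD[OF sB]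
  have GP: "subalgebra G P R" by (rule subfield_subalgebra[OF G P(1,2)])
  have bS: "subalgebra G ((\<otimes>) b ` S) R" by (rule subalgebra_smult[OF G S(1) b(1)])
  note inc = set_add_incl[OF GP bS]
  obtain s where s: "s \<in> S" "s \<noteq> \<zero>" using S(3) SD(2) by blast
  have sc: "s \<in> carrier R" "s \<in> P" using s SD(1) S(2) by auto
  note s' = nonzero_inverse[OF sc(1) s(2)]
  have bs: "b = (b \<otimes> s) \<otimes> inv s" using b(1) sc s' by (simp add: m_assoc)
  have bP: "b \<notin> P"
  proof
    assume "b \<in> P"
    then have "b \<otimes> s \<in> P \<inter> (\<otimes>) b ` S" using PD(7) sc(2) s(1) by blast
    then have "b \<otimes> s = \<zero>" using b(3) by blast
    then show False using integral b(1,2) sc(1) s(2) by blast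
  qed
  have PL: "P \<subseteq> L" "b \<otimes> s \<in> L" using inc s(1) L(2) by blast+
  have "inv s \<in> L" using LD(8) PL(1) sc(2) s(2) by blast
  \<comment> \<open>dimensions are known over subfields of \<open>L\<close> only, so \<open>P + bP\<close> must lie in \<open>L\<close>\<close>
  then have bL: "b \<in> L" using LD(7)[OF PL(2)] bs by metis
  note Pb = subfield_adjoin[OF P(1,2) b(1)]
  note PbD = subfieldD[OF Pb] and iPb = adjoin_incl[OF P(1) b(1)]
  have PbL: "adjoin P b \<subseteq> L" by (rule adjoin_min[OF L(1) PL(1) bL])
  have GPb: "G \<subseteq> adjoin P b" using P(2) iPb(1) by blast
  note fPb = adjoin_finite_dimension(1)[OF P(1,2) b(1) P(3)]
  have AP: "?A \<subseteq> adjoin P b" unfolding adjoin_def subset_iff set_add_iff using S(2) by blast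
  have "dim G (subspan (adjoin P b) B) = dim G (adjoin P b)"
    using same_span_dimsD[OF eq Pb GPb PbL fPb] subspan_eq_field[OF Pb _ AP] inc(1) PD(3) by auto
  moreover have Bs: "subalgebra (adjoin P b) (subspan (adjoin P b) B) R"
    by (rule subspan_subalgebra[OF Pb BD(1)])
  moreover have "adjoin P b \<subseteq> subspan (adjoin P b) B"
  proof
    fix m assume m: "m \<in> adjoin P b"
    then have "m \<in> carrier R" using PbD(1) by blast
    moreover have "\<one> \<in> subspan (adjoin P b) B" using subspan_incl B(2) PD(3) by blast
    ultimately show "m \<in> subspan (adjoin P b) B" using subalgebraD(6)[OF Bs m] by force
  qed
  ultimately have "adjoin P b = subspan (adjoin P b) B"
    using dim_subspace(3)[OF G finite_dimension_subspan[OF Pb GPb fPb B(1)] subfield_subalgebra[OF G Pb GPb]] by simp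
  then have BPb: "B \<subseteq> adjoin P b" using subspan_incl by blast
  define T where "T = {t \<in> P. b \<otimes> t \<in> B}"
  have sT: "subalgebra G T R"
  proof (rule subalgebraI[OF G])
    show "T \<subseteq> carrier R" unfolding T_def using PD(1) by blast
    show "\<zero> \<in> T" unfolding T_def using PD(2) BD(2) b(1) by simp
    fix v assume v: "v \<in> T"
    then have vc: "v \<in> carrier R" unfolding T_def using PD(1) by blast
    show "v \<oplus> w \<in> T" if w: "w \<in> T" for w
    proof -
      have "w \<in> carrier R" using w unfolding T_def using PD(1) by blast
      then show ?thesis
        using v w BD(3)[of "b \<otimes> v" "b \<otimes> w"] PD(4)[of v w] b(1) vc unfolding T_def by (simp add: r_distr)
    qed
    show "k \<otimes> v \<in> T" if k: "k \<in> G" for k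
    proof -
      have kP: "k \<in> P" "k \<in> carrier R" using k P(2) GD(1) by auto
      then show ?thesis
        using v BD(6)[OF k, of "b \<otimes> v"] PD(7)[OF kP(1), of v] b(1) vc unfolding T_def by (simp add: m_lcomm)
    qed
  qed
  have TP: "T \<subseteq> P" unfolding T_def by blast
  have fT: "finite_dimension G T" by (rule dim_subspace(1)[OF G P(3) sT TP])
  have B_eq: "B = P <+>\<^bsub>R\<^esub> (\<otimes>) b ` T"
  proof (intro equalityI subsetI)
    fix y assume y: "y \<in> B"
    then obtain p q where pq: "p \<in> P" "q \<in> P" "y = p \<oplus> b \<otimes> q" using subsetD[OF BPb y] unfolding adjoin_iff by blast
    have c: "p \<in> carrier R" "q \<in> carrier R" using pq PD(1) by auto
    have "b \<otimes> q = y \<ominus> p" unfolding pq(3) using c b(1) by algebra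
    then have "q \<in> T" unfolding T_def using pq(1,2) BD(5)[OF y, of p] B(2) by auto
    then show "y \<in> P <+>\<^bsub>R\<^esub> (\<otimes>) b ` T" unfolding set_add_iff using pq by blast
  next
    fix y assume "y \<in> P <+>\<^bsub>R\<^esub> (\<otimes>) b ` T"
    then obtain p t where "p \<in> P" "b \<otimes> t \<in> B" "y = p \<oplus> b \<otimes> t"
      unfolding set_add_iff T_def by blast
    then show "y \<in> B" using BD(3) B(2) by blast
  qed
  have "same_span_dims P S T"
    unfolding same_span_dims_def
  proof (intro allI impI)
    fix M assume M: "subfield M R" "G \<subseteq> M" "M \<subseteq> P" "finite_dimension G M"
    have MinL: "M \<subseteq> L" using M(3) PL(1) by blast
    show "dim G (subspan M S) = dim G (subspan M T)"
      using same_span_dimsD[OF eq M(1,2) MinL M(4)] subspan_field_plus[OF P b(1) bP S(1,2) M(1-3)]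
        subspan_field_plus[OF P b(1) bP sT TP M(1-3)] B_eq by simp
  qed
  then show ?thesis using fT TP B_eq by blast
qed

text \<open>
  A factor \<open>x\<close> with \<open>T = xS\<close> is a ratio of elements of \<open>P\<close>, so multiplication by \<open>x\<close> maps \<open>P\<close> onto itself
  and \<open>P + bS\<close> onto \<open>P + bT\<close>.
\<close>

lemma similar_normalized:
  assumes P: "subfield P R" "G \<subseteq> P" "finite_dimension G P"
    and b: "b \<in> carrier R" "b \<noteq> \<zero>" "P \<inter> (\<otimes>) b ` S = {\<zero>}"
    and S: "subalgebra G S R" "S \<subseteq> P"
    and L: "subfield L R" "P <+>\<^bsub>R\<^esub> (\<otimes>) b ` S \<subseteq> L"
    and B: "finite_dimension G B" "P \<subseteq> B"
    and eq: "same_span_dims L (P <+>\<^bsub>R\<^esub> (\<otimes>) b ` S) B"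
    and cases: "(\<exists>Q e. subfield Q R \<and> G \<subseteq> Q \<and> Q \<subseteq> P \<and> e \<in> carrier R - {\<zero>} \<and> S \<subseteq> (\<otimes>) e ` Q
      \<and> dim G Q \<le> Suc (dim G S)) \<or> minimal_space S"
  shows "\<exists>x\<in>carrier R - {\<zero>}. B = (\<otimes>) x ` (P <+>\<^bsub>R\<^esub> (\<otimes>) b ` S)"
proof (cases "S = {\<zero>}")
  case True
  note PD = subfieldD[OF P(1)]
  have GP: "subalgebra G P R" by (rule subfield_subalgebra[OF G P(1,2)])
  have A: "P <+>\<^bsub>R\<^esub> (\<otimes>) b ` S = P"
    unfolding True using PD(1) b(1) by (auto simp: set_add_def' subset_iff)
  have GL: "G \<subseteq> L" using P(2) L(2) A by simp
  have "dim G P = dim G B"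
    using same_span_dims_dim[OF eq[unfolded A] GL P(3) B(1)] .
  then have "P = B" using dim_subspace(3)[OF G B(1) GP B(2)] by simp
  moreover have "(\<otimes>) \<one> ` P = P" using PD(1) by (auto simp: image_iff subset_iff)
  ultimately show ?thesis unfolding A using one_not_zero by (intro bexI[of _ \<one>]) auto
next
  case False
  note PD = subfieldD[OF P(1)] and SD = subalgebraD[OF S(1)]
  obtain T where T: "finite_dimension G T" "T \<subseteq> P" "same_span_dims P S T"
      "B = P <+>\<^bsub>R\<^esub> (\<otimes>) b ` T"
    using second_summand[OF P b S False L B eq] by blast
  have fS: "finite_dimension G S" by (rule dim_subspace(1)[OF G P(3) S])
  obtain x where x: "x \<in> carrier R" "x \<noteq> \<zero>" "T = (\<otimes>) x ` S"
    using cases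
  proof (elim disjE exE conjE)
    fix Q e assume Q: "subfield Q R" "G \<subseteq> Q" "Q \<subseteq> P" "e \<in> carrier R - {\<zero>}" "S \<subseteq> (\<otimes>) e ` Q"
      "dim G Q \<le> Suc (dim G S)"
    have fQ: "finite_dimension G Q"
      by (rule dim_subspace(1)[OF G P(3) subfield_subalgebra[OF G Q(1,2)] Q(3)])
    show ?thesis
      using similar_if_almost_field[OF T(3) P(1,2) fS T(1) False Q(1-3) fQ _ _ Q(5,6)] Q(4) that by blast
  next
    assume "minimal_space S"
    then show ?thesis using minimal_spaces_similar[OF T(3) P _ S(2) T(1,2)] that by blast
  qed
  obtain s where s: "s \<in> S" "s \<noteq> \<zero>" using False SD(2) by blast
  have sc: "s \<in> carrier R" "s \<in> P" using s SD(1) S(2) by auto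
  note s' = nonzero_inverse[OF sc(1) s(2)] and x' = nonzero_inverse[OF x(1,2)]
  have "x \<otimes> s \<in> P" using T(2) x(3) s(1) by blast
  moreover have "x = (x \<otimes> s) \<otimes> inv s" using x(1) sc s' by (simp add: m_assoc)
  ultimately have xP: "x \<in> P" using PD(7)[OF _ PD(8)[OF sc(2) s(2)]] by metis
  have ixP: "inv x \<in> P" by (rule PD(8)[OF xP x(2)])
  have "B = (\<otimes>) x ` (P <+>\<^bsub>R\<^esub> (\<otimes>) b ` S)"
  proof (intro equalityI subsetI)
    fix y assume "y \<in> B"
    then obtain p u where pu: "p \<in> P" "u \<in> S" "y = p \<oplus> b \<otimes> (x \<otimes> u)"
      unfolding T(4) x(3) set_add_iff by blast
    have c: "p \<in> carrier R" "u \<in> carrier R" using pu PD(1) SD(1) by auto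
    have "x \<otimes> (inv x \<otimes> p \<oplus> b \<otimes> u) = (x \<otimes> inv x) \<otimes> p \<oplus> b \<otimes> (x \<otimes> u)"
      using c b(1) x(1) x'(1) by algebra
    then have "y = x \<otimes> (inv x \<otimes> p \<oplus> b \<otimes> u)" unfolding pu(3) using x'(4) c by simp
    moreover have "inv x \<otimes> p \<oplus> b \<otimes> u \<in> P <+>\<^bsub>R\<^esub> (\<otimes>) b ` S"
      unfolding set_add_iff using PD(7)[OF ixP pu(1)] pu(2) by blast
    ultimately show "y \<in> (\<otimes>) x ` (P <+>\<^bsub>R\<^esub> (\<otimes>) b ` S)" by blast
  next
    fix y assume "y \<in> (\<otimes>) x ` (P <+>\<^bsub>R\<^esub> (\<otimes>) b ` S)"
    then obtain a where a: "a \<in> P <+>\<^bsub>R\<^esub> (\<otimes>) b ` S" "y = x \<otimes> a" by (rule imageE) simp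
    from a(1) obtain p u where "p \<in> P" "u \<in> S" "a = p \<oplus> b \<otimes> u"
      unfolding set_add_iff by blast
    with a(2) have pu: "p \<in> P" "u \<in> S" "y = x \<otimes> (p \<oplus> b \<otimes> u)" by simp_all
    have c: "p \<in> carrier R" "u \<in> carrier R" using pu PD(1) SD(1) by auto
    have "y = x \<otimes> p \<oplus> b \<otimes> (x \<otimes> u)" unfolding pu(3) using c b(1) x(1) by algebra
    then show "y \<in> B" unfolding T(4) x(3) set_add_iff using PD(7)[OF xP pu(1)] pu(2) by blast
  qed
  then show ?thesis using x by blast
qed

text \<open>
  The case \<open>e = c = 1\<close> applies to \<open>A/e\<close> and \<open>B/c\<close>, since the dimensions of spans do not change under scaling.
  The field \<open>L\<close> is the image of \<open>F\<close> in the application. Dividing by \<open>e\<close> keeps \<open>A\<close> inside it because \<open>e \<in> A\<close>.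
\<close>

theorem similar_spaces:
  assumes P: "subfield P R" "G \<subseteq> P" "finite_dimension G P"
    and b: "b \<in> carrier R" "b \<noteq> \<zero>" "P \<inter> (\<otimes>) b ` S = {\<zero>}"
    and S: "subalgebra G S R" "S \<subseteq> P"
    and e: "e \<in> carrier R" "e \<noteq> \<zero>" "A = (\<otimes>) e ` (P <+>\<^bsub>R\<^esub> (\<otimes>) b ` S)"
    and L: "subfield L R" "A \<subseteq> L"
    and B: "finite_dimension G B" "c \<in> carrier R" "c \<noteq> \<zero>" "(\<otimes>) c ` P \<subseteq> B"
    and eq: "same_span_dims L A B"
    and cases: "(\<exists>Q e. subfield Q R \<and> G \<subseteq> Q \<and> Q \<subseteq> P \<and> e \<in> carrier R - {\<zero>} \<and> S \<subseteq> (\<otimes>) e ` Q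
      \<and> dim G Q \<le> Suc (dim G S)) \<or> minimal_space S"
  shows "\<exists>x\<in>carrier R - {\<zero>}. B = (\<otimes>) x ` A"
proof -
  let ?A = "P <+>\<^bsub>R\<^esub> (\<otimes>) b ` S"
  note PD = subfieldD[OF P(1)] and LD = subfieldD[OF L(1)]
  note e' = nonzero_inverse[OF e(1,2)] and c' = nonzero_inverse[OF B(2,3)]
  have sB: "subalgebra G B R" by (rule finite_dimension_imp_subalgebra[OF G B(1)])
  have Bc: "B \<subseteq> carrier R" using subalgebraD(1)[OF sB] .
  have GP: "subalgebra G P R" by (rule subfield_subalgebra[OF G P(1,2)])
  have bS: "subalgebra G ((\<otimes>) b ` S) R" by (rule subalgebra_smult[OF G S(1) b(1)])
  have sA: "subalgebra G ?A R" by (rule subalgebra_set_add[OF G GP bS])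
  have Ac: "?A \<subseteq> carrier R" by (rule subalgebraD(1)[OF sA])
  have fS: "finite_dimension G S" by (rule dim_subspace(1)[OF G P(3) S])
  have fA1: "finite_dimension G ?A" by (rule dim_sum(1)[OF G P(3) finite_dimension_smult[OF G b(1,2) fS]])
  have fA: "finite_dimension G A" unfolding e(3) by (rule finite_dimension_smult[OF G e(1,2) fA1])
  have A1: "?A = (\<otimes>) (inv e) ` A" unfolding e(3) using smult_inv_image(1)[OF e(1,2) Ac] by simp
  define B1 where "B1 = (\<otimes>) (inv c) ` B"
  have fB1: "finite_dimension G B1" unfolding B1_def by (rule finite_dimension_smult[OF G c'(1,2) B(1)])
  have "P = (\<otimes>) (inv c) ` (\<otimes>) c ` P" using smult_inv_image(1)[OF B(2,3) PD(1)] by simp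
  also have "\<dots> \<subseteq> B1" unfolding B1_def by (rule image_mono[OF B(4)])
  finally have PB: "P \<subseteq> B1" .
  have eq1: "same_span_dims L ?A B1"
    unfolding A1 B1_def by (rule same_span_dims_smult[OF eq fA B(1) e'(1,2) c'(1,2)])
  have "\<one> \<in> ?A" using set_add_incl(1)[OF GP bS] PD(3) by blast
  then have "e \<in> A" unfolding e(3) using e(1) by (force simp: image_iff)
  then have "inv e \<in> L" using L(2) LD(8) e(2) by blast
  then have AL: "?A \<subseteq> L" unfolding A1 using L(2) LD(7) by blast
  obtain x where x: "x \<in> carrier R" "x \<noteq> \<zero>" "B1 = (\<otimes>) x ` ?A"
    using similar_normalized[OF P b S L(1) AL fB1 PB eq1 cases] by blast
  have "B = (\<otimes>) c ` B1" unfolding B1_def using smult_inv_image(2)[OF B(2,3) Bc] by simp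
  also have "\<dots> = (\<otimes>) (c \<otimes> x \<otimes> inv e) ` A"
    unfolding x(3) A1 image_image
    by (rule image_cong) (use x(1) B(2) e'(1) L(2) LD(1) in \<open>auto simp: m_assoc subset_iff\<close>)
  finally have "B = (\<otimes>) (c \<otimes> x \<otimes> inv e) ` A" .
  moreover have "c \<otimes> x \<otimes> inv e \<in> carrier R - {\<zero>}" using x B(2,3) e' integral by auto
  ultimately show ?thesis by blast
qed

end

section \<open>Value sets of forms\<close>

definition value_set :: "('a, 'v) qform \<Rightarrow> 'a set" where
  "value_set P = qf P ` carrier (qspace P)"

text \<open>
  In characteristic 2 squaring is additive.
\<close>

lemma squares_subfield:
  fixes F (structure)
  assumes "field F" "\<one> \<oplus> \<one> = \<zero>"
  shows "subfield (squares F) F"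
proof -
  interpret field F by fact
  have sq: "x [^] (2::nat) = x \<otimes> x" if "x \<in> carrier F" for x
    using that by (simp add: numeral_2_eq_2)
  have sub: "squares F \<subseteq> carrier F" by (auto simp: squares_def)
  have mem: "x \<otimes> x \<in> squares F" if "x \<in> carrier F" for x
    unfolding squares_def by (rule image_eqI[where x = x]) (simp_all add: sq that)
  have elim: "\<exists>x\<in>carrier F. y = x \<otimes> x" if "y \<in> squares F" for y
    using that sq by (auto simp: squares_def)
  show ?thesis
  proof (rule subfieldI')
    show "subring (squares F) F"
    proof (rule subringI[OF sub])
      show "\<one> \<in> squares F" using mem[OF one_closed] by simp
      fix a assume "a \<in> squares F"
      then obtain x where x: "x \<in> carrier F" "a = x \<otimes> x" using elim by blast
      have dbl: "z \<oplus> z = \<zero>" if "z \<in> carrier F" for z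
        using l_distr[OF one_closed one_closed that] assms(2) that by simp
      show "\<ominus> a \<in> squares F"
        using dbl[of a] x mem[OF x(1)] by (simp add: minus_equality)
      fix b assume "b \<in> squares F"
      then obtain y where y: "y \<in> carrier F" "b = y \<otimes> y" using elim by blast
      have "(x \<oplus> y) \<otimes> (x \<oplus> y) = (a \<oplus> b) \<oplus> (x \<otimes> y \<oplus> x \<otimes> y)"
        unfolding x(2) y(2) using x(1) y(1) by algebra
      then have "a \<oplus> b = (x \<oplus> y) \<otimes> (x \<oplus> y)"
        using dbl[of "x \<otimes> y"] x y by simp
      then show "a \<oplus> b \<in> squares F" using mem[of "x \<oplus> y"] x y by simp
      have "a \<otimes> b = (x \<otimes> y) \<otimes> (x \<otimes> y)" unfolding x(2) y(2) using x(1) y(1) by algebra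
      then show "a \<otimes> b \<in> squares F" using mem[of "x \<otimes> y"] x y by simp
    qed
    fix k assume k: "k \<in> squares F - {\<zero>}"
    then obtain x where x: "x \<in> carrier F" "k = x \<otimes> x" using elim by blast
    have x0: "x \<noteq> \<zero>" using k x by auto
    note x' = nonzero_inverse[OF x(1) x0]
    have "k \<otimes> (inv x \<otimes> inv x) = (x \<otimes> inv x) \<otimes> (x \<otimes> inv x)"
      unfolding x(2) using x(1) x'(1) by algebra
    then have "inv k = inv x \<otimes> inv x"
      using x x'(1,4) by (intro comm_inv_char) auto
    then show "inv k \<in> squares F" using mem[OF x'(1)] by simp
  qed
qed

lemma squares_square_closed:
  fixes F (structure)
  assumes "field F" "\<one> \<oplus> \<one> = \<zero>"
  shows "square_closed_subfield F (squares F)"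
proof (rule square_closed_subfield.intro[OF assms(1) square_closed_subfield_axioms.intro])
  interpret field F by fact
  show "subfield (squares F) F" by (rule squares_subfield[OF assms])
  fix x assume x: "x \<in> carrier F"
  then have "x \<otimes> x = x [^] (2::nat)" by (simp add: numeral_2_eq_2)
  then show "x \<otimes> x \<in> squares F" using x unfolding squares_def by blast
qed

lemma (in ring) combine_finsum:
  assumes "distinct us" "\<And>u. u \<in> set us \<Longrightarrow> c u \<in> carrier R" "\<And>u. u \<in> set us \<Longrightarrow> d u \<in> carrier R"
  shows "combine (map c us) (map d us) = (\<Oplus>u\<in>set us. c u \<otimes> d u)"
  using assms
proof (induction us)
  case (Cons u us)
  then show ?case by (simp add: finsum_insert Pi_iff)
qed simp

context totally_singular_form
begin

lemma square_pow: "x \<in> carrier F \<Longrightarrow> x [^] (2::nat) = x \<otimes> x"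
  by (simp add: numeral_2_eq_2)

lemma subfield_squares: "subfield (squares F) F"
  using squares_subfield[OF _ char2] field_axioms by blast

lemma qf_lincomb:
  assumes "finite A" "A \<subseteq> carrier (qspace Q)" "a \<in> A \<rightarrow> carrier F"
  shows "qf Q (lincomb a A) = (\<Oplus>\<^bsub>F\<^esub>u\<in>A. a u [^] (2::nat) \<otimes> qf Q u)"
  using assms
proof (induction A rule: finite_induct)
  case empty
  have "qf Q (\<zero> \<odot>\<^bsub>qspace Q\<^esub> \<zero>\<^bsub>qspace Q\<^esub>) = \<zero>"
    by (subst qf_smult) (auto simp: qf_closed numeral_2_eq_2)
  then show ?case by (simp add: lincomb_def)
next
  case (insert u A)
  have "u \<in> carrier (qspace Q)" "A \<subseteq> carrier (qspace Q)" using insert by auto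
  with insert show ?case
    apply (simp add: lincomb_def)
    apply (subst M.finsum_insert)
        apply (auto simp: qf_add qf_smult Pi_iff subset_iff qf_closed finsum_insert)
    done
qed

lemma qf_zero: "qf Q \<zero>\<^bsub>qspace Q\<^esub> = \<zero>"
  using qf_lincomb[of "{}" "\<lambda>_. \<zero>"] by (simp add: lincomb_def)

lemma value_set_carrier: "value_set Q \<subseteq> carrier F"
  using qf_closed by (auto simp: value_set_def)

lemma qf_lincomb_combine:
  assumes "distinct us" "set us \<subseteq> carrier (qspace Q)" "a \<in> set us \<rightarrow> carrier F"
  shows "qf Q (lincomb a (set us)) = combine (map (\<lambda>u. a u [^] (2::nat)) us) (map (qf Q) us)"
  using assms qf_closed by (subst qf_lincomb) (auto intro!: combine_finsum[symmetric])

lemma square_coeffs: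
  assumes "distinct us" "length Ks = length us" "set Ks \<subseteq> squares F"
  obtains a where "a \<in> set us \<rightarrow> carrier F" "map (\<lambda>u. a u [^] (2::nat)) us = Ks"
proof -
  have "\<exists>f. \<forall>k\<in>squares F. f k \<in> carrier F \<and> k = f k [^] (2::nat)"
    unfolding squares_def by (intro bchoice) auto
  then obtain f where f: "\<And>k. k \<in> squares F \<Longrightarrow> f k \<in> carrier F \<and> f k [^] (2::nat) = k" by metis
  define a where "a u = f (the (map_of (zip us Ks) u))" for u
  have a: "a (us ! i) = f (Ks ! i)" if "i < length us" for i
    unfolding a_def using map_of_zip_nth[OF assms(2)[symmetric] assms(1) that[folded assms(2)]] by simp
  have K: "Ks ! i \<in> squares F" if "i < length us" for i using that assms(2,3) by auto
  show ?thesis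
  proof (rule that)
    show "a \<in> set us \<rightarrow> carrier F" using a f K by (auto simp: in_set_conv_nth)
    show "map (\<lambda>u. a u [^] (2::nat)) us = Ks"
      by (rule nth_equalityI) (use a f K assms(2) in auto)
  qed
qed

lemma value_set_Span:
  assumes "distinct bs" "basis (set bs)"
  shows "value_set Q = Span (squares F) (map (qf Q) bs)"
proof -
  have bs: "set bs \<subseteq> carrier (qspace Q)" using assms by (simp add: basis_def)
  have q: "set (map (qf Q) bs) \<subseteq> carrier F" using bs qf_closed by auto
  show ?thesis
  proof (intro equalityI subsetI)
    fix y assume "y \<in> value_set Q"
    then obtain v where v: "v \<in> carrier (qspace Q)" "y = qf Q v" by (auto simp: value_set_def)
    define c where "c = coords F (qspace Q) (set bs) v"
    have c: "c \<in> set bs \<rightarrow> carrier F" "lincomb c (set bs) = v"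
      unfolding c_def using coords[OF _ assms(2) v(1)] by auto
    have "y = combine (map (\<lambda>u. c u [^] (2::nat)) bs) (map (qf Q) bs)"
      unfolding v(2) using qf_lincomb_combine[OF assms(1) bs c(1)] c(2) by simp
    then show "y \<in> Span (squares F) (map (qf Q) bs)"
      unfolding Span_mem_iff_length_version[OF subfield_squares q]
      using c(1) by (intro exI[of _ "map (\<lambda>u. c u [^] (2::nat)) bs"]) (auto simp: squares_def)
  next
    fix y assume "y \<in> Span (squares F) (map (qf Q) bs)"
    then obtain Ks where Ks: "set Ks \<subseteq> squares F" "length Ks = length bs" "y = combine Ks (map (qf Q) bs)"
      unfolding Span_mem_iff_length_version[OF subfield_squares q] by auto
    obtain a where a: "a \<in> set bs \<rightarrow> carrier F" "map (\<lambda>u. a u [^] (2::nat)) bs = Ks"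
      using square_coeffs[OF assms(1) Ks(2,1)] .
    have "y = qf Q (lincomb a (set bs))"
      unfolding qf_lincomb_combine[OF assms(1) bs a(1)] a(2) Ks(3) ..
    then show "y \<in> value_set Q" unfolding value_set_def using bs a(1) by blast
  qed
qed

lemma basis_list_exists: "\<exists>bs. distinct bs \<and> basis (set bs)"
  using finite_basis_exists[OF finite_dim] finite_distinct_list by metis

lemma value_set_independent_basis:
  "\<exists>ds. set ds \<subseteq> carrier F \<and> independent (squares F) ds \<and> Span (squares F) ds = value_set Q"
proof -
  obtain bs where bs: "distinct bs" "basis (set bs)" using basis_list_exists by blast
  then have "set (map (qf Q) bs) \<subseteq> carrier F" using qf_closed by (auto simp: basis_def)
  from filter_base[OF subfield_squares this] show ?thesis
    using value_set_Span[OF bs] by metis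
qed

lemma independent_values:
  assumes "distinct us" "set us \<subseteq> carrier (qspace Q)" "independent (squares F) (map (qf Q) us)"
    and a: "a \<in> set us \<rightarrow> carrier F" "qf Q (lincomb a (set us)) = \<zero>" and u: "u \<in> set us"
  shows "a u = \<zero>"
proof -
  let ?Ks = "map (\<lambda>u. a u [^] (2::nat)) us"
  have "set (take (length (map (qf Q) us)) ?Ks) \<subseteq> {\<zero>}"
    using a qf_lincomb_combine[OF assms(1,2) a(1)]
    by (intro independent_imp_trivial_combine[OF subfield_squares assms(3)]) (auto simp: squares_def)
  then have "a u [^] (2::nat) = \<zero>" using u by auto
  then show ?thesis using a(1) u square_pow[of "a u"] integral[of "a u" "a u"] by (auto simp: Pi_iff)
qed

text \<open>
  Lift the basis \<open>ds\<close> of the value set to vectors \<open>us\<close>, and let \<open>W\<close> be a maximal set of vectors of value 0 that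
  is independent together with \<open>us\<close>. Every vector \<open>v\<close> has the same value as some combination \<open>w\<close> of \<open>us\<close>, so
  \<open>w + v\<close> has value 0 and lies in the span of \<open>us\<close> and \<open>W\<close>, by maximality.
\<close>

lemma adapted_basis:
  assumes ds: "independent (squares F) ds" "Span (squares F) ds = value_set Q"
  shows "\<exists>us W. distinct us \<and> map (qf Q) us = ds \<and> finite W \<and> set us \<inter> W = {} \<and> basis (set us \<union> W)
    \<and> (\<forall>w\<in>W. qf Q w = \<zero>)"
proof -
  have "set ds \<subseteq> value_set Q"
    using Span_base_incl[OF subfield_squares independent_in_carrier[OF ds(1)]] ds(2) by blast
  then have "ds \<in> lists (qf Q ` carrier (qspace Q))" by (auto simp: value_set_def)
  then obtain us where us: "set us \<subseteq> carrier (qspace Q)" "map (qf Q) us = ds"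
    unfolding lists_image by auto
  have dus: "distinct us" using independent_distinct[OF subfield_squares ds(1)] us(2) by (auto simp: distinct_map)
  have ind: "independent (squares F) (map (qf Q) us)" using ds(1) us(2) by simp
  note triv = independent_values[OF dus us(1) ind]
  define good where "good W \<longleftrightarrow> W \<subseteq> carrier (qspace Q) \<and> (\<forall>w\<in>W. qf Q w = \<zero>) \<and> set us \<inter> W = {}
    \<and> lin_indpt (set us \<union> W)" for W
  have "lin_indpt (set us)"
  proof (rule finite_lin_indpt2)
    fix a assume a: "a \<in> set us \<rightarrow> carrier F" "lincomb a (set us) = \<zero>\<^bsub>qspace Q\<^esub>"
    then show "\<forall>v\<in>set us. a v = \<zero>" using triv[OF a(1)] qf_zero by simp
  qed (use us in auto)
  then have "good {}" by (simp add: good_def)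
  have bound: "finite W \<and> card W \<le> dim" if "good W" for W
  proof -
    have "set us \<union> W \<subseteq> carrier (qspace Q)" "lin_indpt (set us \<union> W)" using that us(1) by (auto simp: good_def)
    from li_le_dim[OF finite_dim this] show ?thesis
      using card_mono[of "set us \<union> W" W] by auto
  qed
  obtain W where W: "finite W" "maximal W good" using maximal_exists[of good, OF bound \<open>good {}\<close>] by blast
  have gW: "good W" using W(2) by (simp add: maximal_def)
  then have W': "W \<subseteq> carrier (qspace Q)" "\<And>w. w \<in> W \<Longrightarrow> qf Q w = \<zero>" "set us \<inter> W = {}" "lin_indpt (set us \<union> W)"
    by (auto simp: good_def)
  let ?B = "set us \<union> W"
  have Bc: "?B \<subseteq> carrier (qspace Q)" using us(1) W' by blast
  \<comment> \<open>here the maximality of \<open>W\<close> enters\<close>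
  have ker: "v \<in> span ?B" if v: "v \<in> carrier (qspace Q)" "qf Q v = \<zero>" for v
  proof (rule ccontr)
    assume nv: "v \<notin> span ?B"
    then have nB: "v \<notin> ?B" using in_own_span[OF Bc] by blast
    have "lin_indpt (?B \<union> {v})" using lin_dep_iff_in_span[OF Bc W'(4) v(1) nB] nv by blast
    then have "good (insert v W)" using W' v nB by (auto simp: good_def)
    then have "insert v W = W" using W(2) by (auto simp: maximal_def)
    then show False using nB by blast
  qed
  have "carrier (qspace Q) \<subseteq> span ?B"
  proof
    fix v assume v: "v \<in> carrier (qspace Q)"
    have "qf Q v \<in> Span (squares F) (map (qf Q) us)" unfolding us(2) ds(2) value_set_def using v by blast
    moreover have "set (map (qf Q) us) \<subseteq> carrier F" using us(1) qf_closed by auto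
    ultimately obtain Ks where Ks: "set Ks \<subseteq> squares F" "length Ks = length us"
        "qf Q v = combine Ks (map (qf Q) us)"
      using Span_mem_iff_length_version[OF subfield_squares] by auto
    obtain a where a: "a \<in> set us \<rightarrow> carrier F" "map (\<lambda>u. a u [^] (2::nat)) us = Ks"
      using square_coeffs[OF dus Ks(2,1)] .
    define w where "w = lincomb a (set us)"
    have w: "w \<in> carrier (qspace Q)" unfolding w_def using us(1) a(1) by blast
    have qw: "qf Q w = qf Q v" unfolding w_def qf_lincomb_combine[OF dus us(1) a(1)] a(2) Ks(3) ..
    have ws: "w \<in> span ?B"
      unfolding w_def span_def using a(1) by blast
    have dbl: "z \<oplus> z = \<zero>" if "z \<in> carrier F" for z
      using l_distr[OF R.one_closed R.one_closed that] char2 that by simp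
    have "w \<oplus>\<^bsub>qspace Q\<^esub> w = (\<one> \<oplus> \<one>) \<odot>\<^bsub>qspace Q\<^esub> w" using w by (simp add: smult_l_distr)
    then have ww: "w \<oplus>\<^bsub>qspace Q\<^esub> w = \<zero>\<^bsub>qspace Q\<^esub>" using w char2 by simp
    have "qf Q (w \<oplus>\<^bsub>qspace Q\<^esub> v) = \<zero>" using qf_add[OF w v] qw dbl qf_closed[OF v] by simp
    then have "w \<oplus>\<^bsub>qspace Q\<^esub> v \<in> span ?B" using ker w v by blast
    then have "w \<oplus>\<^bsub>qspace Q\<^esub> (w \<oplus>\<^bsub>qspace Q\<^esub> v) \<in> span ?B" using span_add1[OF Bc ws] by blast
    also have "w \<oplus>\<^bsub>qspace Q\<^esub> (w \<oplus>\<^bsub>qspace Q\<^esub> v) = v"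
      using w v ww by (simp flip: M.a_assoc)
    finally show "v \<in> span ?B" .
  qed
  then have "basis ?B" unfolding basis_def using W'(4) Bc span_is_subset2[OF Bc] by blast
  then show ?thesis using dus us(2) W(1) W'(2,3) by blast
qed

text \<open>
  In an adapted basis, the vectors of value 0 account for the difference of the two dimensions.
\<close>

lemma value_set_dimension:
  "\<exists>r \<le> dim. dimension r (squares F) (value_set Q) \<and> (anisotropic F Q \<longleftrightarrow> r = dim)"
proof -
  obtain ds where ds: "independent (squares F) ds" "Span (squares F) ds = value_set Q"
    using value_set_independent_basis by blast
  obtain us W where us: "distinct us" "map (qf Q) us = ds" "finite W" "set us \<inter> W = {}"
      "basis (set us \<union> W)" "\<forall>w\<in>W. qf Q w = \<zero>"
    using adapted_basis[OF ds] by blast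
  have Bc: "set us \<union> W \<subseteq> carrier (qspace Q)" "lin_indpt (set us \<union> W)" using us(5) by (auto simp: basis_def)
  have d: "dim = length ds + card W"
    using dim_basis[OF _ us(5)] us(1-4) by (simp add: card_Un_disjoint distinct_card flip: us(2))
  have "dimension (length ds) (squares F) (value_set Q)"
    using dimension_independent[OF ds(1)] ds(2) by simp
  moreover have "anisotropic F Q \<longleftrightarrow> W = {}"
  proof
    assume an: "anisotropic F Q"
    have "\<zero>\<^bsub>qspace Q\<^esub> \<notin> set us \<union> W" by (rule vs_zero_lin_dep[OF Bc])
    then show "W = {}" using an us(6) Bc(1) by (auto simp: anisotropic_def subset_iff)
  next
    assume W: "W = {}"
    show "anisotropic F Q"
      unfolding anisotropic_def
    proof (intro ballI impI)
      fix v assume v: "v \<in> carrier (qspace Q)" "qf Q v = \<zero>"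
      have b: "basis (set us)" using us(5) W by simp
      define c where "c = coords F (qspace Q) (set us) v"
      have c: "c \<in> set us \<rightarrow> carrier F" "lincomb c (set us) = v"
        unfolding c_def using coords[OF _ b v(1)] by auto
      have "c u = \<zero>" if "u \<in> set us" for u
        using independent_values[OF us(1) _ _ c(1) _ that] Bc(1) ds(1) us(2) c(2) v(2) by auto
      then have "lincomb c (set us) = \<zero>\<^bsub>qspace Q\<^esub>" using Bc(1) by (intro lincomb_zero) auto
      then show "v = \<zero>\<^bsub>qspace Q\<^esub>" using c(2) by simp
    qed
  qed
  ultimately show ?thesis using d us(3) by (intro exI[of _ "length ds"]) auto
qed

end

section \<open>Isometry classes and defects\<close>

lemma linear_mapI:
  assumes "vectorspace F V" "vectorspace F W" "\<And>v. v \<in> carrier V \<Longrightarrow> f v \<in> carrier W"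
    and "\<And>v w. v \<in> carrier V \<Longrightarrow> w \<in> carrier V \<Longrightarrow> f (v \<oplus>\<^bsub>V\<^esub> w) = f v \<oplus>\<^bsub>W\<^esub> f w"
    and "\<And>a v. a \<in> carrier F \<Longrightarrow> v \<in> carrier V \<Longrightarrow> f (a \<odot>\<^bsub>V\<^esub> v) = a \<odot>\<^bsub>W\<^esub> f v"
  shows "linear_map F V W f"
  using assms unfolding linear_map_def mod_hom_def mod_hom_axioms_def module_hom_def vectorspace_def
  by auto

lemma linear_mapD:
  assumes "linear_map F V W f"
  shows "v \<in> carrier V \<Longrightarrow> f v \<in> carrier W"
    "v \<in> carrier V \<Longrightarrow> w \<in> carrier V \<Longrightarrow> f (v \<oplus>\<^bsub>V\<^esub> w) = f v \<oplus>\<^bsub>W\<^esub> f w"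
    "a \<in> carrier F \<Longrightarrow> v \<in> carrier V \<Longrightarrow> f (a \<odot>\<^bsub>V\<^esub> v) = a \<odot>\<^bsub>W\<^esub> f v"
  using assms unfolding linear_map_def mod_hom_def mod_hom_axioms_def module_hom_def by auto

lemma isometric_of_bases:
  fixes F (structure)
  assumes P: "totally_singular_form F P" and Q: "totally_singular_form F Q"
    and B: "finite B" "vectorspace.basis F (qspace P) B"
    and B': "vectorspace.basis F (qspace Q) B'"
    and g: "bij_betw g B B'" and q: "\<And>u. u \<in> B \<Longrightarrow> qf P u = qf Q (g u)"
  shows "isometric F P Q"
proof -
  interpret P: totally_singular_form F P by fact
  interpret Q: totally_singular_form F Q by fact
  have fB': "finite B'" using g B(1) bij_betw_finite by blast
  have Bc: "B \<subseteq> carrier (qspace P)" "B' \<subseteq> carrier (qspace Q)"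
    using B(2) B' by (auto simp: P.basis_def Q.basis_def)
  define h where "h = the_inv_into B g"
  have h: "h w \<in> B" "g (h w) = w" if "w \<in> B'" for w
    unfolding h_def using g that the_inv_into_into[of g B w B] f_the_inv_into_f[of g B w]
    by (auto simp: bij_betw_def)
  have hg: "h (g u) = u" "g u \<in> B'" if "u \<in> B" for u
    unfolding h_def using g that the_inv_into_f_f[of g B u] by (auto simp: bij_betw_def)
  define co where "co v = coords F (qspace P) B v" for v
  define co' where "co' v = coords F (qspace Q) B' v" for v
  note coP = P.coords[OF B, folded co_def] and coQ = Q.coords[OF fB' B', folded co'_def]
  note uP = P.coords_unique[OF B, folded co_def] and uQ = Q.coords_unique[OF fB' B', folded co'_def]
  have co: "co v u \<in> carrier F" if "v \<in> carrier (qspace P)" "u \<in> B" for u v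
    using coP(1)[OF that(1)] that by auto
  have co': "co' v u \<in> carrier F" if "v \<in> carrier (qspace Q)" "u \<in> B'" for u v
    using coQ(1)[OF that(1)] that by auto
  define f where "f v = Q.lincomb (\<lambda>w. co v (h w)) B'" for v
  have fc: "(\<lambda>w. co v (h w)) \<in> B' \<rightarrow> carrier F" if "v \<in> carrier (qspace P)" for v
    using co[OF that] h by auto
  have fcl: "f v \<in> carrier (qspace Q)" if "v \<in> carrier (qspace P)" for v
    unfolding f_def using Bc fc[OF that] by blast
  have co_add: "co (v \<oplus>\<^bsub>qspace P\<^esub> w) u = co v u \<oplus> co w u"
    if "v \<in> carrier (qspace P)" "w \<in> carrier (qspace P)" "u \<in> B" for v w u
  proof (rule uP)
    show "P.lincomb (\<lambda>u. co v u \<oplus> co w u) B = v \<oplus>\<^bsub>qspace P\<^esub> w"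
      using that co B Bc by (subst P.lincomb_sum) (auto simp: coP)
  qed (use that co in auto)
  have co_smult: "co (a \<odot>\<^bsub>qspace P\<^esub> v) u = a \<otimes> co v u"
    if "a \<in> carrier F" "v \<in> carrier (qspace P)" "u \<in> B" for a v u
  proof (rule uP)
    show "P.lincomb (\<lambda>u. a \<otimes> co v u) B = a \<odot>\<^bsub>qspace P\<^esub> v"
      using that co B Bc by (subst P.lincomb_smult) (auto simp: coP)
  qed (use that co in auto)
  have lin: "linear_map F (qspace P) (qspace Q) f"
  proof (rule linear_mapI)
    show "vectorspace F (qspace P)" "vectorspace F (qspace Q)" by unfold_locales
    show "f v \<in> carrier (qspace Q)" if "v \<in> carrier (qspace P)" for v by (rule fcl[OF that])
    show "f (v \<oplus>\<^bsub>qspace P\<^esub> w) = f v \<oplus>\<^bsub>qspace Q\<^esub> f w"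
      if "v \<in> carrier (qspace P)" "w \<in> carrier (qspace P)" for v w
      unfolding f_def Q.lincomb_sum[OF fB' Bc(2) fc[OF that(1)] fc[OF that(2)], symmetric]
      using co[OF that(1)] co[OF that(2)] h by (intro Q.lincomb_cong) (auto simp: co_add[OF that] Bc)
    show "f (a \<odot>\<^bsub>qspace P\<^esub> v) = a \<odot>\<^bsub>qspace Q\<^esub> f v"
      if "a \<in> carrier F" "v \<in> carrier (qspace P)" for a v
      unfolding f_def Q.lincomb_smult[OF Bc(2) fc[OF that(2)] that(1), symmetric]
      using co[OF that(2)] h that by (intro Q.lincomb_cong) (auto simp: co_smult[OF that] Bc)
  qed
  have cof: "co' (f v) w = co v (h w)" if "v \<in> carrier (qspace P)" "w \<in> B'" for v w
    by (rule uQ[OF fcl[OF that(1)] fc[OF that(1)] _ that(2)]) (simp add: f_def)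
  have "inj_on f (carrier (qspace P))"
  proof (rule inj_onI)
    fix v w assume vw: "v \<in> carrier (qspace P)" "w \<in> carrier (qspace P)" "f v = f w"
    have "co v u = co w u" if "u \<in> B" for u
      using cof[OF vw(1) hg(2)[OF that]] cof[OF vw(2) hg(2)[OF that]] hg(1)[OF that] vw(3) by simp
    then have "P.lincomb (co v) B = P.lincomb (co w) B"
      using co[OF vw(2)] Bc by (intro P.lincomb_cong) auto
    then show "v = w" using coP(2) vw by simp
  qed
  moreover have "\<exists>v\<in>carrier (qspace P). f v = w" if w: "w \<in> carrier (qspace Q)" for w
  proof
    let ?a = "\<lambda>u. co' w (g u)"
    have a: "?a \<in> B \<rightarrow> carrier F" using co'[OF w] hg by auto
    show v: "P.lincomb ?a B \<in> carrier (qspace P)" using a Bc by blast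
    have "co (P.lincomb ?a B) u = co' w (g u)" if "u \<in> B" for u
      by (rule uP[OF v a refl that])
    then have "f (P.lincomb ?a B) = Q.lincomb (co' w) B'"
      unfolding f_def using h co'[OF w] Bc by (intro Q.lincomb_cong) auto
    then show "f (P.lincomb ?a B) = w" using coQ(2)[OF w] by simp
  qed
  ultimately have bij: "bij_betw f (carrier (qspace P)) (carrier (qspace Q))"
    unfolding bij_betw_def using fcl by blast
  have qc: "qf Q (g u) \<in> carrier F" if "u \<in> B" for u
    using Q.qf_closed[OF subsetD[OF Bc(2) hg(2)[OF that]]] .
  have "qf P v = qf Q (f v)" if v: "v \<in> carrier (qspace P)" for v
  proof -
    have "qf P v = (\<Oplus>u\<in>B. co v u [^] (2::nat) \<otimes> qf P u)"
      using P.qf_lincomb[OF B(1) Bc(1), of "co v"] co[OF v] coP(2)[OF v] by auto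
    also have "\<dots> = (\<Oplus>u\<in>B. co v (h (g u)) [^] (2::nat) \<otimes> qf Q (g u))"
      by (rule P.R.finsum_cong') (use hg(1) q co[OF v] qc in auto)
    also have "\<dots> = (\<Oplus>w\<in>g ` B. co v (h w) [^] (2::nat) \<otimes> qf Q w)"
      by (rule P.R.add.finprod_reindex[symmetric])
        (use g hg(1) co[OF v] qc in \<open>auto simp: bij_betw_def\<close>)
    also have "g ` B = B'" using g by (simp add: bij_betw_def)
    also have "(\<Oplus>w\<in>B'. co v (h w) [^] (2::nat) \<otimes> qf Q w) = qf Q (f v)"
      unfolding f_def by (rule Q.qf_lincomb[OF fB' Bc(2) fc[OF v], symmetric])
    finally show ?thesis .
  qed
  then show ?thesis unfolding isometric_def using lin bij by blast
qed

text \<open>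
  For the converse, both spaces have bases adapted to the same basis of the common value set. They
  contain equally many vectors of value 0, and matching them gives the isometry.
\<close>

lemma isometric_iff:
  fixes F (structure)
  assumes P: "totally_singular_form F P" and Q: "totally_singular_form F Q"
  shows "isometric F P Q \<longleftrightarrow> form_dim F P = form_dim F Q \<and> value_set P = value_set Q"
proof
  interpret P: totally_singular_form F P by fact
  interpret Q: totally_singular_form F Q by fact
  show "form_dim F P = form_dim F Q \<and> value_set P = value_set Q" if "isometric F P Q"
  proof -
    obtain f where f: "linear_map F (qspace P) (qspace Q) f"
        "bij_betw f (carrier (qspace P)) (carrier (qspace Q))"
        "\<forall>v\<in>carrier (qspace P). qf P v = qf Q (f v)"
      using \<open>isometric F P Q\<close> unfolding isometric_def by blast
    interpret f: linear_map F "qspace P" "qspace Q" f by (rule f(1))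
    have "form_dim F P = form_dim F Q"
      using f.dim_eq[OF P.finite_dim] f(2) by (auto simp: bij_betw_def)
    moreover have "value_set Q = qf Q ` f ` carrier (qspace P)"
      using f(2) by (simp add: value_set_def bij_betw_def)
    then have "value_set P = value_set Q"
      unfolding image_image using f(3) by (auto simp: value_set_def image_iff)
    ultimately show ?thesis by simp
  qed
  assume *: "form_dim F P = form_dim F Q \<and> value_set P = value_set Q"
  obtain ds where ds: "P.independent (squares F) ds" "P.Span (squares F) ds = value_set P"
    using P.value_set_independent_basis by blast
  obtain us W where us: "distinct us" "map (qf P) us = ds" "finite W" "set us \<inter> W = {}"
      "P.basis (set us \<union> W)" "\<forall>w\<in>W. qf P w = \<zero>"
    using P.adapted_basis[OF ds] by blast
  obtain us' W' where us': "distinct us'" "map (qf Q) us' = ds" "finite W'" "set us' \<inter> W' = {}"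
      "Q.basis (set us' \<union> W')" "\<forall>w\<in>W'. qf Q w = \<zero>"
    using Q.adapted_basis[OF ds(1)] ds(2) * by metis
  have "distinct ds" by (rule P.independent_distinct[OF P.subfield_squares ds(1)])
  then have b: "bij_betw (qf P) (set us) (set ds)" "bij_betw (qf Q) (set us') (set ds)"
    unfolding bij_betw_def using us(2) us'(2) by (metis distinct_map set_map)+
  have len: "length us = length us'" using us(2) us'(2) by (metis length_map)
  have "card (set us \<union> W) = card (set us' \<union> W')"
    using P.dim_basis[OF _ us(5)] Q.dim_basis[OF _ us'(5)] us(3) us'(3) * by simp
  then have "card W = card W'"
    using us us' len by (simp add: card_Un_disjoint distinct_card)
  then obtain k where k: "bij_betw k W W'" using finite_same_card_bij us(3) us'(3) by blast
  define g where "g u = (if u \<in> set us then the_inv_into (set us') (qf Q) (qf P u) else k u)" for u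
  have g1: "bij_betw g (set us) (set us')"
  proof -
    have "bij_betw (the_inv_into (set us') (qf Q) \<circ> qf P) (set us) (set us')"
      using b(1) bij_betw_the_inv_into[OF b(2)] by (rule bij_betw_trans)
    then show ?thesis by (rule bij_betw_cong[THEN iffD1, rotated]) (simp add: g_def)
  qed
  have g2: "bij_betw g W W'"
    using k by (rule bij_betw_cong[THEN iffD1, rotated]) (use us(4) in \<open>auto simp: g_def\<close>)
  have g: "bij_betw g (set us \<union> W) (set us' \<union> W')" by (rule bij_betw_combine[OF g1 g2 us'(4)])
  show "isometric F P Q"
  proof (rule isometric_of_bases[OF P Q _ us(5) us'(5) g])
    show "finite (set us \<union> W)" using us by simp
    fix u assume u: "u \<in> set us \<union> W"
    show "qf P u = qf Q (g u)"
    proof (cases "u \<in> set us")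
      case True
      have "qf P u \<in> qf Q ` set us'" using b True by (auto simp: bij_betw_def)
      then have "qf Q (the_inv_into (set us') (qf Q) (qf P u)) = qf P u"
        using b(2) by (intro f_the_inv_into_f) (auto simp: bij_betw_def)
      then show ?thesis using True by (simp add: g_def)
    next
      case False
      then have "u \<in> W" "g u \<in> W'" using u g2 by (auto simp: bij_betw_def)
      then show ?thesis using us(6) us'(6) by simp
    qed
  qed
qed

definition value_dim :: "('a, 'm) ring_scheme \<Rightarrow> ('a, 'v) qform \<Rightarrow> nat" where
  "value_dim F P = ring.dim F (squares F) (value_set P)"

lemma value_dim:
  assumes P: "totally_singular_form F P"
  shows "ring.dimension F (value_dim F P) (squares F) (value_set P)" "value_dim F P \<le> form_dim F P"
    "anisotropic F P \<longleftrightarrow> value_dim F P = form_dim F P"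
proof -
  interpret P: totally_singular_form F P by fact
  obtain r where r: "r \<le> P.dim" "P.dimension r (squares F) (value_set P)" "anisotropic F P \<longleftrightarrow> r = P.dim"
    using P.value_set_dimension by blast
  have "value_dim F P = r"
    unfolding value_dim_def by (rule P.dim_eqI[OF P.subfield_squares r(2)])
  then show "ring.dimension F (value_dim F P) (squares F) (value_set P)" "value_dim F P \<le> form_dim F P"
    "anisotropic F P \<longleftrightarrow> value_dim F P = form_dim F P"
    using r by auto
qed

lemma diag_form_values:
  fixes F (structure)
  assumes F: "field F" "\<one> \<oplus> \<one> = \<zero>" "set as \<subseteq> carrier F"
  shows "form_dim F (diag_form F as) = length as"
    "value_set (diag_form F as) = ring.Span F (squares F) as"
proof -
  interpret D: totally_singular_form F "diag_form F as" by (rule diag_form_totally_singular[OF F])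
  let ?n = "length as" and ?bs = "map (coord_vec F (length as)) [0..<length as]"
  have sp: "qspace (diag_form F as) = D.func_space {..<?n}" by (simp add: diag_form_def)
  have set: "set ?bs = coord_vec F ?n ` {..<?n}" by auto
  have b: "D.basis (set ?bs)" unfolding set sp by (rule coord_vec_basis[OF F(1)])
  have d: "distinct ?bs" using coord_vec_inj[OF F(1), of ?n] by (simp add: distinct_map atLeast0LessThan)
  show "form_dim F (diag_form F as) = length as"
    using D.dim_basis[OF _ b] distinct_card[OF d] by simp
  have "qf (diag_form F as) (coord_vec F ?n j) = as ! j" if j: "j < ?n" for j
  proof -
    have as: "as ! k \<in> carrier F" if "k < ?n" for k using F(3) that by auto
    have "qf (diag_form F as) (coord_vec F ?n j) =
        (\<Oplus>k\<in>{..<?n}. as ! k \<otimes> coord_vec F ?n j k [^] (2::nat))"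
      by (simp add: diag_form_def)
    also have "\<dots> = (\<Oplus>k\<in>{..<?n}. if j = k then as ! k else \<zero>)"
      by (rule D.R.finsum_cong') (use as in \<open>auto simp: coord_vec_def numeral_2_eq_2\<close>)
    also have "\<dots> = as ! j" by (rule D.R.add.finprod_singleton) (use as j in auto)
    finally show ?thesis .
  qed
  then have "map (qf (diag_form F as)) ?bs = as" by (intro nth_equalityI) auto
  then show "value_set (diag_form F as) = ring.Span F (squares F) as"
    using D.value_set_Span[OF d b] by simp
qed

lemma orth_sum_simps:
  "carrier (qspace (orth_sum F P Q)) = carrier (qspace P) \<times> carrier (qspace Q)"
  "\<zero>\<^bsub>qspace (orth_sum F P Q)\<^esub> = (\<zero>\<^bsub>qspace P\<^esub>, \<zero>\<^bsub>qspace Q\<^esub>)"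
  "v \<oplus>\<^bsub>qspace (orth_sum F P Q)\<^esub> w = (fst v \<oplus>\<^bsub>qspace P\<^esub> fst w, snd v \<oplus>\<^bsub>qspace Q\<^esub> snd w)"
  "a \<odot>\<^bsub>qspace (orth_sum F P Q)\<^esub> v = (a \<odot>\<^bsub>qspace P\<^esub> fst v, a \<odot>\<^bsub>qspace Q\<^esub> snd v)"
  "qf (orth_sum F P Q) v = qf P (fst v) \<oplus>\<^bsub>F\<^esub> qf Q (snd v)"
  by (simp_all add: orth_sum_def direct_sum_def case_prod_beta)

lemma direct_sum_basis:
  fixes F (structure)
  assumes "vectorspace F V" "vectorspace F W"
    and B: "finite B" "vectorspace.basis F V B" and C: "finite C" "vectorspace.basis F W C"
  shows "vectorspace.basis F (direct_sum V W) (inj1 V W ` B \<union> inj2 V W ` C)"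
    "inj1 V W ` B \<inter> inj2 V W ` C = {}"
proof -
  interpret V: vectorspace F V by fact
  interpret W: vectorspace F W by fact
  interpret D: vectorspace F "direct_sum V W" by (rule direct_sum_is_vs[OF assms(1,2)])
  interpret i: linear_map F V "direct_sum V W" "inj1 V W" by (rule inj1_linear[OF assms(1,2)])
  interpret j: linear_map F W "direct_sum V W" "inj2 V W" by (rule inj2_linear[OF assms(1,2)])
  have Bc: "B \<subseteq> carrier V" "V.lin_indpt B" "V.span B = carrier V" and
    Cc: "C \<subseteq> carrier W" "W.lin_indpt C" "W.span C = carrier W"
    using B C by (auto simp: V.basis_def W.basis_def)
  have ii: "inj_on (inj1 V W) (carrier V)" and jj: "inj_on (inj2 V W) (carrier W)"
    by (auto simp: inj_on_def inj1_def inj2_def)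
  let ?B = "inj1 V W ` B" and ?C = "inj2 V W ` C"
  have sub: "?B \<subseteq> carrier (direct_sum V W)" "?C \<subseteq> carrier (direct_sum V W)"
    using Bc(1) Cc(1) i.T_im j.T_im by blast+
  show disj: "?B \<inter> ?C = {}"
    using V.vs_zero_lin_dep[OF Bc(1,2)] by (auto simp: inj1_def inj2_def)
  have fin: "finite (?B \<union> ?C)" using B C by simp
  show "D.basis (?B \<union> ?C)"
    unfolding D.basis_def
  proof (intro conjI)
    show "?B \<union> ?C \<subseteq> carrier (direct_sum V W)" using sub by blast
    show "D.lin_indpt (?B \<union> ?C)"
    proof (rule D.finite_lin_indpt2[OF fin])
      show "?B \<union> ?C \<subseteq> carrier (direct_sum V W)" using sub by blast
      fix a assume a: "a \<in> ?B \<union> ?C \<rightarrow> carrier F" "D.lincomb a (?B \<union> ?C) = \<zero>\<^bsub>direct_sum V W\<^esub>"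
      have aB: "a \<in> ?B \<rightarrow> carrier F" "a \<in> ?C \<rightarrow> carrier F" using a(1) by auto
      have aB': "a \<circ> inj1 V W \<in> B \<rightarrow> carrier F" "a \<circ> inj2 V W \<in> C \<rightarrow> carrier F" using a(1) by auto
      let ?x = "V.lincomb (a \<circ> inj1 V W) B" and ?y = "W.lincomb (a \<circ> inj2 V W) C"
      have xy: "?x \<in> carrier V" "?y \<in> carrier W" using Bc Cc aB' by blast+
      have "D.lincomb a (?B \<union> ?C) = D.lincomb a ?B \<oplus>\<^bsub>direct_sum V W\<^esub> D.lincomb a ?C"
        using D.module.lincomb_union[OF fin _ disj a(1)] sub by blast
      also have "\<dots> = inj1 V W ?x \<oplus>\<^bsub>direct_sum V W\<^esub> inj2 V W ?y"
        unfolding i.lincomb_linear_image[OF ii Bc(1) aB(1) B(1)] j.lincomb_linear_image[OF jj Cc(1) aB(2) C(1)] ..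
      also have "\<dots> = (?x, ?y)" using xy by (simp add: inj1_def inj2_def direct_sum_def)
      finally have "?x = \<zero>\<^bsub>V\<^esub>" "?y = \<zero>\<^bsub>W\<^esub>" using a(2) by (auto simp: direct_sum_def)
      then have "\<forall>v\<in>B. (a \<circ> inj1 V W) v = \<zero>" "\<forall>v\<in>C. (a \<circ> inj2 V W) v = \<zero>"
        using V.lin_dep_crit[OF B(1) order_refl aB'(1)] W.lin_dep_crit[OF C(1) order_refl aB'(2)] Bc(2) Cc(2)
        by blast+
      then show "\<forall>v\<in>?B \<union> ?C. a v = \<zero>" by auto
    qed
    have "carrier (direct_sum V W) \<subseteq> D.span (?B \<union> ?C)"
    proof
      fix z assume "z \<in> carrier (direct_sum V W)"
      then obtain x y where z: "z = (x, y)" "x \<in> carrier V" "y \<in> carrier W" by (auto simp: direct_sum_def)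
      obtain a where a: "a \<in> B \<rightarrow> carrier F" "V.lincomb a B = x"
        using V.finite_in_span[OF B(1) Bc(1)] Bc(3) z(2) by blast
      obtain c where c: "c \<in> C \<rightarrow> carrier F" "W.lincomb c C = y"
        using W.finite_in_span[OF C(1) Cc(1)] Cc(3) z(3) by blast
      let ?a = "a \<circ> the_inv_into B (inj1 V W)" and ?c = "c \<circ> the_inv_into C (inj2 V W)"
      have ia: "(?a \<circ> inj1 V W) u = a u" if "u \<in> B" for u
        using the_inv_into_f_f[OF inj_on_subset[OF ii Bc(1)] that] by simp
      have jc: "(?c \<circ> inj2 V W) u = c u" if "u \<in> C" for u
        using the_inv_into_f_f[OF inj_on_subset[OF jj Cc(1)] that] by simp
      have a': "?a \<in> ?B \<rightarrow> carrier F" "?c \<in> ?C \<rightarrow> carrier F" using a(1) c(1) ia jc by auto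
      have "D.lincomb ?a ?B = inj1 V W x"
        unfolding i.lincomb_linear_image[OF ii Bc(1) a'(1) B(1)] a(2)[symmetric]
        by (rule arg_cong[of _ _ "inj1 V W"], rule V.lincomb_cong) (use ia a(1) Bc in auto)
      moreover have "D.lincomb ?c ?C = inj2 V W y"
        unfolding j.lincomb_linear_image[OF jj Cc(1) a'(2) C(1)] c(2)[symmetric]
        by (rule arg_cong[of _ _ "inj2 V W"], rule W.lincomb_cong) (use jc c(1) Cc in auto)
      ultimately have "inj1 V W x \<in> D.span ?B" "inj2 V W y \<in> D.span ?C"
        unfolding D.finite_span[OF finite_imageI[OF B(1)] sub(1)] D.finite_span[OF finite_imageI[OF C(1)] sub(2)]
        using a' by (metis (mono_tags, lifting) mem_Collect_eq)+
      then have "inj1 V W x \<in> D.span (?B \<union> ?C)" "inj2 V W y \<in> D.span (?B \<union> ?C)"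
        using D.span_is_monotone[of ?B "?B \<union> ?C"] D.span_is_monotone[of ?C "?B \<union> ?C"] by auto
      then have "inj1 V W x \<oplus>\<^bsub>direct_sum V W\<^esub> inj2 V W y \<in> D.span (?B \<union> ?C)"
        by (intro D.span_add1) (use sub in auto)
      then show "z \<in> D.span (?B \<union> ?C)" using z by (simp add: inj1_def inj2_def direct_sum_def)
    qed
    then show "D.span (?B \<union> ?C) = carrier (direct_sum V W)"
      using D.span_is_subset2[of "?B \<union> ?C"] sub by blast
  qed
qed

lemma orth_sum_totally_singular:
  fixes F (structure)
  assumes P: "totally_singular_form F P" and Q: "totally_singular_form F Q"
  shows "totally_singular_form F (orth_sum F P Q)"
    "form_dim F (orth_sum F P Q) = form_dim F P + form_dim F Q"
    "value_set (orth_sum F P Q) = value_set P <+>\<^bsub>F\<^esub> value_set Q"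
proof -
  interpret P: totally_singular_form F P by fact
  interpret Q: totally_singular_form F Q by fact
  have vs: "vectorspace F (qspace P)" "vectorspace F (qspace Q)" by unfold_locales
  have sp: "qspace (orth_sum F P Q) = direct_sum (qspace P) (qspace Q)" by (simp add: orth_sum_def)
  interpret D: vectorspace F "direct_sum (qspace P) (qspace Q)" by (rule direct_sum_is_vs[OF vs])
  obtain B where B: "finite B" "P.basis B" using P.finite_basis_exists[OF P.finite_dim] by blast
  obtain C where C: "finite C" "Q.basis C" using Q.finite_basis_exists[OF Q.finite_dim] by blast
  let ?B = "inj1 (qspace P) (qspace Q) ` B" and ?C = "inj2 (qspace P) (qspace Q) ` C"
  note BC = direct_sum_basis[OF vs B C]
  have fin: "finite (?B \<union> ?C)" using B C by simp
  have inj: "inj_on (inj1 (qspace P) (qspace Q)) B" "inj_on (inj2 (qspace P) (qspace Q)) C"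
    by (auto simp: inj_on_def inj1_def inj2_def)
  show "form_dim F (orth_sum F P Q) = form_dim F P + form_dim F Q"
    unfolding sp D.dim_basis[OF fin BC(1)] P.dim_basis[OF B] Q.dim_basis[OF C]
    using BC(2) B(1) C(1) by (simp add: card_Un_disjoint card_image inj)
  show "totally_singular_form F (orth_sum F P Q)"
  proof (rule totally_singular_form.intro[OF _ totally_singular_form_axioms.intro])
    show "vectorspace F (qspace (orth_sum F P Q))" by (simp only: sp D.vectorspace_axioms)
    show "\<one> \<oplus> \<one> = \<zero>" by (rule P.char2)
    have "D.fin_dim"
      unfolding D.fin_dim_def by (rule exI[of _ "?B \<union> ?C"]) (simp only: fin BC(1)[unfolded D.basis_def] simp_thms)
    then show "vectorspace.fin_dim F (qspace (orth_sum F P Q))" by (simp only: sp)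
  next
    fix v assume "v \<in> carrier (qspace (orth_sum F P Q))"
    then have v: "fst v \<in> carrier (qspace P)" "snd v \<in> carrier (qspace Q)"
      unfolding orth_sum_simps by auto
    note vc = P.qf_closed[OF v(1)] Q.qf_closed[OF v(2)]
    show "qf (orth_sum F P Q) v \<in> carrier F"
      using vc by (simp add: orth_sum_simps)
    show "qf (orth_sum F P Q) (a \<odot>\<^bsub>qspace (orth_sum F P Q)\<^esub> v) = a [^] (2::nat) \<otimes> qf (orth_sum F P Q) v"
      if "a \<in> carrier F" for a
      unfolding orth_sum_simps fst_conv snd_conv P.qf_smult[OF that v(1)] Q.qf_smult[OF that v(2)]
      using vc that by (simp add: P.r_distr)
    fix w assume "w \<in> carrier (qspace (orth_sum F P Q))"
    then have w: "fst w \<in> carrier (qspace P)" "snd w \<in> carrier (qspace Q)"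
      unfolding orth_sum_simps by auto
    note wc = P.qf_closed[OF w(1)] Q.qf_closed[OF w(2)]
    show "qf (orth_sum F P Q) (v \<oplus>\<^bsub>qspace (orth_sum F P Q)\<^esub> w) =
        qf (orth_sum F P Q) v \<oplus> qf (orth_sum F P Q) w"
      unfolding orth_sum_simps fst_conv snd_conv P.qf_add[OF v(1) w(1)] Q.qf_add[OF v(2) w(2)]
      using vc wc by (simp add: P.R.add.m_ac)
  qed
  show "value_set (orth_sum F P Q) = value_set P <+>\<^bsub>F\<^esub> value_set Q"
  proof (intro equalityI subsetI)
    fix y assume "y \<in> value_set (orth_sum F P Q)"
    then obtain z where "z \<in> carrier (qspace (orth_sum F P Q))" "y = qf (orth_sum F P Q) z"
      by (auto simp: value_set_def)
    then have "fst z \<in> carrier (qspace P)" "snd z \<in> carrier (qspace Q)" "y = qf P (fst z) \<oplus> qf Q (snd z)"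
      by (auto simp: orth_sum_simps)
    then show "y \<in> value_set P <+>\<^bsub>F\<^esub> value_set Q" unfolding P.set_add_iff value_set_def by blast
  next
    fix y assume "y \<in> value_set P <+>\<^bsub>F\<^esub> value_set Q"
    then obtain v w where vw: "v \<in> carrier (qspace P)" "w \<in> carrier (qspace Q)" "y = qf P v \<oplus> qf Q w"
      unfolding P.set_add_iff value_set_def by blast
    then have "y = qf (orth_sum F P Q) (v, w)" "(v, w) \<in> carrier (qspace (orth_sum F P Q))"
      by (simp_all add: orth_sum_simps)
    then show "y \<in> value_set (orth_sum F P Q)" unfolding value_set_def by blast
  qed
qed

lemma scale_form_totally_singular:
  fixes F (structure)
  assumes P: "totally_singular_form F P" and c: "c \<in> carrier F"
  shows "totally_singular_form F (scale_form F c P)"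
    "form_dim F (scale_form F c P) = form_dim F P"
    "value_set (scale_form F c P) = (\<otimes>) c ` value_set P"
proof -
  interpret P: totally_singular_form F P by fact
  have sp: "qspace (scale_form F c P) = qspace P" "qf (scale_form F c P) = (\<lambda>v. c \<otimes> qf P v)"
    by (simp_all add: scale_form_def)
  show "totally_singular_form F (scale_form F c P)"
    by (intro totally_singular_form.intro totally_singular_form_axioms.intro, unfold sp)
      (use c P.char2 P.finite_dim P.qf_closed P.vectorspace_axioms in
        \<open>auto simp: P.qf_smult P.qf_add P.r_distr P.m_lcomm\<close>)
  show "form_dim F (scale_form F c P) = form_dim F P" by (simp add: sp)
  show "value_set (scale_form F c P) = (\<otimes>) c ` value_set P"
    by (simp add: value_set_def sp image_image)
qed

lemma zero_form:
  fixes F (structure)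
  assumes F: "field F" "\<one> \<oplus> \<one> = \<zero>"
  shows "totally_singular_form F (diag_form F (replicate k \<zero>))"
    "form_dim F (diag_form F (replicate k \<zero>)) = k"
    "value_set (diag_form F (replicate k \<zero>)) = {\<zero>}"
proof -
  interpret field F by fact
  note sq = squares_subfield[OF F]
  have c: "set (replicate k \<zero>) \<subseteq> carrier F" by auto
  show "totally_singular_form F (diag_form F (replicate k \<zero>))" by (rule diag_form_totally_singular[OF F c])
  show "form_dim F (diag_form F (replicate k \<zero>)) = k" using diag_form_values(1)[OF F c] by simp
  have "Span (squares F) (replicate k \<zero>) \<subseteq> {\<zero>}"
    by (rule subalgebra_Span_incl[OF sq])
      (use subfieldD(1)[OF sq] in \<open>auto intro!: subalgebraI[OF sq]\<close>)
  then show "value_set (diag_form F (replicate k \<zero>)) = {\<zero>}"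
    unfolding diag_form_values(2)[OF F c]
    using Span_subgroup_props(2)[OF sq c] by blast
qed

lemma anisotropic_decomposition_values:
  fixes F (structure)
  assumes P: "totally_singular_form F P" and d: "anisotropic_decomposition F P A k"
  shows "totally_singular_form F A" "anisotropic F A" "form_dim F P = form_dim F A + k"
    "value_set P = value_set A"
proof -
  interpret P: totally_singular_form F P by fact
  have F: "field F" by unfold_locales
  note N = zero_form[OF F P.char2, of k]
  show A: "totally_singular_form F A" "anisotropic F A"
    using d by (auto simp: anisotropic_decomposition_def)
  interpret A: totally_singular_form F A by (rule A(1))
  note S = orth_sum_totally_singular[OF A(1) N(1)]
  have sum0: "value_set A <+>\<^bsub>F\<^esub> {\<zero>} = value_set A"
    using A.value_set_carrier by (force simp: P.set_add_iff)
  have "isometric F P (orth_sum F A (diag_form F (replicate k \<zero>)))"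
    using d by (auto simp: anisotropic_decomposition_def)
  then show "form_dim F P = form_dim F A + k" "value_set P = value_set A"
    unfolding isometric_iff[OF P S(1)] S(2,3) N(2,3) sum0 by auto
qed

text \<open>
  The anisotropic part has the value set of \<open>P\<close>, and as an anisotropic form its dimension is that
  of the value set. A diagonal form on a basis of the value set realizes it.
\<close>

lemma defect_eq:
  fixes F (structure)
  assumes P: "totally_singular_form F P"
  shows "defect F P = form_dim F P - value_dim F P"
proof -
  interpret P: totally_singular_form F P by fact
  have F: "field F" by unfold_locales
  let ?k = "form_dim F P - value_dim F P"
  note N = zero_form[OF F P.char2, of ?k]
  have uniq: "k = ?k" if d: "anisotropic_decomposition F P A k" for k and A :: "('a, nat \<Rightarrow> 'a) qform"
    using anisotropic_decomposition_values[OF P d] value_dim(3)[of F A] by (simp add: value_dim_def)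
  obtain ds where ds: "set ds \<subseteq> carrier F" "P.independent (squares F) ds" "P.Span (squares F) ds = value_set P"
    using P.value_set_independent_basis by blast
  let ?A = "diag_form F ds"
  have A: "totally_singular_form F ?A" by (rule diag_form_totally_singular[OF F P.char2 ds(1)])
  have v: "form_dim F ?A = length ds" "value_set ?A = value_set P"
    using diag_form_values[OF F P.char2 ds(1)] ds(3) by auto
  have "value_dim F P = length ds"
    unfolding value_dim_def using P.dim_eqI[OF P.subfield_squares P.dimension_independent[OF ds(2)]] ds(3) by simp
  then have an: "anisotropic F ?A" "form_dim F P = length ds + ?k"
    using value_dim(3)[OF A] v value_dim(2)[OF P] by (auto simp: value_dim_def)
  have sum0: "value_set P <+>\<^bsub>F\<^esub> {\<zero>} = value_set P"
    using P.value_set_carrier by (force simp: P.set_add_iff)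
  have "isometric F P (orth_sum F ?A (diag_form F (replicate ?k \<zero>)))"
    unfolding isometric_iff[OF P orth_sum_totally_singular(1)[OF A N(1)]]
      orth_sum_totally_singular(2,3)[OF A N(1)] v N(2,3) sum0
    using an(2) by simp
  then have ex: "\<exists>A :: ('a, nat \<Rightarrow> 'a) qform. anisotropic_decomposition F P A ?k"
    unfolding anisotropic_decomposition_def using A an(1) by blast
  show ?thesis
    unfolding defect_def
  proof (rule the_equality)
    show "\<exists>A :: ('a, nat \<Rightarrow> 'a) qform. anisotropic_decomposition F P A ?k" by (rule ex)
  qed (use uniq in blast)
qed

lemma similar_of_value_sets:
  fixes F (structure)
  assumes P: "totally_singular_form F P" and Q: "totally_singular_form F Q"
    and d: "form_dim F P = form_dim F Q" and x: "x \<in> nonzero F" "value_set Q = (\<otimes>) x ` value_set P"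
  shows "similar F P Q"
proof -
  interpret P: totally_singular_form F P by fact
  have xc: "x \<in> carrier F" "x \<noteq> \<zero>" using x(1) by auto
  note x' = P.nonzero_inverse[OF xc]
  note S = scale_form_totally_singular[OF Q x'(1)]
  have "value_set P = (\<otimes>) (inv x) ` value_set Q"
    unfolding x(2) using P.smult_inv_image(1)[OF xc P.value_set_carrier] by simp
  then have "isometric F P (scale_form F (inv x) Q)"
    unfolding isometric_iff[OF P S(1)] S(2,3) using d by simp
  then show ?thesis unfolding similar_def using x' by blast
qed

section \<open>Extension of scalars\<close>

lemma hom_char2:
  assumes "field F" "field E" "j \<in> ring_hom F E" "\<one>\<^bsub>F\<^esub> \<oplus>\<^bsub>F\<^esub> \<one>\<^bsub>F\<^esub> = \<zero>\<^bsub>F\<^esub>"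
  shows "\<one>\<^bsub>E\<^esub> \<oplus>\<^bsub>E\<^esub> \<one>\<^bsub>E\<^esub> = \<zero>\<^bsub>E\<^esub>"
proof -
  interpret F: field F by fact
  interpret E: field E by fact
  interpret j: ring_hom_cring F E j by (intro ring_hom_cringI F.is_cring E.is_cring assms(3))
  show ?thesis using j.hom_add[of "\<one>\<^bsub>F\<^esub>" "\<one>\<^bsub>F\<^esub>"] assms(4) by simp
qed

text \<open>
  The value set over \<open>E\<close> is the \<open>E\<^sup>2\<close>-span of the images of the values of \<open>P\<close> on a basis. Once \<open>j ` M\<close> contains
  \<open>E\<^sup>2\<close>, these images also generate its span over \<open>j ` M\<close>. For \<open>j ` M = E\<^sup>2\<close> this span is the value set itself.
\<close>

lemma base_change_values:
  assumes P: "totally_singular_form F P" and E: "field E" and j: "j \<in> ring_hom F E"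
    and M: "subfield M F" "squares F \<subseteq> M" "squares E \<subseteq> j ` M"
  shows "field.subspan E (j ` M) (value_set (base_change F E j P)) = j ` field.subspan F M (value_set P)"
    "form_dim E (base_change F E j P) = form_dim F P"
    "ring.dimension E (ring.dim F M (field.subspan F M (value_set P))) (j ` M)
      (field.subspan E (j ` M) (value_set (base_change F E j P)))"
proof -
  interpret P: totally_singular_form F P by fact
  interpret E: field E by fact
  have F: "field F" by unfold_locales
  interpret j: ring_hom_ring F E j
    by (rule ring_hom_ringI2[OF P.R.ring_axioms E.ring_axioms j])
  note char2 = hom_char2[OF F E j P.char2]
  define qs where "qs = map (qf P) (basis_list F P)"
  have bs: "distinct (basis_list F P)" "P.basis (set (basis_list F P))"
    using someI_ex[OF P.basis_list_exists] unfolding basis_list_def by auto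
  have vP: "value_set P = P.Span (squares F) qs"
    unfolding qs_def by (rule P.value_set_Span[OF bs])
  have qc: "set qs \<subseteq> carrier F" using bs(2) P.qf_closed by (auto simp: qs_def P.basis_def)
  have bc: "base_change F E j P = diag_form E (map j qs)"
    by (simp add: base_change_def qs_def o_def)
  have jc: "set (map j qs) \<subseteq> carrier E" using qc by auto
  have len: "length qs = form_dim F P"
    using P.dim_basis[OF _ bs(2)] distinct_card[OF bs(1)] by (simp add: qs_def)
  show "form_dim E (base_change F E j P) = form_dim F P"
    unfolding bc using diag_form_values(1)[OF E char2 jc] len by simp
  note sE = squares_subfield[OF E char2]
  have jM: "subfield (j ` M) E" by (rule j.img_is_subfield(2)[OF M(1) E.one_not_zero])
  have Mc: "M \<subseteq> carrier F" by (rule P.subfieldD(1)[OF M(1)])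
  have s: "P.subspan M (value_set P) = P.Span M qs"
    unfolding vP by (rule P.subspan_Span_subspan[OF P.subfield_squares M(1,2) qc])
  have "E.subspan (j ` M) (value_set (base_change F E j P)) = E.Span (j ` M) (map j qs)"
    unfolding bc diag_form_values(2)[OF E char2 jc]
    by (rule E.subspan_Span_subspan[OF sE jM M(3) jc])
  also have "\<dots> = j ` P.Span M qs" by (rule j.Span_hom[OF Mc qc])
  finally show eq: "E.subspan (j ` M) (value_set (base_change F E j P)) = j ` P.subspan M (value_set P)"
    unfolding s .
  have inj: "inj_on j (carrier F)"
    by (rule j.img_is_subfield(1)[OF P.carrier_is_subfield E.one_not_zero])
  have fin: "P.dimension (P.R.dim M (P.Span M qs)) M (P.Span M qs)"
    by (rule P.dimension_dim[OF M(1) P.Span_finite_dimension[OF M(1) qc]])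
  have "inj_on j (P.Span M qs)"
    using inj P.Span_in_carrier[OF Mc qc] inj_on_subset by blast
  from j.inj_hom_dimension[OF M(1) E.one_not_zero this fin]
  show "E.dimension (ring.dim F M (P.subspan M (value_set P))) (j ` M)
      (E.subspan (j ` M) (value_set (base_change F E j P)))"
    unfolding eq s by simp
qed

text \<open>
  Vishik equivalence refers to extensions whose elements are lists; the singletons provide a copy of
  \<open>M\<close> among them.
\<close>

definition list_copy :: "('a, 'm) ring_scheme \<Rightarrow> 'a set \<Rightarrow> 'a list ring" where
  "list_copy F M = \<lparr>carrier = (\<lambda>x. [x]) ` M, mult = (\<lambda>x y. [hd x \<otimes>\<^bsub>F\<^esub> hd y]), one = [\<one>\<^bsub>F\<^esub>],
     zero = [\<zero>\<^bsub>F\<^esub>], add = (\<lambda>x y. [hd x \<oplus>\<^bsub>F\<^esub> hd y])\<rparr>"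

lemma field_list_copy:
  assumes "field F" "subfield M F"
  shows "field (list_copy F M)"
proof -
  interpret field F by fact
  have fM: "field (F\<lparr>carrier := M\<rparr>)" by (rule subfield_iff(2)[OF assms(2)])
  have "(\<lambda>x. [x]) \<in> ring_iso (F\<lparr>carrier := M\<rparr>) (list_copy F M)"
    by (auto simp: ring_iso_def ring_hom_def list_copy_def bij_betw_def inj_on_def)
  from field.ring_iso_imp_img_field[OF fM this] show ?thesis
    by (simp add: list_copy_def)
qed

text \<open>
  Squaring maps \<open>F\<close> into \<open>M\<close> and \<open>M\<close> onto \<open>M\<^sup>2\<close>. Over the extension \<open>M\<close> of \<open>F\<close> so obtained, the value set of a
  form is isomorphic to the \<open>M\<close>-span of its value set over \<open>F\<close>, and its dimension over \<open>M\<^sup>2\<close> can be read off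
  from the defect.
\<close>

lemma vishik_equivalent_subspan_dim:
  assumes F: "field F" and P: "totally_singular_form F P" and Q: "totally_singular_form F Q"
    and v: "vishik_equivalent F P Q" and M: "subfield M F" "squares F \<subseteq> M"
  shows "ring.dim F M (field.subspan F M (value_set P)) = ring.dim F M (field.subspan F M (value_set Q))"
proof -
  interpret P: totally_singular_form F P by fact
  interpret Q: totally_singular_form F Q by fact
  define E where "E = list_copy F M"
  define j where "j = (\<lambda>x. [x \<otimes>\<^bsub>F\<^esub> x])"
  have E: "field E" unfolding E_def by (rule field_list_copy[OF F M(1)])
  interpret E: field E by (rule E)
  note MD = P.subfieldD[OF M(1)]
  have sq: "x \<otimes>\<^bsub>F\<^esub> x \<in> squares F" if "x \<in> carrier F" for x
    using that P.square_pow[OF that] by (force simp: squares_def)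
  have dbl: "z \<oplus>\<^bsub>F\<^esub> z = \<zero>\<^bsub>F\<^esub>" if "z \<in> carrier F" for z
    using P.R.l_distr[OF P.R.one_closed P.R.one_closed that] P.char2 that by simp
  have j: "j \<in> ring_hom F E"
  proof (rule ring_hom_memI)
    fix x y assume xy: "x \<in> carrier F" "y \<in> carrier F"
    show "j x \<in> carrier E" using sq[OF xy(1)] M(2) by (auto simp: j_def E_def list_copy_def)
    have "(x \<otimes>\<^bsub>F\<^esub> y) \<otimes>\<^bsub>F\<^esub> (x \<otimes>\<^bsub>F\<^esub> y) = (x \<otimes>\<^bsub>F\<^esub> x) \<otimes>\<^bsub>F\<^esub> (y \<otimes>\<^bsub>F\<^esub> y)" using xy by (simp add: P.R.m_ac)
    then show "j (x \<otimes>\<^bsub>F\<^esub> y) = j x \<otimes>\<^bsub>E\<^esub> j y" by (simp add: j_def E_def list_copy_def)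
    have "(x \<oplus>\<^bsub>F\<^esub> y) \<otimes>\<^bsub>F\<^esub> (x \<oplus>\<^bsub>F\<^esub> y) =
        (x \<otimes>\<^bsub>F\<^esub> x \<oplus>\<^bsub>F\<^esub> y \<otimes>\<^bsub>F\<^esub> y) \<oplus>\<^bsub>F\<^esub> (x \<otimes>\<^bsub>F\<^esub> y \<oplus>\<^bsub>F\<^esub> x \<otimes>\<^bsub>F\<^esub> y)"
      using xy by algebra
    then have "(x \<oplus>\<^bsub>F\<^esub> y) \<otimes>\<^bsub>F\<^esub> (x \<oplus>\<^bsub>F\<^esub> y) = x \<otimes>\<^bsub>F\<^esub> x \<oplus>\<^bsub>F\<^esub> y \<otimes>\<^bsub>F\<^esub> y"
      using dbl[of "x \<otimes>\<^bsub>F\<^esub> y"] xy by simp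
    then show "j (x \<oplus>\<^bsub>F\<^esub> y) = j x \<oplus>\<^bsub>E\<^esub> j y" by (simp add: j_def E_def list_copy_def)
  qed (simp add: j_def E_def list_copy_def)
  have sE: "squares E = j ` M"
  proof -
    have "[x] [^]\<^bsub>E\<^esub> (2::nat) = j x" if "x \<in> M" for x
    proof -
      have "[x] \<in> carrier E" using that by (simp add: E_def list_copy_def)
      then have "[x] [^]\<^bsub>E\<^esub> (2::nat) = [x] \<otimes>\<^bsub>E\<^esub> [x]" by (simp add: numeral_2_eq_2)
      then show ?thesis by (simp add: j_def E_def list_copy_def)
    qed
    moreover have "carrier E = (\<lambda>x. [x]) ` M" by (simp add: E_def list_copy_def)
    ultimately show ?thesis unfolding squares_def by (auto simp: image_image image_iff)
  qed
  have char2: "\<one>\<^bsub>E\<^esub> \<oplus>\<^bsub>E\<^esub> \<one>\<^bsub>E\<^esub> = \<zero>\<^bsub>E\<^esub>" by (rule hom_char2[OF F E j P.char2])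
  have sub: "squares E \<subseteq> j ` M" using sE by simp
  have key: "defect E (base_change F E j X) = form_dim F X - ring.dim F M (field.subspan F M (value_set X))
      \<and> ring.dim F M (field.subspan F M (value_set X)) \<le> form_dim F X"
    if X: "totally_singular_form F X" for X :: "('a, 'x) qform"
  proof -
    have tE: "totally_singular_form E (base_change F E j X)" by (rule base_change_totally_singular[OF X E j])
    note bc = base_change_values[OF X E j M sub]
    have sf: "subfield (squares E) E" by (rule squares_subfield[OF E char2])
    have "E.subspan (squares E) (value_set (base_change F E j X)) = value_set (base_change F E j X)"
      by (rule E.subspan_self, rule E.finite_dimension_imp_subalgebra[OF sf])
        (use value_dim(1)[OF tE] in \<open>auto simp: E.finite_dimension_def\<close>)
    then have "value_dim E (base_change F E j X) = ring.dim F M (field.subspan F M (value_set X))"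
      using bc(3) E.dim_eqI[OF sf] unfolding sE[symmetric] value_dim_def by simp
    then show ?thesis using defect_eq[OF tE] value_dim(2)[OF tE] bc(2) by simp
  qed
  have "form_dim F P = form_dim F Q" "defect E (base_change F E j P) = defect E (base_change F E j Q)"
    using v E j unfolding vishik_equivalent_def by blast+
  then show ?thesis using key[OF P] key[OF Q] by arith
qed

section \<open>Quasi-Pfister forms and their neighbors\<close>

lemma diag_tensor_one:
  fixes F (structure)
  assumes "field F" "set cs \<subseteq> carrier F"
  shows "diag_tensor F [\<one>, a] cs = cs @ map ((\<otimes>) a) cs"
proof -
  interpret field F by fact
  have "map ((\<otimes>) \<one>) cs = cs" using assms(2) by (intro map_idI) auto
  then show ?thesis by (simp add: diag_tensor_def)
qed

text \<open>
  One more slot \<open>a\<close> turns the span \<open>S\<close> of the coefficients into \<open>S + aS\<close>, which is the field \<open>S(a)\<close>.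
\<close>

lemma Pfister_coeffs_Span:
  fixes F (structure)
  assumes F: "field F" "\<one> \<oplus> \<one> = \<zero>" and as: "set as \<subseteq> carrier F"
  shows "set (Pfister_coeffs F as) \<subseteq> carrier F \<and> subfield (ring.Span F (squares F) (Pfister_coeffs F as)) F
    \<and> squares F \<subseteq> ring.Span F (squares F) (Pfister_coeffs F as)"
proof -
  interpret field F by fact
  note sf = squares_subfield[OF F]
  interpret square_closed_subfield F "squares F" by (rule squares_square_closed[OF F])
  show ?thesis using as
  proof (induction as)
    case Nil
    have "Span (squares F) [\<one>] = squares F"
      using subspan_Span[OF sf, of "[\<one>]"] subspan_eq_field[OF sf, of "{\<one>}"] subfieldD(3)[OF sf]
      by (simp del: Span.simps)
    then show ?case using sf by (simp add: Pfister_coeffs_def del: Span.simps)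
  next
    case (Cons a as)
    let ?cs = "Pfister_coeffs F as"
    let ?S = "Span (squares F) ?cs"
    have a: "a \<in> carrier F" and cs: "set ?cs \<subseteq> carrier F" and S: "subfield ?S F" "squares F \<subseteq> ?S"
      using Cons by auto
    have eq: "Pfister_coeffs F (a # as) = ?cs @ map ((\<otimes>) a) ?cs"
      using diag_tensor_one[OF F(1) cs] by (simp add: Pfister_coeffs_def)
    have ac: "set (map ((\<otimes>) a) ?cs) \<subseteq> carrier F" using a cs by auto
    have "Span (squares F) (map ((\<otimes>) a) ?cs) = (\<otimes>) a ` ?S"
    proof (cases "a = \<zero>")
      case True
      have zero: "(\<otimes>) a ` ?S = {\<zero>}"
        using True subfieldD(1,2)[OF S(1)] by (force simp: image_iff)
      have "Span (squares F) (map ((\<otimes>) a) ?cs) \<subseteq> {\<zero>}"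
        by (rule subalgebra_Span_incl[OF sf])
          (use True cs subfieldD(1)[OF sf] in \<open>auto intro!: subalgebraI[OF sf]\<close>)
      moreover have "{\<zero>} \<subseteq> Span (squares F) (map ((\<otimes>) a) ?cs)"
        using Span_subgroup_props(2)[OF sf ac] by (simp del: Span.simps)
      ultimately show ?thesis unfolding zero by (rule equalityI)
    next
      case False
      show ?thesis
        using subspan_Span[OF sf ac] subspan_Span[OF sf cs] subspan_smult[OF sf cs a False]
        by (simp del: Span.simps)
    qed
    then have sp: "Span (squares F) (Pfister_coeffs F (a # as)) = adjoin ?S a"
      unfolding eq adjoin_def Span_append_eq_set_add[OF sf cs ac] by simp
    show ?case
      unfolding sp using subfield_adjoin[OF S a] adjoin_incl(1)[OF S(1) a] S(2) cs ac eq by auto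
  qed
qed

lemma quasi_Pfister_values:
  assumes P: "totally_singular_form F P" and q: "quasi_Pfister F P"
  shows "subfield (value_set P) F" "squares F \<subseteq> value_set P"
proof -
  interpret P: totally_singular_form F P by fact
  have F: "field F" by unfold_locales
  obtain as where as: "set as \<subseteq> carrier F" "isometric F P (diag_form F (Pfister_coeffs F as))"
    using q unfolding quasi_Pfister_def by blast
  note pc = Pfister_coeffs_Span[OF F P.char2 as(1)]
  have "value_set P = P.Span (squares F) (Pfister_coeffs F as)"
    using as(2) isometric_iff[OF P diag_form_totally_singular[OF F P.char2 conjunct1[OF pc]]]
      diag_form_values(2)[OF F P.char2 conjunct1[OF pc]] by simp
  then show "subfield (value_set P) F" "squares F \<subseteq> value_set P" using pc by auto
qed

text \<open>
  The dimension of the value set of \<open>\<phi>\<close> is at most that of the value sets of \<open>\<pi>\<close> and \<open>\<sigma>\<close> together, which is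
  at most \<open>dim \<pi> + dim \<sigma> = dim \<phi>\<close>. For anisotropic \<open>\<phi>\<close> there is equality throughout, so the sum is direct
  and \<open>\<sigma>\<close> is anisotropic.
\<close>

lemma special_neighbor_values:
  fixes K (structure)
  assumes s: "special_quasi_Pfister_neighbor K \<phi> \<pi> b \<sigma>" and an: "anisotropic K \<phi>"
  shows "\<exists>e\<in>nonzero K. value_set \<phi> = (\<otimes>) e ` (value_set \<pi> <+>\<^bsub>K\<^esub> (\<otimes>) b ` value_set \<sigma>)"
    "value_set \<pi> \<inter> (\<otimes>) b ` value_set \<sigma> = {\<zero>}"
    "value_dim K \<sigma> = form_dim K \<sigma>" "value_set \<sigma> \<subseteq> value_set \<pi>"
proof -
  have P: "totally_singular_form K \<phi>" and pi: "totally_singular_form K \<pi>" and si: "totally_singular_form K \<sigma>"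
    and b: "b \<in> carrier K" "b \<noteq> \<zero>" and sub: "subform K \<sigma> \<pi>"
    and sim: "similar K \<phi> (orth_sum K \<pi> (scale_form K b \<sigma>))"
    using s unfolding special_quasi_Pfister_neighbor_def by auto
  interpret P: totally_singular_form K \<phi> by fact
  note sq = P.subfield_squares
  show "value_set \<sigma> \<subseteq> value_set \<pi>"
    using sub linear_mapD(1) unfolding subform_def value_set_def by fastforce
  note bs = scale_form_totally_singular[OF si b(1)]
  note os = orth_sum_totally_singular[OF pi bs(1), unfolded bs(2,3)]
  obtain e where e: "e \<in> carrier K" "e \<noteq> \<zero>"
      "isometric K \<phi> (scale_form K e (orth_sum K \<pi> (scale_form K b \<sigma>)))"
    using sim unfolding similar_def by blast
  note es = scale_form_totally_singular[OF os(1) e(1), unfolded os(2,3)]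
  have v: "value_set \<phi> = (\<otimes>) e ` (value_set \<pi> <+>\<^bsub>K\<^esub> (\<otimes>) b ` value_set \<sigma>)"
    and fd: "form_dim K \<phi> = form_dim K \<pi> + form_dim K \<sigma>"
    using e(3) unfolding isometric_iff[OF P es(1)] es(2,3) by auto
  then show "\<exists>e\<in>nonzero K. value_set \<phi> = (\<otimes>) e ` (value_set \<pi> <+>\<^bsub>K\<^esub> (\<otimes>) b ` value_set \<sigma>)"
    using e by blast
  have fin: "P.finite_dimension (squares K) (value_set \<pi>)" "P.finite_dimension (squares K) (value_set \<sigma>)"
    using value_dim(1)[OF pi] value_dim(1)[OF si] by (auto simp: P.finite_dimension_def)
  note fb = P.finite_dimension_smult[OF sq b fin(2)]
  note ds = P.dim_sum[OF sq fin(1) fb]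
  have "value_dim K \<phi> = P.R.dim (squares K) (value_set \<pi> <+>\<^bsub>K\<^esub> (\<otimes>) b ` value_set \<sigma>)"
    unfolding value_dim_def v by (rule P.dim_smult[OF sq e(1,2) ds(1)])
  then have "value_dim K \<phi> + P.R.dim (squares K) (value_set \<pi> \<inter> (\<otimes>) b ` value_set \<sigma>) =
      value_dim K \<pi> + value_dim K \<sigma>"
    using ds(2) P.dim_smult[OF sq b fin(2)] by (simp add: value_dim_def)
  moreover have "value_dim K \<phi> = form_dim K \<phi>" using value_dim(3)[OF P] an by simp
  ultimately have *: "P.R.dim (squares K) (value_set \<pi> \<inter> (\<otimes>) b ` value_set \<sigma>) = 0"
    "value_dim K \<sigma> = form_dim K \<sigma>"
    using fd value_dim(2)[OF pi] value_dim(2)[OF si] by auto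
  show "value_dim K \<sigma> = form_dim K \<sigma>" by (rule *(2))
  have "subalgebra (squares K) (value_set \<pi> \<inter> (\<otimes>) b ` value_set \<sigma>) K"
    by (intro P.subalgebra_inter P.finite_dimension_imp_subalgebra[OF sq] fin fb)
  then have "P.finite_dimension (squares K) (value_set \<pi> \<inter> (\<otimes>) b ` value_set \<sigma>)"
    using P.dim_subspace(1)[OF sq fin(1)] by blast
  then show "value_set \<pi> \<inter> (\<otimes>) b ` value_set \<sigma> = {\<zero>}"
    using P.dim_eq_0[OF sq] *(1) by blast
qed

text \<open>
  For a neighbor \<open>\<sigma>\<close> of codimension one, the value set \<open>Q\<close> of the ambient quasi-Pfister form is a field that
  contains a multiple of \<open>S = D(\<sigma>)\<close> of more than half its dimension. Its elements are therefore ratios of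
  elements of \<open>S\<close>, and so \<open>Q\<close> lies in the field \<open>D(\<pi>)\<close>.
\<close>

lemma almost_field_or_minimal:
  fixes K (structure)
  assumes pi: "totally_singular_form K \<pi>" and si: "totally_singular_form K \<sigma>"
    and qp: "quasi_Pfister K \<pi>" and dim: "value_dim K \<sigma> = form_dim K \<sigma>"
    and sub: "value_set \<sigma> \<subseteq> value_set \<pi>"
    and cases: "quasi_Pfister K \<sigma> \<or> codim1_quasi_Pfister_neighbor K \<sigma> \<or> minimal_form K \<sigma>"
  shows "(\<exists>Q e. subfield Q K \<and> squares K \<subseteq> Q \<and> Q \<subseteq> value_set \<pi> \<and> e \<in> nonzero K
      \<and> value_set \<sigma> \<subseteq> (\<otimes>) e ` Q
      \<and> ring.dim K (squares K) Q \<le> Suc (ring.dim K (squares K) (value_set \<sigma>)))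
    \<or> square_closed_subfield.minimal_space K (squares K) (value_set \<sigma>)"
proof -
  have K: "field K" using pi by (simp add: totally_singular_form_def vectorspace_def)
  interpret S: square_closed_subfield K "squares K"
    by (rule squares_square_closed[OF K totally_singular_form.char2[OF pi]])
  interpret pi: totally_singular_form K \<pi> by fact
  interpret si: totally_singular_form K \<sigma> by fact
  note piF = quasi_Pfister_values[OF pi qp]
  note piD = S.subfieldD[OF piF(1)]
  have fs: "S.finite_dimension (squares K) (value_set \<sigma>)"
    using value_dim(1)[OF si] by (auto simp: S.finite_dimension_def)
  have fp: "S.finite_dimension (squares K) (value_set \<pi>)"
    using value_dim(1)[OF pi] by (auto simp: S.finite_dimension_def)
  from cases show ?thesis
  proof (elim disjE)
    assume "quasi_Pfister K \<sigma>"
    from quasi_Pfister_values[OF si this]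
    have "subfield (value_set \<sigma>) K" "squares K \<subseteq> value_set \<sigma>" by auto
    moreover have "value_set \<sigma> \<subseteq> (\<otimes>) \<one> ` value_set \<sigma>"
      using si.value_set_carrier by (auto simp: image_iff subset_iff)
    ultimately show ?thesis using sub S.one_not_zero by (intro disjI1 exI[of _ "value_set \<sigma>"] exI[of _ "\<one>"]) auto
  next
    assume "codim1_quasi_Pfister_neighbor K \<sigma>"
    then obtain T :: "('a, nat \<Rightarrow> 'a) qform" and c where T: "totally_singular_form K T" "quasi_Pfister K T"
        "c \<in> carrier K" "c \<noteq> \<zero>" "subform K (scale_form K c \<sigma>) T"
        "form_dim K T < 2 * form_dim K \<sigma>" "form_dim K T - form_dim K \<sigma> = 1"
      unfolding codim1_quasi_Pfister_neighbor_def quasi_Pfister_neighbor_of_def by blast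
    let ?Q = "value_set T" and ?H = "(\<otimes>) c ` value_set \<sigma>"
    note Q = quasi_Pfister_values[OF T(1,2)]
    have fQ: "S.finite_dimension (squares K) ?Q"
      using value_dim(1)[OF T(1)] by (auto simp: S.finite_dimension_def)
    have dQ: "S.dim (squares K) ?Q \<le> form_dim K T"
      using value_dim(2)[OF T(1)] by (simp add: value_dim_def)
    have ds: "S.dim (squares K) (value_set \<sigma>) = form_dim K \<sigma>" using dim by (simp add: value_dim_def)
    have H: "?H \<subseteq> ?Q"
    proof -
      have "value_set (scale_form K c \<sigma>) \<subseteq> value_set T"
        using T(5) linear_mapD(1) unfolding subform_def value_set_def by fastforce
      then show ?thesis using scale_form_totally_singular(3)[OF si T(3)] by simp
    qed
    have aS: "subalgebra (squares K) (value_set \<sigma>) K"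
      by (rule S.finite_dimension_imp_subalgebra[OF S.G fs])
    have aH: "subalgebra (squares K) ?H K" by (rule S.subalgebra_smult[OF S.G aS T(3)])
    have dH: "S.dim (squares K) ?H = form_dim K \<sigma>" using S.dim_smult[OF S.G T(3,4) fs] ds by simp
    have QP: "?Q \<subseteq> value_set \<pi>"
    proof
      fix q assume q: "q \<in> ?Q"
      show "q \<in> value_set \<pi>"
      proof (cases "q = \<zero>")
        case True then show ?thesis using piD(2) by simp
      next
        case False
        obtain h h' where h: "h \<in> ?H" "h' \<in> ?H" "h' \<noteq> \<zero>" "q \<otimes> h' = h"
          using S.large_part_of_field[OF Q fQ aH H _ q False] dH dQ T(6) by auto
        obtain s s' where s: "s \<in> value_set \<sigma>" "h = c \<otimes> s" "s' \<in> value_set \<sigma>" "h' = c \<otimes> s'"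
          using h(1,2) by blast
        have cc: "q \<in> carrier K" "s \<in> carrier K" "s' \<in> carrier K"
          using q s si.value_set_carrier S.subfieldD(1)[OF Q(1)] by auto
        have s0: "s' \<noteq> \<zero>" using h(3) s(4) T(3) by auto
        note s' = S.nonzero_inverse[OF cc(3) s0]
        have "c \<otimes> (q \<otimes> s') = c \<otimes> s" using h(4) unfolding s(2,4) using cc T(3) by (simp add: S.m_lcomm)
        then have "q \<otimes> s' = s" using S.m_lcancel[OF T(4,3)] cc by simp
        moreover have "q = (q \<otimes> s') \<otimes> inv s'" using cc s' by (simp add: S.m_assoc)
        ultimately have "q = s \<otimes> inv s'" by simp
        then show ?thesis using piD(7)[OF _ piD(8)[OF _ s0]] s(1,3) sub by blast
      qed
    qed
    note c' = S.nonzero_inverse[OF T(3,4)]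
    have "value_set \<sigma> = (\<otimes>) (inv c) ` ?H"
      using S.smult_inv_image(1)[OF T(3,4) si.value_set_carrier] by simp
    then have "value_set \<sigma> \<subseteq> (\<otimes>) (inv c) ` ?Q" using image_mono[OF H] by metis
    moreover have "S.dim (squares K) ?Q \<le> Suc (S.dim (squares K) (value_set \<sigma>))" using dQ ds T(7) by simp
    ultimately show ?thesis using Q QP c' by (intro disjI1 exI[of _ ?Q] exI[of _ "inv c"]) auto
  next
    assume m: "minimal_form K \<sigma>"
    have "norm_field K \<sigma> = S.ratio_field (value_set \<sigma>)"
      by (simp add: norm_field_def S.ratio_field_def S.gen_def nonzero_values_def value_set_def)
    then have "S.minimal_space (value_set \<sigma>)"
      using m fs dim unfolding minimal_form_def S.minimal_space_def norm_degree_def value_dim_def by simp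
    then show ?thesis by simp
  qed
qed

section \<open>Forms with a special neighbor as anisotropic part\<close>

lemma subfield_vimage:
  assumes "field F" "field K" "i \<in> ring_hom F K" "subfield N K"
  shows "subfield {x \<in> carrier F. i x \<in> N} F"
proof -
  interpret F: field F by fact
  interpret K: field K by fact
  interpret ir: ring_hom_ring F K i by (rule ring_hom_ringI2[OF F.ring_axioms K.ring_axioms assms(3)])
  interpret i: ring_hom_cring F K i by (intro ring_hom_cringI F.is_cring K.is_cring assms(3))
  note ND = K.subfieldD[OF assms(4)]
  have inj: "inj_on i (carrier F)"
    by (rule ir.img_is_subfield(1)[OF F.carrier_is_subfield K.one_not_zero])
  show ?thesis
  proof (rule F.subfieldI')
    show "subring {x \<in> carrier F. i x \<in> N} F"
      by (rule F.subringI) (use ND in auto)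
    fix x assume "x \<in> {x \<in> carrier F. i x \<in> N} - {\<zero>\<^bsub>F\<^esub>}"
    then have x: "x \<in> carrier F" "x \<noteq> \<zero>\<^bsub>F\<^esub>" "i x \<in> N" by auto
    note x' = F.nonzero_inverse[OF x(1,2)]
    have ix: "i x \<noteq> \<zero>\<^bsub>K\<^esub>" using inj_onD[OF inj, of x "\<zero>\<^bsub>F\<^esub>"] x by auto
    have "i x \<otimes>\<^bsub>K\<^esub> i (inv\<^bsub>F\<^esub> x) = \<one>\<^bsub>K\<^esub>"
      using i.hom_mult[OF x(1) x'(1)] x'(4) by simp
    then have "inv\<^bsub>K\<^esub> (i x) = i (inv\<^bsub>F\<^esub> x)" using x x' by (intro K.comm_inv_char) auto
    then show "inv\<^bsub>F\<^esub> x \<in> {x \<in> carrier F. i x \<in> N}" using ND(8)[OF x(3) ix] x'(1) by simp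
  qed
qed

lemma squares_vimage:
  assumes "field F" "field K" "i \<in> ring_hom F K" "squares K \<subseteq> N"
  shows "squares F \<subseteq> {x \<in> carrier F. i x \<in> N}"
proof
  interpret F: field F by fact
  interpret K: field K by fact
  interpret i: ring_hom_cring F K i by (intro ring_hom_cringI F.is_cring K.is_cring assms(3))
  fix y assume "y \<in> squares F"
  then obtain x where x: "x \<in> carrier F" "y = x [^]\<^bsub>F\<^esub> (2::nat)" unfolding squares_def by blast
  have "i y = i x [^]\<^bsub>K\<^esub> (2::nat)" using x by (simp add: numeral_2_eq_2)
  then have "i y \<in> squares K" using x(1) unfolding squares_def by auto
  then show "y \<in> {x \<in> carrier F. i x \<in> N}" using assms(4) x by auto
qed

text \<open>
  The fields between \<open>K\<^sup>2\<close> and \<open>i ` F\<close> are the images of fields \<open>M\<close> between \<open>F\<^sup>2\<close> and \<open>F\<close>, over which Vishik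
  equivalence gives equal dimensions.
\<close>

lemma base_change_same_span_dims:
  fixes F :: "'a ring" and K :: "'k ring"
  assumes F: "field F" "\<one>\<^bsub>F\<^esub> \<oplus>\<^bsub>F\<^esub> \<one>\<^bsub>F\<^esub> = \<zero>\<^bsub>F\<^esub>"
    and P: "totally_singular_form F P" and Q: "totally_singular_form F Q"
    and v: "vishik_equivalent F P Q"
    and K: "field K" and i: "i \<in> ring_hom F K"
  shows "square_closed_subfield.same_span_dims K (squares K) (i ` carrier F)
    (value_set (base_change F K i P)) (value_set (base_change F K i Q))"
proof -
  note char2 = hom_char2[OF F(1) K i F(2)]
  interpret S: square_closed_subfield K "squares K" by (rule squares_square_closed[OF K char2])
  interpret F: field F by (rule F(1))
  interpret i: ring_hom_cring F K i by (intro ring_hom_cringI F.is_cring S.is_cring i)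
  show ?thesis
    unfolding S.same_span_dims_def
  proof (intro allI impI)
    fix N assume N: "subfield N K" "squares K \<subseteq> N" "N \<subseteq> i ` carrier F" "S.finite_dimension (squares K) N"
    define M where "M = {x \<in> carrier F. i x \<in> N}"
    have M: "subfield M F" unfolding M_def by (rule subfield_vimage[OF F(1) K i N(1)])
    have iM: "i ` M = N" unfolding M_def using N(3) by blast
    have sqM: "squares F \<subseteq> M"
      unfolding M_def by (rule squares_vimage[OF F(1) K i N(2)])
    have sK: "squares K \<subseteq> i ` M" using N(2) iM by simp
    have dims: "S.dim (squares K) (S.subspan N (value_set (base_change F K i X))) =
        S.dim (squares K) N * F.dim M (F.subspan M (value_set X))"
      if X: "totally_singular_form F X" for X :: "('a, 'x) qform"
    proof -
      have d: "S.dimension (F.dim M (F.subspan M (value_set X))) N (S.subspan N (value_set (base_change F K i X)))"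
        using base_change_values(3)[OF X K i M sqM sK] unfolding iM .
      then have "S.finite_dimension N (S.subspan N (value_set (base_change F K i X)))"
        by (rule S.finite_dimensionI)
      from S.dim_tower(2)[OF S.G N(1,4) this] show ?thesis using S.dim_eqI[OF N(1) d] by simp
    qed
    show "S.dim (squares K) (S.subspan N (value_set (base_change F K i P))) =
        S.dim (squares K) (S.subspan N (value_set (base_change F K i Q)))"
      unfolding dims[OF P] dims[OF Q] vishik_equivalent_subspan_dim[OF F(1) P Q v M sqM] ..
  qed
qed

theorem corollary4p18:
  fixes F :: "'a ring" and K :: "'k ring" and i :: "'a \<Rightarrow> 'k"
    and \<phi> :: "('a, 'v) qform" and \<psi> :: "('a, 'w) qform"
    and \<phi>an :: "('k, 'x) qform" and \<pi> :: "('k, 'y) qform" and \<sigma> :: "('k, 'z) qform"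
    and b c :: 'k
  assumes "field F" and "\<one>\<^bsub>F\<^esub> \<oplus>\<^bsub>F\<^esub> \<one>\<^bsub>F\<^esub> = \<zero>\<^bsub>F\<^esub>"
    and "totally_singular_form F \<phi>" and "totally_singular_form F \<psi>"
    and "vishik_equivalent F \<phi> \<psi>"
    and "field K" and "i \<in> ring_hom F K"
    and "squares K = i ` similarity_factors F \<phi>"
    and "anisotropic_part K (base_change F K i \<phi>) \<phi>an"
    and "special_quasi_Pfister_neighbor K \<phi>an \<pi> b \<sigma>"
    and "c \<in> nonzero K" and "subform K (scale_form K c \<pi>) (base_change F K i \<psi>)"
    and "quasi_Pfister K \<sigma> \<or> codim1_quasi_Pfister_neighbor K \<sigma> \<or> minimal_form K \<sigma>"
  shows "similar F \<phi> \<psi>"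
proof -
  note F = assms(1,2) and P = assms(3) and Q = assms(4) and v = assms(5) and K = assms(6) and i = assms(7)
    and G = assms(8) and cases = assms(13)
  note char2 = hom_char2[OF F(1) K i F(2)]
  interpret S: square_closed_subfield K "squares K" by (rule squares_square_closed[OF K char2])
  interpret F: field F by (rule F(1))
  interpret P: totally_singular_form F \<phi> by (rule P)
  interpret Q: totally_singular_form F \<psi> by (rule Q)
  interpret ir: ring_hom_ring F K i by (rule ring_hom_ringI2[OF F.ring_axioms S.ring_axioms i])
  interpret ic: ring_hom_cring F K i by (intro ring_hom_cringI F.is_cring S.is_cring i)
  have inj: "inj_on i (carrier F)"
    by (rule ir.img_is_subfield(1)[OF F.carrier_is_subfield S.one_not_zero])
  have L: "subfield (i ` carrier F) K"
    by (rule ir.img_is_subfield(2)[OF F.carrier_is_subfield S.one_not_zero])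

  define M where "M = similarity_factors F \<phi>"
  have Mc: "M \<subseteq> carrier F" unfolding M_def similarity_factors_def by auto
  have iM: "i ` M = squares K" unfolding M_def using G by simp
  have M_eq: "M = {x \<in> carrier F. i x \<in> squares K}"
    unfolding iM[symmetric] using Mc inj by (auto simp: inj_on_def)
  have M: "subfield M F" unfolding M_eq by (rule subfield_vimage[OF F(1) K i S.G])
  have sqM: "squares F \<subseteq> M"
    unfolding M_eq by (rule squares_vimage[OF F(1) K i order_refl])
  have Pvs: "subalgebra (squares F) (value_set \<phi>) F" and Qvs: "subalgebra (squares F) (value_set \<psi>) F"
    using value_dim(1)[OF P] value_dim(1)[OF Q]
    by (auto intro!: F.finite_dimension_imp_subalgebra[OF P.subfield_squares] simp: F.finite_dimension_def)
  note PD = F.subalgebraD[OF Pvs] and QD = F.subalgebraD[OF Qvs]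
  have "subalgebra M (value_set \<phi>) F"
  proof (rule F.subalgebraI[OF M PD(1-3)])
    fix g y assume g: "g \<in> M" and y: "y \<in> value_set \<phi>"
    show "g \<otimes>\<^bsub>F\<^esub> y \<in> value_set \<phi>"
    proof (cases "g = \<zero>\<^bsub>F\<^esub>")
      case True
      then show ?thesis using y PD(1,2) by auto
    next
      case False
      then have gi: "isometric F (scale_form F g \<phi>) \<phi>" and gc: "g \<in> carrier F"
        using g unfolding M_def similarity_factors_def by auto
      note sc = scale_form_totally_singular[OF P gc]
      have "(\<otimes>\<^bsub>F\<^esub>) g ` value_set \<phi> = value_set \<phi>"
        using gi unfolding isometric_iff[OF sc(1) P] sc(3) by simp
      then show ?thesis using y by blast
    qed
  qed
  \<comment> \<open>\<open>D(\<phi>)\<close> is closed under similarity factors, so it does not grow over \<open>K\<close>\<close>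
  then have stab: "F.subspan M (value_set \<phi>) = value_set \<phi>" by (rule F.subspan_self)

  let ?PK = "base_change F K i \<phi>" and ?QK = "base_change F K i \<psi>"
  have PK: "totally_singular_form K ?PK" and QK: "totally_singular_form K ?QK"
    by (rule base_change_totally_singular[OF P K i] base_change_totally_singular[OF Q K i])+
  have fPK: "S.finite_dimension (squares K) (value_set ?PK)" and fQK: "S.finite_dimension (squares K) (value_set ?QK)"
    using value_dim(1)[OF PK] value_dim(1)[OF QK] by (auto simp: S.finite_dimension_def)
  have sK: "squares K \<subseteq> i ` M" using iM by simp
  have vPK: "value_set ?PK = i ` value_set \<phi>"
    using base_change_values(1)[OF P K i M sqM sK] S.subspan_self[OF S.finite_dimension_imp_subalgebra[OF S.G fPK]]
    unfolding iM stab by simp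
  have vQK: "value_set ?QK = i ` F.subspan M (value_set \<psi>)"
    using base_change_values(1)[OF Q K i M sqM sK] S.subspan_self[OF S.finite_dimension_imp_subalgebra[OF S.G fQK]]
    unfolding iM by simp

  obtain k where k: "anisotropic_decomposition K ?PK \<phi>an k" using assms(9) unfolding anisotropic_part_def by blast
  note an = anisotropic_decomposition_values[OF PK k]
  have pi: "totally_singular_form K \<pi>" and si: "totally_singular_form K \<sigma>" and qp: "quasi_Pfister K \<pi>"
    and b: "b \<in> carrier K" "b \<noteq> \<zero>\<^bsub>K\<^esub>"
    using assms(10) unfolding special_quasi_Pfister_neighbor_def by auto
  note sn = special_neighbor_values[OF assms(10) an(2)]
  obtain e where e: "e \<in> carrier K" "e \<noteq> \<zero>\<^bsub>K\<^esub>"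
      "value_set ?PK = (\<otimes>\<^bsub>K\<^esub>) e ` (value_set \<pi> <+>\<^bsub>K\<^esub> (\<otimes>\<^bsub>K\<^esub>) b ` value_set \<sigma>)"
    using sn(1) unfolding an(4) by blast
  note piF = quasi_Pfister_values[OF pi qp]
  have fpi: "S.finite_dimension (squares K) (value_set \<pi>)" and fsi: "S.finite_dimension (squares K) (value_set \<sigma>)"
    using value_dim(1)[OF pi] value_dim(1)[OF si] by (auto simp: S.finite_dimension_def)
  have c: "c \<in> carrier K" "c \<noteq> \<zero>\<^bsub>K\<^esub>" using assms(11) by auto
  have cpi: "(\<otimes>\<^bsub>K\<^esub>) c ` value_set \<pi> \<subseteq> value_set ?QK"
  proof -
    have "value_set (scale_form K c \<pi>) \<subseteq> value_set ?QK"
      using assms(12) linear_mapD(1) unfolding subform_def value_set_def by fastforce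
    then show ?thesis using scale_form_totally_singular(3)[OF pi c(1)] by simp
  qed
  have PL: "value_set ?PK \<subseteq> i ` carrier F" unfolding vPK using PD(1) by blast
  obtain x where x: "x \<in> carrier K" "x \<noteq> \<zero>\<^bsub>K\<^esub>" "value_set ?QK = (\<otimes>\<^bsub>K\<^esub>) x ` value_set ?PK"
    using S.similar_spaces[OF piF fpi b sn(2) S.finite_dimension_imp_subalgebra[OF S.G fsi] sn(4) e L PL
        fQK c cpi base_change_same_span_dims[OF F P Q v K i] almost_field_or_minimal[OF pi si qp sn(3,4) cases]]
    by blast

  \<comment> \<open>\<open>x\<close> comes from \<open>F\<close>, being a ratio of values of \<open>\<psi>\<close> and \<open>\<phi>\<close> over \<open>K\<close>\<close>
  have "\<one>\<^bsub>K\<^esub> \<in> value_set \<pi>" by (rule S.subfieldD(3)[OF piF(1)])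
  moreover have "\<zero>\<^bsub>K\<^esub> \<in> (\<otimes>\<^bsub>K\<^esub>) b ` value_set \<sigma>" using sn(2) by blast
  ultimately have "\<one>\<^bsub>K\<^esub> \<oplus>\<^bsub>K\<^esub> \<zero>\<^bsub>K\<^esub> \<in> value_set \<pi> <+>\<^bsub>K\<^esub> (\<otimes>\<^bsub>K\<^esub>) b ` value_set \<sigma>"
    unfolding S.set_add_iff by blast
  then have eP: "e \<in> value_set ?PK" unfolding e(3) using e(1) by (force simp: image_iff)
  then have "x \<otimes>\<^bsub>K\<^esub> e \<in> value_set ?QK" unfolding x(3) by blast
  then have xeL: "x \<otimes>\<^bsub>K\<^esub> e \<in> i ` carrier F"
    unfolding vQK using F.subalgebraD(1)[OF F.subspan_subalgebra[OF M QD(1)]] by blast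
  note LD = S.subfieldD[OF L]
  have "x = (x \<otimes>\<^bsub>K\<^esub> e) \<otimes>\<^bsub>K\<^esub> inv\<^bsub>K\<^esub> e" using x(1) e S.nonzero_inverse[OF e(1,2)] by (simp add: S.m_assoc)
  also have "\<dots> \<in> i ` carrier F" using LD(7)[OF xeL LD(8)[OF subsetD[OF PL eP] e(2)]] .
  finally obtain x0 where x0: "x0 \<in> carrier F" "x = i x0" by blast
  have x00: "x0 \<noteq> \<zero>\<^bsub>F\<^esub>" using x0 x(2) by auto
  have "i ` F.subspan M (value_set \<psi>) = i ` (\<otimes>\<^bsub>F\<^esub>) x0 ` value_set \<phi>"
    using x(3) unfolding vPK vQK x0(2) image_image using x0(1) PD(1)
    by (simp add: subset_iff cong: image_cong)
  then have "F.subspan M (value_set \<psi>) = (\<otimes>\<^bsub>F\<^esub>) x0 ` value_set \<phi>"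
    by (rule inj_on_image_eq_iff[OF inj, THEN iffD1, rotated -1])
      (use F.subalgebraD(1)[OF F.subspan_subalgebra[OF M QD(1)]] PD(1) x0(1) in auto)
  then have sub: "value_set \<psi> \<subseteq> (\<otimes>\<^bsub>F\<^esub>) x0 ` value_set \<phi>" using F.subspan_incl by blast

  \<comment> \<open>equality holds because the dimensions over \<open>F\<^sup>2\<close> agree\<close>
  note sqF = P.subfield_squares
  have fP: "F.finite_dimension (squares F) (value_set \<phi>)"
    using value_dim(1)[OF P] by (auto simp: F.finite_dimension_def)
  have "F.dim (squares F) (value_set \<psi>) = F.dim (squares F) (value_set \<phi>)"
    using vishik_equivalent_subspan_dim[OF F(1) P Q v sqF order_refl]
    unfolding F.subspan_self[OF Pvs] F.subspan_self[OF Qvs] by simp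
  then have "value_set \<psi> = (\<otimes>\<^bsub>F\<^esub>) x0 ` value_set \<phi>"
    using F.dim_subspace(3)[OF sqF F.finite_dimension_smult[OF sqF x0(1) x00 fP] Qvs sub]
      F.dim_smult[OF sqF x0(1) x00 fP] by simp
  moreover have "form_dim F \<phi> = form_dim F \<psi>" using v unfolding vishik_equivalent_def by blast
  ultimately show ?thesis using similar_of_value_sets[OF P Q] x0(1) x00 by blast
qed

end
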